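(* (1) For $L=\mathrm{E}_7$ or $L=\mathrm{E}_8$, and for $1\le i\le 3$, the group $\mathrm{SO}(L)$ acts transitively on the set of $(\mathbb{Z}/2\mathbb{Z})^i$-neighbours of $L$. (2) For $L=\mathrm{E}_7$ or $L=\mathrm{E}_8$, the group $\mathrm{SO}(L)$ acts transitively on the set of $\mathbb{Z}/4\mathbb{Z}$-neighbours of $L$. (3) There are exactly two orbits of $(\mathbb{Z}/2\mathbb{Z})^4$-neighbours of $\mathrm{E}_8$ under the action of $\mathrm{SO}(\mathrm{E}_8)$, and their union is the unique orbit of $(\mathbb{Z}/2\mathbb{Z})^4$-neighbours of $\mathrm{E}_8$ under the action of $\mathrm{O}(\mathrm{E}_8)$.
   Context: $\mathrm{D}_8=\{(x_i)\in\mathbb{Z}^8:\sum_i x_i\equiv0\bmod2\}$, $\mathrm{E}_8=\mathrm{D}_8+\mathbb{Z}e\subset\mathbb{R}^8$ with $e=\frac12(1,\dots,1)$, and $\mathrm{E}_7=\{(x_i)\in\mathrm{E}_8:\sum_i x_i=0\}$, viewed as a lattice in the $7$-dimensional Euclidean space $e^\perp\simeq\mathbb{R}^7$. The inner product is the usual one. For $n\equiv0,\pm1\bmod8$, $\mathcal{L}_n$ is the set of even lattices $L\subset\mathbb{R}^n$ (integral with $x\cdot x\in2\mathbb{Z}$ for all $x\in L$) with $\det(L)=1$ if $n$ is even and $\det(L)=2$ if $n$ is odd; thus $\mathrm{E}_7\in\mathcal{L}_7$ and $\mathrm{E}_8\in\mathcal{L}_8$. For a finite abelian group $A$, two lattices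 $L_1,L_2\in\mathcal{L}_n$ are $A$-neighbours if $L_1/(L_1\cap L_2)\simeq L_2/(L_1\cap L_2)\simeq A$. $\mathrm{O}(L)$ (resp. $\mathrm{SO}(L)$) is the group of $g\in\mathrm{O}_n(\mathbb{R})$ (resp. $\mathrm{SO}_n(\mathbb{R})$) with $gL=L$; it acts naturally on the set of $A$-neighbours of $L$. *)

theory Defs
  imports
    "HOL-Analysis.Analysis"
    "HOL-Algebra.Elementary_Groups"
    "HOL-Algebra.Product_Groups"
    "HOL-Algebra.Group_Action"
begin

section \<open>Lattices in Euclidean space\<close>

definition lattice_basis :: "('n::finite \<Rightarrow> real^'n) \<Rightarrow> (real^'n) set \<Rightarrow> bool" where
  "lattice_basis b L \<longleftrightarrow>
     inj b \<and> independent (range b) \<and> L = {\<Sum>i\<in>UNIV. of_int (c i) *\<^sub>R b i | c :: 'n \<Rightarrow> int. True}"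

definition is_lattice :: "(real^'n) set \<Rightarrow> bool" where
  "is_lattice L \<longleftrightarrow> (\<exists>b. lattice_basis b L)"

definition gram_matrix :: "('n::finite \<Rightarrow> real^'n) \<Rightarrow> real^'n^'n" where
  "gram_matrix b = (\<chi> i j. b i \<bullet> b j)"

text \<open>The choice of basis is immaterial, see \<open>lattice_det_eq\<close> below.\<close>

definition lattice_det :: "(real^'n) set \<Rightarrow> real" where
  "lattice_det L = det (gram_matrix (SOME b. lattice_basis b L))"

definition even_lattice :: "(real^'n) set \<Rightarrow> bool" where
  "even_lattice L \<longleftrightarrow> is_lattice L \<and> (\<forall>x\<in>L. \<forall>y\<in>L. x \<bullet> y \<in> \<int>)
     \<and> (\<forall>x\<in>L. \<exists>k::int. x \<bullet> x = 2 * of_int k)"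

text \<open>The family \<open>\<L>\<^sub>n\<close>, where \<open>n\<close> is the cardinality of the index type. It is meant
  for \<open>n\<close> congruent to \<open>0\<close>, \<open>1\<close> or \<open>-1\<close> modulo \<open>8\<close>.\<close>

definition even_lattices :: "(real^'n) set set" where
  "even_lattices = {L. even_lattice L \<and> lattice_det L = (if even CARD('n) then 1 else 2)}"

section \<open>Neighbours\<close>

definition additive_group :: "'a::ab_group_add set \<Rightarrow> 'a monoid" where
  "additive_group L = \<lparr>carrier = L, monoid.mult = (+), one = 0\<rparr>"

definition neighbours :: "('b, 'c) monoid_scheme \<Rightarrow> (real^'n) set \<Rightarrow> (real^'n) set set" where
  "neighbours A L = {N. L \<in> even_lattices \<and> N \<in> even_lattices
     \<and> additive_group L Mod (L \<inter> N) \<cong> A \<and> additive_group N Mod (L \<inter> N) \<cong> A}"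

definition elementary_2_group :: "nat \<Rightarrow> (nat \<Rightarrow> int) monoid" where
  "elementary_2_group i = product_group {..<i} (\<lambda>_. integer_mod_group 2)"

section \<open>Orthogonal groups of lattices and their action on neighbours\<close>

definition orth_group :: "(real^'n) set \<Rightarrow> (real^'n^'n) monoid" where
  "orth_group L = \<lparr>carrier = {g. orthogonal_matrix g \<and> (\<lambda>x. g *v x) ` L = L},
     monoid.mult = (\<lambda>g h. g ** h), one = mat 1\<rparr>"

text \<open>\<^const>\<open>rotation_matrix\<close> means orthogonal of determinant \<open>1\<close>.\<close>

definition special_orth_group :: "(real^'n) set \<Rightarrow> (real^'n^'n) monoid" where
  "special_orth_group L = \<lparr>carrier = {g. rotation_matrix g \<and> (\<lambda>x. g *v x) ` L = L},
     monoid.mult = (\<lambda>g h. g ** h), one = mat 1\<rparr>"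

text \<open>The restriction is needed since \<^const>\<open>BijGroup\<close> consists of extensional functions.\<close>

definition neighbour_action ::
    "('b, 'c) monoid_scheme \<Rightarrow> (real^'n) set \<Rightarrow> real^'n^'n \<Rightarrow> (real^'n) set \<Rightarrow> (real^'n) set" where
  "neighbour_action A L g = (\<lambda>N\<in>neighbours A L. (\<lambda>x. g *v x) ` N)"

text \<open>Transitivity means that there is exactly one orbit; the locale \<^locale>\<open>transitive_action\<close>
  by itself also admits the empty set.\<close>

definition SO_transitive_on_neighbours ::
    "('b, 'c) monoid_scheme \<Rightarrow> (real^'n) set \<Rightarrow> bool" where
  "SO_transitive_on_neighbours A L \<longleftrightarrow> neighbours A L \<noteq> {}
     \<and> transitive_action (special_orth_group L) (neighbours A L) (neighbour_action A L)"

section \<open>The lattices \<open>E\<^sub>8\<close> and \<open>E\<^sub>7\<close>\<close>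

definition D8 :: "(real^8) set" where
  "D8 = {x. (\<forall>i. x $ i \<in> \<int>) \<and> (\<exists>k::int. (\<Sum>i\<in>UNIV. x $ i) = 2 * of_int k)}"

definition half_ones :: "real^8" where
  "half_ones = (\<chi> i. 1 / 2)"

definition E8 :: "(real^8) set" where
  "E8 = {x + of_int m *\<^sub>R half_ones | x (m::int). x \<in> D8}"

definition E7 :: "(real^8) set" where
  "E7 = {x \<in> E8. (\<Sum>i\<in>UNIV. x $ i) = 0}"

text \<open>To view \<^const>\<open>E7\<close> as a lattice in a 7-dimensional Euclidean space, identify the
  hyperplane orthogonal to \<^const>\<open>half_ones\<close> with \<open>\<real>\<^sup>7\<close> by a linear isometry \<open>\<iota>\<close>; the
  lattice is then \<open>\<iota> -` E7\<close>.\<close>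

definition hyperplane_isometry :: "(real^7 \<Rightarrow> real^8) \<Rightarrow> bool" where
  "hyperplane_isometry \<iota> \<longleftrightarrow>
     linear \<iota> \<and> (\<forall>x y. \<iota> x \<bullet> \<iota> y = x \<bullet> y) \<and> range \<iota> = {x. x \<bullet> half_ones = 0}"

section \<open>Well-definedness\<close>

lemma hyperplane_isometry_exists: "\<exists>\<iota>. hyperplane_isometry \<iota>"
proof -
  let ?H = "{x::real^8. x \<bullet> half_ones = 0}"
  have H: "?H = {x. half_ones \<bullet> x = 0}" by (auto simp: inner_commute)
  have nz: "half_ones \<noteq> 0" by (simp add: half_ones_def vec_eq_iff)
  have sub: "subspace ?H" unfolding H by (rule subspace_hyperplane)
  have "dim ?H = 7" unfolding H using dim_hyperplane[OF nz] by simp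
  then have dim: "dim (UNIV::(real^7) set) = dim ?H" by simp
  obtain f :: "real^7 \<Rightarrow> real^8" where
    f: "linear f" "f ` UNIV = ?H" "\<And>x. x \<in> UNIV \<Longrightarrow> norm (f x) = norm x"
    by (rule isometry_subspaces[OF subspace_UNIV sub dim]) blast
  have "f x \<bullet> f y = x \<bullet> y" for x y
    unfolding dot_norm linear_add[OF f(1), symmetric] using f(3) by simp
  with f(1,2) show ?thesis unfolding hyperplane_isometry_def by blast
qed

lemma gram_matrix_eq: "gram_matrix b = (\<chi> i. b i) ** transpose (\<chi> i. b i)"
  by (simp add: gram_matrix_def matrix_matrix_mult_def transpose_def vec_eq_iff inner_vec_def)

lemma lattice_basis_transition:
  fixes b b' :: "'n::finite \<Rightarrow> real^'n"
  assumes "lattice_basis b L" "lattice_basis b' L"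
  obtains U :: "int^'n^'n" where
    "(\<chi> i. b' i) = (\<chi> i j. of_int (U $ i $ j)) ** (\<chi> i. b i)"
proof -
  have L: "L = {\<Sum>i\<in>UNIV. of_int (c i) *\<^sub>R b i | c :: 'n \<Rightarrow> int. True}"
    using assms(1) by (simp add: lattice_basis_def)
  have L': "(\<Sum>i\<in>UNIV. of_int (c i) *\<^sub>R b' i) \<in> L" for c :: "'n \<Rightarrow> int"
    using assms(2) by (auto simp: lattice_basis_def)
  have "\<exists>c :: 'n \<Rightarrow> int. b' i = (\<Sum>j\<in>UNIV. of_int (c j) *\<^sub>R b j)" for i
  proof -
    have "b' i = (\<Sum>j\<in>UNIV. of_int (if j = i then 1 else 0) *\<^sub>R b' j)"
    proof -
      have "(\<Sum>j\<in>UNIV. of_int (if j = i then 1 else 0) *\<^sub>R b' j)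
          = (\<Sum>j\<in>UNIV. if j = i then b' j else 0)"
        by (rule sum.cong) auto
      then show ?thesis by simp
    qed
    then have "b' i \<in> L"
      using L'[of "\<lambda>j. if j = i then 1 else 0"] by (simp only:)
    then show ?thesis unfolding L by blast
  qed
  then obtain C :: "'n \<Rightarrow> 'n \<Rightarrow> int" where
    C: "\<And>i. b' i = (\<Sum>j\<in>UNIV. of_int (C i j) *\<^sub>R b j)" by metis
  show ?thesis
    by (rule that[of "\<chi> i j. C i j"])
      (simp add: C matrix_matrix_mult_def vec_eq_iff)
qed

lemma det_of_int_in_Ints: "det (\<chi> i j. of_int (U $ i $ j) :: real^'n^'n) \<in> \<int>"
  unfolding det_def by (auto intro!: Ints_sum Ints_mult Ints_prod)

lemma lattice_det_eq:
  fixes b :: "'n::finite \<Rightarrow> real^'n"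
  assumes "lattice_basis b L"
  shows "lattice_det L = det (gram_matrix b)"
proof -
  define b' where "b' = (SOME b. lattice_basis b L)"
  have b': "lattice_basis b' L" unfolding b'_def using assms by (rule someI[of "\<lambda>b. lattice_basis b L"])
  let ?B = "\<chi> i. b i" and ?B' = "\<chi> i. b' i"
  obtain U :: "int^'n^'n" where U: "?B' = (\<chi> i j. of_int (U $ i $ j)) ** ?B"
    using lattice_basis_transition[OF assms b'] .
  obtain V :: "int^'n^'n" where V: "?B = (\<chi> i j. of_int (V $ i $ j)) ** ?B'"
    using lattice_basis_transition[OF b' assms] .
  define u v where "u = det (\<chi> i j. of_int (U $ i $ j) :: real^'n^'n)"
    and "v = det (\<chi> i j. of_int (V $ i $ j) :: real^'n^'n)"
  have 1: "det ?B' = u * det ?B" by (subst U) (simp only: det_mul u_def)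
  have 2: "det ?B = v * det ?B'" by (subst V) (simp only: det_mul v_def)
  have "(det ?B')\<^sup>2 = (det ?B)\<^sup>2"
  proof (cases "det ?B = 0")
    case False
    have "(v * u) * det ?B = 1 * det ?B" using 2[unfolded 1, symmetric] by (simp only: mult.assoc mult_1)
    then have "u * v = 1" using False by (simp add: mult.commute)
    moreover obtain k l :: int where "u = of_int k" "v = of_int l"
      using det_of_int_in_Ints[of U] det_of_int_in_Ints[of V] by (auto simp: u_def v_def elim!: Ints_cases)
    ultimately have "k * l = 1" by (metis of_int_eq_1_iff of_int_mult)
    then have "k = 1 \<or> k = -1" by (auto simp: zmult_eq_1_iff)
    with \<open>u = of_int k\<close> 1 show ?thesis by (auto simp: power2_eq_square)
  qed (simp add: 1)
  then show ?thesis
    by (simp add: lattice_det_def b'_def[symmetric] gram_matrix_eq det_mul det_transpose power2_eq_square)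
qed

end

theory Submission
  imports Defs
begin

text \<open>Every \<open>(\<int>/2)\<^sup>i\<close>-neighbour of \<open>E\<^sub>8\<close> arises by successively adjoining vectors \<open>y\<^sub>1, \<dots>, y\<^sub>i\<close>
  with \<open>2y\<^sub>j \<in> E\<^sub>8\<close>, each time keeping only the old vectors which pair integrally with the new one; a
  \<open>\<int>/4\<close>-neighbour is generated in the same way by one vector \<open>y\<close> with \<open>4y \<in> E\<^sub>8\<close>. Neighbours of \<open>E\<^sub>7\<close> are
  orthogonal sections of such chains, with the \<open>y\<^sub>j\<close> orthogonal to the root \<open>half_ones\<close>. Reflections in roots
  common to \<open>E\<^sub>8\<close> and the neighbour constructed so far move \<open>y\<^sub>1, y\<^sub>2, \<dots>\<close> one after the other to standard
  vectors while fixing a root \<open>\<alpha>\<close> in both lattices. For \<open>E\<^sub>7\<close>, take \<open>\<alpha> = half_ones\<close>, which brings the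
  isometries back to \<open>E\<^sub>7\<close>, and correct the determinant by \<open>-1\<close>. For \<open>E\<^sub>8\<close>, such a root exists by the
  pigeonhole principle if \<open>i \<le> 3\<close>, and the reflection in \<open>\<alpha>\<close> corrects the determinant.

  For \<open>i = 4\<close> there is no common root. In a basis of \<open>E\<^sub>8\<close> adapted to the neighbour, an element of the
  stabiliser is block triangular modulo \<open>4\<close>, with diagonal blocks inverse transposes of each other; so its
  determinant is \<open>1\<close> modulo \<open>4\<close>, and the orbit under the orthogonal group splits into two.\<close>

section \<open>Even lattices and chains of neighbours\<close>

text \<open>Moving a whole subspace of E8/2E8 at once would call for Witt's theorem; adjoining one
  vector at a time replaces it by congruences between coordinates. The price is that each step may
  use only reflections preserving everything built so far, and this dictates the standard
  generators. In units of 1/2, the coordinates of \<open>t1\<close>, ..., \<open>t4\<close> have the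
  parities 11111111, 11110000, 00111100, 10101010, which span the extended Hamming code. A root e_i
  + e_j or e_i - e_j survives in a neighbour exactly when each of its generators has equal parities
  at i and j. After \<open>t1\<close> all pairs survive, after \<open>t2\<close> the pairs inside
  either half, after \<open>t3\<close> only {1,2}, {3,4}, {5,6}, {7,8}, and \<open>t4\<close>
  separates each of these. The tracked root \<open>\<alpha>0\<close> = e_1 + e_2 belongs to the
  first pair, which is why it lasts for exactly three steps. For i = 4 the congruence has to be
  modulo 4, since 1 and -1 agree modulo 2. The factor 4 comes from two halves: if v/2 and w/2 lie in
  an integral lattice, then v.w is divisible by 4.\<close>

definition subgrp :: "'a::real_vector set \<Rightarrow> bool" where
  "subgrp L \<longleftrightarrow> 0 \<in> L \<and> (\<forall>x\<in>L. \<forall>y\<in>L. x - y \<in> L)"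

definition even_norm :: "'a::real_inner \<Rightarrow> bool" where
  "even_norm x \<longleftrightarrow> (\<exists>k::int. x \<bullet> x = 2 * of_int k)"

text \<open>Neither a basis nor full rank is required, so that the images in R^8 of lattices of rank
  7 are covered.\<close>

definition even_group :: "'a::real_inner set \<Rightarrow> bool" where
  "even_group L \<longleftrightarrow> subgrp L \<and> (\<forall>x\<in>L. \<forall>y\<in>L. x \<bullet> y \<in> \<int>) \<and> (\<forall>x\<in>L. even_norm x)"

lemma subgrp_0: "subgrp L \<Longrightarrow> 0 \<in> L"
  and subgrp_diff: "subgrp L \<Longrightarrow> x \<in> L \<Longrightarrow> y \<in> L \<Longrightarrow> x - y \<in> L"
  by (auto simp: subgrp_def)

lemma subgrp_minus: "subgrp L \<Longrightarrow> x \<in> L \<Longrightarrow> - x \<in> L"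
  using subgrp_diff[of L 0 x] subgrp_0[of L] by simp

lemma subgrp_add: "subgrp L \<Longrightarrow> x \<in> L \<Longrightarrow> y \<in> L \<Longrightarrow> x + y \<in> L"
  using subgrp_diff[of L x "- y"] subgrp_minus[of L y] by simp

lemma subgrp_int:
  assumes "subgrp L" "x \<in> L" shows "of_int k *\<^sub>R x \<in> L"
proof -
  have n: "of_nat m *\<^sub>R x \<in> L" for m
    by (induction m) (auto simp: scaleR_add_left subgrp_0 subgrp_add assms)
  show ?thesis
  proof (cases k)
    case (nonneg n) then show ?thesis using n[of n] by simp
  next
    case (neg m) then show ?thesis
      using subgrp_minus[OF assms(1) n[of "Suc m"]] by (simp del: of_nat_Suc)
  qed
qed

lemma even_groupD:
  assumes "even_group L"
  shows "subgrp L" "\<And>x y. x \<in> L \<Longrightarrow> y \<in> L \<Longrightarrow> x \<bullet> y \<in> \<int>" "\<And>x. x \<in> L \<Longrightarrow> even_norm x"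
  using assms by (auto simp: even_group_def)

text \<open>The neighbour of \<open>K\<close> generated by \<open>y\<close>, and its iteration; the last vector of a list is adjoined first.
  A chain consists of vectors of order \<open>2\<close> which are independent modulo \<open>L\<close> in the sense needed for the
  successive steps.\<close>

definition nbr :: "'a::real_inner set \<Rightarrow> 'a \<Rightarrow> 'a set" where
  "nbr K y = {x + of_int k *\<^sub>R y | x k. x \<in> K \<and> x \<bullet> y \<in> \<int>}"

fun nbrs :: "'a::real_inner set \<Rightarrow> 'a list \<Rightarrow> 'a set" where
  "nbrs L [] = L"
| "nbrs L (y # ys) = nbr (nbrs L ys) y"

fun nbr_chain :: "'a::real_inner set \<Rightarrow> 'a list \<Rightarrow> bool" where
  "nbr_chain L [] = True"
| "nbr_chain L (y # ys) \<longleftrightarrow> nbr_chain L ys \<and> 2 *\<^sub>R y \<in> L \<and> even_norm y \<and>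
     (\<forall>z\<in>set ys. y \<bullet> z \<in> \<int>) \<and> (\<forall>k\<in>nbrs L ys. y + k \<notin> L)"

lemma even_normE:
  assumes "even_norm y" obtains k :: int where "y \<bullet> y = 2 * of_int k"
  using assms by (auto simp: even_norm_def)

lemma even_norm_Ints: "even_norm y \<Longrightarrow> y \<bullet> y \<in> \<int>"
  by (auto simp: even_norm_def)

lemma nbr_even_group:
  assumes K: "even_group K" and y: "even_norm y"
  shows "even_group (nbr K y)"
  unfolding even_group_def
proof (intro conjI ballI)
  note K' = even_groupD[OF K]
  show "subgrp (nbr K y)" unfolding subgrp_def
  proof (intro conjI ballI)
    show "0 \<in> nbr K y" unfolding nbr_def using subgrp_0[OF K'(1)]
      by (intro CollectI exI[of _ 0] exI[of _ "0::int"]) auto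
    fix a b assume "a \<in> nbr K y" "b \<in> nbr K y"
    then obtain x k x' k' where a: "a = x + of_int k *\<^sub>R y" "x \<in> K" "x \<bullet> y \<in> \<int>"
      and b: "b = x' + of_int k' *\<^sub>R y" "x' \<in> K" "x' \<bullet> y \<in> \<int>" unfolding nbr_def by blast
    have "a - b = (x - x') + of_int (k - k') *\<^sub>R y" by (simp add: a b algebra_simps)
    moreover have "(x - x') \<bullet> y \<in> \<int>" using a b by (simp add: inner_diff_left)
    ultimately show "a - b \<in> nbr K y" unfolding nbr_def using subgrp_diff[OF K'(1) a(2) b(2)] by blast
  qed
  fix a assume "a \<in> nbr K y"
  then obtain x k where a: "a = x + of_int k *\<^sub>R y" "x \<in> K" "x \<bullet> y \<in> \<int>" unfolding nbr_def by blast
  {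
    fix b assume "b \<in> nbr K y"
    then obtain x' k' where b: "b = x' + of_int k' *\<^sub>R y" "x' \<in> K" "x' \<bullet> y \<in> \<int>" unfolding nbr_def by blast
    have "a \<bullet> b = x \<bullet> x' + of_int k' * (x \<bullet> y) + of_int k * (x' \<bullet> y) + of_int k * of_int k' * (y \<bullet> y)"
      by (simp add: a b inner_add_left inner_add_right inner_commute algebra_simps)
    then show "a \<bullet> b \<in> \<int>" using a b K'(2)[of x x'] even_norm_Ints[OF y] by (auto intro!: Ints_add Ints_mult)
  }
  obtain m n :: int where m: "x \<bullet> x = 2 * of_int m" and n: "y \<bullet> y = 2 * of_int n"
    using K'(3)[OF a(2)] y by (auto simp: even_norm_def)
  obtain p :: int where p: "x \<bullet> y = of_int p" using a(3) by (auto elim: Ints_cases)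
  have "a \<bullet> a = x \<bullet> x + 2 * of_int k * (x \<bullet> y) + of_int k * of_int k * (y \<bullet> y)"
    by (simp add: a inner_add_left inner_add_right inner_commute algebra_simps)
  also have "\<dots> = 2 * of_int (m + k * p + k * k * n)" by (simp add: m n p algebra_simps)
  finally show "even_norm a" unfolding even_norm_def by blast
qed

text \<open>Even norms replace an integrality hypothesis: with n = y - y' in \<open>K\<close>, the
  number 2(n.y') = y.y - y'.y' - n.n is even, so n pairs integrally with y'. Hence a generator of
  even norm matters only through its class modulo \<open>K\<close>.\<close>

lemma nbr_subset:
  assumes K: "even_group K" and y: "even_norm y" "even_norm y'" and d: "y - y' \<in> K"
  shows "nbr K y \<subseteq> nbr K y'"
proof
  note K' = even_groupD[OF K]
  fix a assume "a \<in> nbr K y"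
  then obtain x k where a: "a = x + of_int k *\<^sub>R y" "x \<in> K" "x \<bullet> y \<in> \<int>" unfolding nbr_def by blast
  define n where "n = y - y'"
  have yn: "y = y' + n" by (simp add: n_def)
  have n: "n \<in> K" using d by (simp add: n_def)
  obtain p q r :: int where "y \<bullet> y = 2 * of_int p" "y' \<bullet> y' = 2 * of_int q" "n \<bullet> n = 2 * of_int r"
    using y K'(3)[OF n] by (auto simp: even_norm_def)
  moreover have "y \<bullet> y = y' \<bullet> y' + 2 * (n \<bullet> y') + n \<bullet> n"
    by (simp add: yn inner_add_left inner_add_right inner_commute)
  ultimately have "n \<bullet> y' = of_int (p - q - r)" by simp
  then have ny: "n \<bullet> y' \<in> \<int>" by simp
  have "x \<bullet> y = x \<bullet> y' + x \<bullet> n" by (simp add: yn inner_add_right)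
  then have xy: "x \<bullet> y' \<in> \<int>" using a(3) K'(2)[OF a(2) n] by (metis Ints_diff add_diff_cancel_right')
  have "a = (x + of_int k *\<^sub>R n) + of_int k *\<^sub>R y'" by (simp add: a yn algebra_simps)
  moreover have "x + of_int k *\<^sub>R n \<in> K" using a(2) n K'(1) by (simp add: subgrp_add subgrp_int)
  moreover have "(x + of_int k *\<^sub>R n) \<bullet> y' \<in> \<int>" using xy ny by (auto simp: inner_add_left intro!: Ints_add Ints_mult)
  ultimately show "a \<in> nbr K y'" unfolding nbr_def by blast
qed

lemma nbr_cong:
  assumes K: "even_group K" and y: "even_norm y" "even_norm y'" and d: "y - y' \<in> K"
  shows "nbr K y = nbr K y'"
  using nbr_subset[OF assms] nbr_subset[OF K y(2,1)] subgrp_minus[OF even_groupD(1)[OF K] d] by auto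

text \<open>Needed for quotients Z/4, where the generator is normalised only up to sign.\<close>

lemma nbr_minus: "nbr K (- y) = nbr K y"
proof -
  have "nbr K (- y) \<subseteq> nbr K y" for y :: 'a
  proof
    fix a assume "a \<in> nbr K (- y)"
    then obtain x k where a: "a = x + of_int k *\<^sub>R (- y)" "x \<in> K" "x \<bullet> (- y) \<in> \<int>" unfolding nbr_def by blast
    have "a = x + of_int (- k) *\<^sub>R y" using a by simp
    moreover have "x \<bullet> y \<in> \<int>" using a(3) by simp
    ultimately show "a \<in> nbr K y" unfolding nbr_def using a(2) by blast
  qed
  from this[of y] this[of "- y"] show ?thesis by auto
qed

lemma orth_simps:
  assumes "orthogonal_transformation h"
  shows "h (x + y) = h x + h y" "h (c *\<^sub>R x) = c *\<^sub>R h x" "h x \<bullet> h y = x \<bullet> y" "h 0 = 0"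
    "h (x - y) = h x - h y" "h (- x) = - h x"
  using assms unfolding orthogonal_transformation_def
  by (auto simp: linear_add linear_scale linear_0 linear_diff linear_neg)

lemma even_norm_orth: "orthogonal_transformation h \<Longrightarrow> even_norm (h x) \<longleftrightarrow> even_norm x"
  by (simp add: even_norm_def orth_simps)

lemma nbr_image:
  assumes h: "orthogonal_transformation h"
  shows "h ` nbr K y = nbr (h ` K) (h y)"
proof (intro equalityI subsetI)
  fix z assume "z \<in> h ` nbr K y"
  then obtain x k where "z = h (x + of_int k *\<^sub>R y)" "x \<in> K" "x \<bullet> y \<in> \<int>" unfolding nbr_def by blast
  then show "z \<in> nbr (h ` K) (h y)" unfolding nbr_def
    by (auto simp: orth_simps[OF h] intro!: exI[of _ "h x"] exI[of _ k])
next
  fix z assume "z \<in> nbr (h ` K) (h y)"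
  then obtain x k where "z = h x + of_int k *\<^sub>R h y" "x \<in> K" "h x \<bullet> h y \<in> \<int>" unfolding nbr_def by blast
  then have "z = h (x + of_int k *\<^sub>R y)" "x + of_int k *\<^sub>R y \<in> nbr K y"
    unfolding nbr_def by (auto simp: orth_simps[OF h])
  then show "z \<in> h ` nbr K y" by blast
qed

lemma nbrs_even_group: "even_group L \<Longrightarrow> nbr_chain L ys \<Longrightarrow> even_group (nbrs L ys)"
  by (induction ys) (auto intro: nbr_even_group)

lemma nbr_memI: "x \<in> K \<Longrightarrow> x \<bullet> y \<in> \<int> \<Longrightarrow> x \<in> nbr K y"
  unfolding nbr_def by (auto intro!: exI[of _ x] exI[of _ "0::int"])

lemma nbr_self: "subgrp K \<Longrightarrow> y \<in> nbr K y"
  unfolding nbr_def by (auto intro!: exI[of _ 0] exI[of _ "1::int"] simp: subgrp_0)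

lemma nbrs_memI: "x \<in> L \<Longrightarrow> (\<forall>y\<in>set ys. x \<bullet> y \<in> \<int>) \<Longrightarrow> x \<in> nbrs L ys"
  by (induction ys) (auto intro: nbr_memI)

lemma nbrs_gens:
  assumes "even_group L"
  shows "nbr_chain L ys \<Longrightarrow> set ys \<subseteq> nbrs L ys"
proof (induction ys)
  case (Cons y ys)
  have "z \<in> nbrs L (y # ys)" if "z \<in> set ys" for z
    using Cons that by (auto intro!: nbr_memI simp: inner_commute[of z])
  moreover have "y \<in> nbrs L (y # ys)"
    using Cons.prems nbrs_even_group[OF assms, of ys] by (auto intro!: nbr_self simp: even_group_def)
  ultimately show ?case by auto
qed simp

section \<open>Recovering generators from a neighbour\<close>

definition gen :: "'a::real_vector set \<Rightarrow> 'a set" where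
  "gen A = \<Inter>{S. subgrp S \<and> A \<subseteq> S}"

lemma gen_subgrp: "subgrp (gen A)"
  unfolding gen_def subgrp_def by auto

lemma gen_inc: "A \<subseteq> gen A"
  unfolding gen_def by auto

lemma gen_least: "subgrp S \<Longrightarrow> A \<subseteq> S \<Longrightarrow> gen A \<subseteq> S"
  unfolding gen_def by auto

lemma gen_mono: "A \<subseteq> B \<Longrightarrow> gen A \<subseteq> gen B"
  unfolding gen_def by auto

lemma subgrp_int_dual: "subgrp {s. s \<bullet> x \<in> \<int>}"
  by (auto simp: subgrp_def inner_diff_left)

lemma gen_inner: "(\<forall>y\<in>A. y \<bullet> x \<in> \<int>) \<Longrightarrow> s \<in> gen A \<Longrightarrow> s \<bullet> x \<in> \<int>"
  using gen_least[OF subgrp_int_dual, of A x] by auto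

text \<open>Dissolves the iteration: the generators pair integrally with each other, so the part
  \<open>s\<close> never interferes with the integrality tests, and all tests fall on the single
  vector \<open>x\<close> of \<open>L\<close>.\<close>

lemma nbrs_struct:
  shows "nbr_chain L ys \<Longrightarrow> k \<in> nbrs L ys \<Longrightarrow>
    \<exists>x s. k = x + s \<and> x \<in> L \<and> s \<in> gen (set ys) \<and> (\<forall>y\<in>set ys. x \<bullet> y \<in> \<int>)"
proof (induction ys arbitrary: k)
  case Nil
  then show ?case using subgrp_0[OF gen_subgrp, of "{}::'a set"]
    by (intro exI[of _ k] exI[of _ "0::'a"]) auto
next
  case (Cons y ys)
  obtain x' j where k: "k = x' + of_int j *\<^sub>R y" "x' \<in> nbrs L ys" "x' \<bullet> y \<in> \<int>"
    using Cons.prems(2) unfolding nbrs.simps nbr_def by blast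
  obtain x s where x: "x' = x + s" "x \<in> L" "s \<in> gen (set ys)" "\<forall>y\<in>set ys. x \<bullet> y \<in> \<int>"
    using Cons.IH[OF _ k(2)] Cons.prems(1) by auto
  have sy: "s \<bullet> y \<in> \<int>"
    by (rule gen_inner[OF _ x(3)]) (use Cons.prems(1) in \<open>auto simp: inner_commute\<close>)
  then have "x \<bullet> y \<in> \<int>" using k(3) x(1) by (simp add: inner_add_left)
  moreover have "s + of_int j *\<^sub>R y \<in> gen (set (y # ys))"
    using x(3) gen_mono[of "set ys" "set (y # ys)"] gen_inc[of "set (y # ys)"]
    by (intro subgrp_add[OF gen_subgrp] subgrp_int[OF gen_subgrp]) auto
  moreover have "k = x + (s + of_int j *\<^sub>R y)" by (simp add: k x)
  ultimately show ?case using x by (intro exI[of _ x] exI[of _ "s + of_int j *\<^sub>R y"]) auto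
qed

text \<open>The ambient group \<open>V\<close> is everything for E8, and the hyperplane orthogonal
  to \<open>half_ones\<close> for E7, where \<open>L\<close> is still E8 but \<open>N\<close> has
  rank 7. The map \<open>f\<close> is a system of coordinates on N/(L \<inter> N) with values in
  Z/2; lifts of the coordinate vectors form the chain.\<close>

lemma chain_exists:
  fixes f :: "'a::real_inner \<Rightarrow> nat \<Rightarrow> int"
  assumes L: "even_group L" and N: "even_group N" and V: "N \<subseteq> V" "subgrp V"
    and max: "\<And>x. x \<in> L \<Longrightarrow> x \<in> V \<Longrightarrow> (\<forall>y\<in>N. x \<bullet> y \<in> \<int>) \<Longrightarrow> x \<in> N"
    and add: "\<And>x y j. x \<in> N \<Longrightarrow> y \<in> N \<Longrightarrow> j < i \<Longrightarrow> f (x + y) j = (f x j + f y j) mod 2"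
    and ker: "\<And>x. x \<in> N \<Longrightarrow> (\<forall>j<i. f x j = 0) \<longleftrightarrow> x \<in> L"
    and surj: "\<And>k. k < i \<Longrightarrow> \<exists>y\<in>N. \<forall>j<i. f y j = (if j = k then 1 else 0)"
  shows "\<exists>ys. length ys = i \<and> nbr_chain L ys \<and> set ys \<subseteq> N \<and> N = nbrs L ys \<inter> V"
proof -
  obtain Y where Y: "\<And>k. k < i \<Longrightarrow> Y k \<in> N" "\<And>k j. k < i \<Longrightarrow> j < i \<Longrightarrow> f (Y k) j = (if j = k then 1 else 0)"
    using surj by metis
  define ys where "ys k = rev (map Y [0..<k])" for k
  have ys0: "ys 0 = []" and ysS: "ys (Suc k) = Y k # ys k" and lys: "length (ys k) = k" for k
    by (simp_all add: ys_def)
  have ysN: "set (ys k) \<subseteq> N" if "k \<le> i" for k using that Y(1) by (auto simp: ys_def)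
  note L' = even_groupD[OF L] and N' = even_groupD[OF N]
  have f0: "f 0 j = 0" if "j < i" for j using ker[of 0] subgrp_0[OF N'(1)] subgrp_0[OF L'(1)] that by auto
  have fm: "f x j mod 2 = f x j" if "x \<in> N" "j < i" for x j
    using add[OF that(1) subgrp_0[OF N'(1)] that(2)] f0[OF that(2)] by simp
  have fd: "f (x - y) j = (f x j - f y j) mod 2" if "x \<in> N" "y \<in> N" "j < i" for x y j
  proof -
    have "f x j = (f (x - y) j + f y j) mod 2"
      using add[OF subgrp_diff[OF N'(1) that(1,2)] that(2,3)] by simp
    then have "(f x j - f y j) mod 2 = f (x - y) j mod 2" by (simp add: mod_simps)
    then show ?thesis using fm[OF subgrp_diff[OF N'(1) that(1,2)] that(3)] by simp
  qed
  have gN: "gen (set (ys k)) \<subseteq> N" if "k \<le> i" for k using gen_least[OF N'(1) ysN[OF that]] .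
  \<comment> \<open>Triangularity: the first \<open>k\<close> lifts have no later coordinates, so
    the lift with index \<open>k\<close> is new modulo them. This yields the last condition on a
    chain.\<close>
  have gf: "f s j = 0" if "k \<le> i" "s \<in> gen (set (ys k))" "k \<le> j" "j < i" for k s j
  proof -
    have "gen (set (ys k)) \<subseteq> {s \<in> N. f s j = 0}"
    proof (rule gen_least)
      show "subgrp {s \<in> N. f s j = 0}" unfolding subgrp_def
        using that f0 fd N'(1) by (auto simp: subgrp_0 subgrp_diff)
      show "set (ys k) \<subseteq> {s \<in> N. f s j = 0}"
        using ysN[OF that(1)] that Y(2) by (auto simp: ys_def)
    qed
    then show ?thesis using that(2) by auto
  qed
  have gd: "nbr_chain L (ys k)" if "k \<le> i" for k using that
  proof (induction k)
    case (Suc k)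
    then have k: "k < i" by simp
    have g: "nbr_chain L (ys k)" using Suc by simp
    have "f (Y k + Y k) j = 0" if "j < i" for j
      using add[OF Y(1)[OF k] Y(1)[OF k] that] Y(2)[OF k that] by auto
    then have "Y k + Y k \<in> L" using ker subgrp_add[OF N'(1) Y(1)[OF k] Y(1)[OF k]] by blast
    then have a: "2 *\<^sub>R Y k \<in> L" by (simp add: scaleR_2)
    have b: "Y k + z \<notin> L" if z: "z \<in> nbrs L (ys k)" for z
    proof
      assume c: "Y k + z \<in> L"
      obtain x s where x: "z = x + s" "x \<in> L" "s \<in> gen (set (ys k))" using nbrs_struct[OF g z] by blast
      have sN: "s \<in> N" using x(3) gN[of k] k by auto
      have "Y k + s \<in> L" using subgrp_diff[OF L'(1) c x(2)] by (simp add: x algebra_simps)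
      then have "f (Y k + s) k = 0" using ker[OF subgrp_add[OF N'(1) Y(1)[OF k] sN]] k by blast
      then show False using add[OF Y(1)[OF k] sN k] Y(2)[OF k k] gf[of k s k] x(3) k by simp
    qed
    show ?case unfolding ysS using g a b N'(2)[OF Y(1)[OF k]] N'(3)[OF Y(1)[OF k]] ysN[of k] k by auto
  qed (simp add: ys0)
  \<comment> \<open>Elimination: each coordinate is 0 or 1, so subtracting at most one lift clears
    it.\<close>
  have dec: "\<exists>s\<in>gen (set (ys k)). \<forall>j<k. f (n - s) j = 0" if n: "n \<in> N" and "k \<le> i" for n k using that(2)
  proof (induction k)
    case 0 then show ?case using subgrp_0[OF gen_subgrp] by auto
  next
    case (Suc k)
    then have k: "k < i" by simp
    obtain s where s: "s \<in> gen (set (ys k))" "\<forall>j<k. f (n - s) j = 0" using Suc by auto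
    have sN: "s \<in> N" using s(1) gN[of k] k by auto
    have nsN: "n - s \<in> N" using n sN N'(1) by (simp add: subgrp_diff)
    have s': "s \<in> gen (set (ys (Suc k)))" using s(1) gen_mono[of "set (ys k)" "set (ys (Suc k))"] by (auto simp: ysS)
    have Y': "Y k \<in> gen (set (ys (Suc k)))" using gen_inc[of "set (ys (Suc k))"] by (auto simp: ysS)
    have "f (n - s) k = 0 \<or> f (n - s) k = 1" using fm[OF nsN k] by presburger
    then show ?case
    proof
      assume "f (n - s) k = 0" then show ?thesis using s s' by (auto simp: less_Suc_eq)
    next
      assume 1: "f (n - s) k = 1"
      have "f (n - (s + Y k)) j = 0" if "j < Suc k" for j
      proof -
        have "f ((n - s) - Y k) j = (f (n - s) j - f (Y k) j) mod 2"
          using fd[OF nsN Y(1)[OF k]] that k by simp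
        then show ?thesis using 1 s(2) Y(2)[OF k, of j] that k by (auto simp: less_Suc_eq diff_diff_eq)
      qed
      then show ?thesis using subgrp_add[OF gen_subgrp s' Y'] by blast
    qed
  qed
  have sub: "N \<subseteq> nbrs L (ys i)"
  proof
    fix n assume n: "n \<in> N"
    obtain s where s: "s \<in> gen (set (ys i))" "\<forall>j<i. f (n - s) j = 0" using dec[OF n, of i] by auto
    have sN: "s \<in> N" using s(1) gN[of i] by auto
    have nsN: "n - s \<in> N" using n sN N'(1) by (simp add: subgrp_diff)
    have nsL: "n - s \<in> L" using ker[OF nsN] s(2) by blast
    have kk: "even_group (nbrs L (ys i))" by (rule nbrs_even_group[OF L gd]) simp
    have "n - s \<in> nbrs L (ys i)" using nbrs_memI[OF nsL, of "ys i"] N'(2)[OF nsN] ysN[of i] by auto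
    moreover have "s \<in> nbrs L (ys i)"
      using gen_least[OF even_groupD(1)[OF kk] nbrs_gens[OF L gd]] s(1) by auto
    ultimately show "n \<in> nbrs L (ys i)" using subgrp_add[OF even_groupD(1)[OF kk]] by fastforce
  qed
  \<comment> \<open>The part of \<open>z\<close> in \<open>L\<close> pairs integrally with all of
    \<open>N\<close>, and maximality puts it into \<open>N\<close>.\<close>
  have sup: "nbrs L (ys i) \<inter> V \<subseteq> N"
  proof
    fix z assume z: "z \<in> nbrs L (ys i) \<inter> V"
    obtain x s where x: "z = x + s" "x \<in> L" "s \<in> gen (set (ys i))" "\<forall>y\<in>set (ys i). x \<bullet> y \<in> \<int>"
      using nbrs_struct[OF gd, of i z] z by auto
    have sN: "s \<in> N" using x(3) gN[of i] by auto
    have xV: "x \<in> V" using subgrp_diff[OF V(2), of z s] z sN V(1) by (auto simp: x)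
    have "x \<bullet> n \<in> \<int>" if n: "n \<in> N" for n
    proof -
      obtain s where s: "s \<in> gen (set (ys i))" "\<forall>j<i. f (n - s) j = 0" using dec[OF n, of i] by auto
      have sN: "s \<in> N" using s(1) gN[of i] by auto
      have "n - s \<in> L" using ker[of "n - s"] s(2) n sN N'(1) by (simp add: subgrp_diff)
      then have "x \<bullet> (n - s) \<in> \<int>" using L'(2) x(2) by blast
      moreover have "s \<bullet> x \<in> \<int>" by (rule gen_inner[OF _ s(1)]) (use x(4) in \<open>auto simp: inner_commute\<close>)
      ultimately show ?thesis by (metis Ints_add diff_add_cancel inner_add_right inner_commute)
    qed
    then have "x \<in> N" using max[OF x(2) xV] by blast
    then show "z \<in> N" using sN N'(1) by (simp add: x subgrp_add)
  qed
  show ?thesis using lys[of i] gd[of i] ysN[of i] sub sup V(1) by (intro exI[of _ "ys i"]) auto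
qed

text \<open>The counterpart of \<open>chain_exists\<close> for a cyclic quotient: a lift
  \<open>y\<close> of 1 generates, since subtracting \<open>f n\<close> times \<open>y\<close> from
  \<open>n\<close> lands in \<open>L\<close>.\<close>

lemma cyclic_exists:
  fixes f :: "'a::real_inner \<Rightarrow> int"
  assumes L: "even_group L" and N: "even_group N" and V: "N \<subseteq> V" "subgrp V"
    and max: "\<And>x. x \<in> L \<Longrightarrow> x \<in> V \<Longrightarrow> (\<forall>y\<in>N. x \<bullet> y \<in> \<int>) \<Longrightarrow> x \<in> N"
    and add: "\<And>x y. x \<in> N \<Longrightarrow> y \<in> N \<Longrightarrow> f (x + y) = (f x + f y) mod 4"
    and ker: "\<And>x. x \<in> N \<Longrightarrow> f x = 0 \<longleftrightarrow> x \<in> L"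
    and surj: "\<exists>y\<in>N. f y = 1"
  shows "\<exists>y\<in>N. N = nbr L y \<inter> V \<and> even_norm y \<and> 4 *\<^sub>R y \<in> L \<and> 2 *\<^sub>R y \<notin> L"
proof -
  note L' = even_groupD[OF L] and N' = even_groupD[OF N]
  obtain y where y: "y \<in> N" "f y = 1" using surj by blast
  have f0: "f 0 = 0" using ker[of 0] subgrp_0[OF N'(1)] subgrp_0[OF L'(1)] by auto
  have fm: "f x mod 4 = f x" if "x \<in> N" for x using add[OF that subgrp_0[OF N'(1)]] f0 by simp
  have fd: "f (x - z) = (f x - f z) mod 4" if "x \<in> N" "z \<in> N" for x z
  proof -
    have "f x = (f (x - z) + f z) mod 4"
      using add[OF subgrp_diff[OF N'(1) that] that(2)] by simp
    then have "(f x - f z) mod 4 = f (x - z) mod 4" by (simp add: mod_simps)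
    then show ?thesis using fm[OF subgrp_diff[OF N'(1) that]] by simp
  qed
  have y2: "y + y \<in> N" and y4: "(y + y) + (y + y) \<in> N" using y(1) N'(1) by (simp_all add: subgrp_add)
  have f2: "f (y + y) = 2" using add[OF y(1) y(1)] y(2) by simp
  have "f ((y + y) + (y + y)) = 0" using add[OF y2 y2] f2 by simp
  then have a: "4 *\<^sub>R y \<in> L" using ker[OF y4] by (simp flip: scaleR_2)
  have b: "2 *\<^sub>R y \<notin> L" using ker[OF y2] f2 by (simp add: scaleR_2)
  have fn: "f (of_nat m *\<^sub>R y) = int m mod 4" for m
  proof (induction m)
    case (Suc m)
    have mN: "of_nat m *\<^sub>R y \<in> N" using subgrp_int[OF N'(1) y(1), of "int m"] by simp
    show ?case using add[OF mN y(1)] Suc y(2) by (simp add: scaleR_add_left add.commute mod_simps)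
  qed (simp add: f0)
  have dec: "\<exists>k::int. n - of_int k *\<^sub>R y \<in> L \<inter> N" if n: "n \<in> N" for n
  proof -
    have kN: "of_int (f n) *\<^sub>R y \<in> N" using subgrp_int[OF N'(1) y(1)] .
    have "0 \<le> f n" using fm[OF n] by presburger
    then have "f (of_int (f n) *\<^sub>R y) = f n" using fn[of "nat (f n)"] fm[OF n] by simp
    then have "f (n - of_int (f n) *\<^sub>R y) = 0" using fd[OF n kN] by simp
    then show ?thesis using ker[of "n - of_int (f n) *\<^sub>R y"] n kN N'(1) by (auto simp: subgrp_diff)
  qed
  have sub: "N \<subseteq> nbr L y"
  proof
    fix n assume n: "n \<in> N"
    obtain k :: int where k: "n - of_int k *\<^sub>R y \<in> L \<inter> N" using dec[OF n] by blast
    have "n = (n - of_int k *\<^sub>R y) + of_int k *\<^sub>R y" by simp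
    then show "n \<in> nbr L y" unfolding nbr_def using k N'(2)[OF _ y(1)] by blast
  qed
  have sup: "nbr L y \<inter> V \<subseteq> N"
  proof
    fix z assume z: "z \<in> nbr L y \<inter> V"
    then obtain x k where x: "z = x + of_int k *\<^sub>R y" "x \<in> L" "x \<bullet> y \<in> \<int>" unfolding nbr_def by blast
    have kN: "of_int k *\<^sub>R y \<in> N" using subgrp_int[OF N'(1) y(1)] .
    have xV: "x \<in> V" using subgrp_diff[OF V(2), of z "of_int k *\<^sub>R y"] z kN V(1) by (auto simp: x)
    have "x \<bullet> n \<in> \<int>" if n: "n \<in> N" for n
    proof -
      obtain k :: int where k: "n - of_int k *\<^sub>R y \<in> L \<inter> N" using dec[OF n] by blast
      have "x \<bullet> n = x \<bullet> (n - of_int k *\<^sub>R y) + of_int k * (x \<bullet> y)" by (simp add: inner_diff_right)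
      then show ?thesis using L'(2)[OF x(2)] k x(3) by (auto intro!: Ints_add Ints_mult)
    qed
    then have "x \<in> N" using max[OF x(2) xV] by blast
    then show "z \<in> N" using kN N'(1) by (simp add: x subgrp_add)
  qed
  show ?thesis using sub sup V(1) a b y(1) N'(3)[OF y(1)] by (intro bexI[of _ y]) auto
qed

section \<open>Coordinates\<close>

lemma exhaust_8: "x = 1 \<or> x = 2 \<or> x = 3 \<or> x = 4 \<or> x = 5 \<or> x = 6 \<or> x = 7 \<or> x = 8" for x :: 8
proof (induct x)
  case (of_int z)
  then have "z \<in> {0..<8}" by simp
  then have "z = 0 \<or> z = 1 \<or> z = 2 \<or> z = 3 \<or> z = 4 \<or> z = 5 \<or> z = 6 \<or> z = 7" by auto
  then show ?case by auto
qed

lemma forall_8: "(\<forall>i::8. P i) \<longleftrightarrow> P 1 \<and> P 2 \<and> P 3 \<and> P 4 \<and> P 5 \<and> P 6 \<and> P 7 \<and> P 8"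
  by (metis exhaust_8)

lemma UNIV_8: "(UNIV :: 8 set) = {1, 2, 3, 4, 5, 6, 7, 8}"
proof -
  have "x \<in> {1, 2, 3, 4, 5, 6, 7, 8}" for x :: 8
    unfolding insert_iff using exhaust_8[of x] by (simp only: empty_iff simp_thms)
  then show ?thesis by (rule UNIV_eq_I)
qed

lemma sum_8: "sum f (UNIV :: 8 set) = f 1 + f 2 + f 3 + f 4 + f 5 + f 6 + f 7 + f 8"
  unfolding UNIV_8 by (simp add: add.assoc)

text \<open>The remaining branch is the index \<open>8\<close>, which equals \<open>0\<close> in
  this type but takes the last position.\<close>

definition pos8 :: "8 \<Rightarrow> nat" where
  "pos8 i = (if i = 1 then 0 else if i = 2 then 1 else if i = 3 then 2 else if i = 4 then 3
     else if i = 5 then 4 else if i = 6 then 5 else if i = 7 then 6 else 7)"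

lemma pos8_simps [simp]:
  "pos8 1 = 0" "pos8 2 = 1" "pos8 3 = 2" "pos8 4 = 3" "pos8 5 = 4" "pos8 6 = 5" "pos8 7 = 6" "pos8 8 = 7"
  by (simp_all add: pos8_def)

text \<open>Quarters are the smallest unit occurring in the generators of the neighbours.\<close>

definition qv :: "int list \<Rightarrow> real^8" where
  "qv xs = (\<chi> i. of_int (xs ! pos8 i) / 4)"

lemma qv_nth [simp]:
  "qv [a,b,c,d,e,f,g,h] $ 1 = of_int a / 4" "qv [a,b,c,d,e,f,g,h] $ 2 = of_int b / 4"
  "qv [a,b,c,d,e,f,g,h] $ 3 = of_int c / 4" "qv [a,b,c,d,e,f,g,h] $ 4 = of_int d / 4"
  "qv [a,b,c,d,e,f,g,h] $ 5 = of_int e / 4" "qv [a,b,c,d,e,f,g,h] $ 6 = of_int f / 4"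
  "qv [a,b,c,d,e,f,g,h] $ 7 = of_int g / 4" "qv [a,b,c,d,e,f,g,h] $ 8 = of_int h / 4"
  by (simp_all add: qv_def)

lemma qv_inner:
  "qv [a,b,c,d,e,f,g,h] \<bullet> qv [a',b',c',d',e',f',g',h'] =
     of_int (a*a' + b*b' + c*c' + d*d' + e*e' + f*f' + g*g' + h*h') / 16"
  by (simp add: inner_vec_def sum_8 field_simps)

lemma qv_add: "qv [a,b,c,d,e,f,g,h] + qv [a',b',c',d',e',f',g',h'] = qv [a+a',b+b',c+c',d+d',e+e',f+f',g+g',h+h']"
  by (simp add: vec_eq_iff forall_8 add_divide_distrib)

lemma qv_diff: "qv [a,b,c,d,e,f,g,h] - qv [a',b',c',d',e',f',g',h'] = qv [a-a',b-b',c-c',d-d',e-e',f-f',g-g',h-h']"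
  by (simp add: vec_eq_iff forall_8 diff_divide_distrib)

lemma qv_minus: "- qv [a,b,c,d,e,f,g,h] = qv [-a,-b,-c,-d,-e,-f,-g,-h]"
  by (simp add: vec_eq_iff forall_8)

lemma qv_scale: "of_int k *\<^sub>R qv [a,b,c,d,e,f,g,h] = qv [k*a,k*b,k*c,k*d,k*e,k*f,k*g,k*h]"
  by (simp add: vec_eq_iff forall_8)

lemma half_ones_qv: "half_ones = qv [2,2,2,2,2,2,2,2]"
  by (simp add: vec_eq_iff forall_8 half_ones_def)

lemma of_int_div_Ints: "k \<noteq> 0 \<Longrightarrow> (of_int n / of_int k :: real) \<in> \<int> \<longleftrightarrow> k dvd n"
  by (auto simp: Ints_def dvd_def field_simps simp flip: of_int_mult)

lemma of_int_16_Ints: "(of_int n / 16 :: real) \<in> \<int> \<longleftrightarrow> 16 dvd n"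
  using of_int_div_Ints[of 16 n] by simp

lemma E8_paramE:
  assumes "x \<in> E8"
  obtains m a b c d e f g h k where
    "x = qv [2*m+4*a, 2*m+4*b, 2*m+4*c, 2*m+4*d, 2*m+4*e, 2*m+4*f, 2*m+4*g, 2*m+4*h]"
    "a + b + c + d + e + f + g + h = 2 * k"
proof -
  obtain y m where x: "x = y + of_int m *\<^sub>R half_ones" "y \<in> D8" using assms unfolding E8_def by blast
  from x(2) have "\<forall>i. \<exists>k::int. y $ i = of_int k" unfolding D8_def by (auto elim: Ints_cases)
  then obtain n where n: "\<And>i. y $ i = of_int (n i)" by metis
  obtain k :: int where k: "(\<Sum>i\<in>UNIV. y $ i) = 2 * of_int k" using x(2) unfolding D8_def by auto
  have k': "n 1 + n 2 + n 3 + n 4 + n 5 + n 6 + n 7 + n 8 = 2 * k"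
    using k unfolding sum_8 n by linarith
  have "x = qv [2*m+4*n 1, 2*m+4*n 2, 2*m+4*n 3, 2*m+4*n 4, 2*m+4*n 5, 2*m+4*n 6, 2*m+4*n 7, 2*m+4*n 8]"
    by (simp add: vec_eq_iff forall_8 x(1) n half_ones_def field_simps)
  then show ?thesis using k' by (rule that)
qed

lemma E8_paramI:
  assumes "a + b + c + d + e + f + g + h = 2 * k"
  shows "qv [2*m+4*a, 2*m+4*b, 2*m+4*c, 2*m+4*d, 2*m+4*e, 2*m+4*f, 2*m+4*g, 2*m+4*h] \<in> E8"
proof -
  define x where "x = qv [4*a, 4*b, 4*c, 4*d, 4*e, 4*f, 4*g, 4*h]"
  have "real_of_int (a + b + c + d + e + f + g + h) = 2 * of_int k" using assms by simp
  then have "x \<in> D8" unfolding D8_def x_def by (auto simp: forall_8 sum_8 intro!: exI[of _ k])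
  moreover have "qv [2*m+4*a, 2*m+4*b, 2*m+4*c, 2*m+4*d, 2*m+4*e, 2*m+4*f, 2*m+4*g, 2*m+4*h]
      = x + of_int m *\<^sub>R half_ones"
    unfolding half_ones_qv qv_scale x_def qv_add by (simp add: algebra_simps)
  ultimately show ?thesis unfolding E8_def by blast
qed

lemma qv_inj:
  "qv [a,b,c,d,e,f,g,h] = qv [a',b',c',d',e',f',g',h'] \<longleftrightarrow>
     a = a' \<and> b = b' \<and> c = c' \<and> d = d' \<and> e = e' \<and> f = f' \<and> g = g' \<and> h = h'"
  by (simp add: vec_eq_iff forall_8)

text \<open>The familiar description read in quarters: the coordinates are all in Z or all in 1/2 +
  Z, and their sum is even.\<close>

lemma qv_E8:
  "qv [a,b,c,d,e,f,g,h] \<in> E8 \<longleftrightarrow> even a \<and> 4 dvd (b-a) \<and> 4 dvd (c-a) \<and> 4 dvd (d-a) \<and> 4 dvd (e-a)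
     \<and> 4 dvd (f-a) \<and> 4 dvd (g-a) \<and> 4 dvd (h-a) \<and> 8 dvd (a+b+c+d+e+f+g+h)"
proof
  assume *: "qv [a,b,c,d,e,f,g,h] \<in> E8"
  obtain m na nb nc nd ne nf ng nh k where x: "qv [a,b,c,d,e,f,g,h] = qv [2*m+4*na, 2*m+4*nb,
      2*m+4*nc, 2*m+4*nd, 2*m+4*ne, 2*m+4*nf, 2*m+4*ng, 2*m+4*nh]"
    and k: "na + nb + nc + nd + ne + nf + ng + nh = 2 * k" using E8_paramE[OF *] .
  have eqs: "a = 2*m+4*na" "b = 2*m+4*nb" "c = 2*m+4*nc" "d = 2*m+4*nd"
    "e = 2*m+4*ne" "f = 2*m+4*nf" "g = 2*m+4*ng" "h = 2*m+4*nh" using x[unfolded qv_inj] by blast+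
  have s: "a+b+c+d+e+f+g+h = 8 * (k + 2 * m)" unfolding eqs using k by presburger
  have dv: "4 dvd ((2*m+4*u) - (2*m+4*w))" for u w :: int
    by (rule dvdI[of _ _ "u - w"]) simp
  show "even a \<and> 4 dvd (b-a) \<and> 4 dvd (c-a) \<and> 4 dvd (d-a) \<and> 4 dvd (e-a)
     \<and> 4 dvd (f-a) \<and> 4 dvd (g-a) \<and> 4 dvd (h-a) \<and> 8 dvd (a+b+c+d+e+f+g+h)"
    unfolding s unfolding eqs by (intro conjI dv) simp_all
next
  assume *: "even a \<and> 4 dvd (b-a) \<and> 4 dvd (c-a) \<and> 4 dvd (d-a) \<and> 4 dvd (e-a)
     \<and> 4 dvd (f-a) \<and> 4 dvd (g-a) \<and> 4 dvd (h-a) \<and> 8 dvd (a+b+c+d+e+f+g+h)"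
  obtain m where m: "a = 2 * m" using * by (auto elim: evenE)
  obtain nb where nb: "b - a = 4 * nb" using * by (auto elim: dvdE)
  obtain nc where nc: "c - a = 4 * nc" using * by (auto elim: dvdE)
  obtain nd where nd: "d - a = 4 * nd" using * by (auto elim: dvdE)
  obtain ne where ne: "e - a = 4 * ne" using * by (auto elim: dvdE)
  obtain nf where nf: "f - a = 4 * nf" using * by (auto elim: dvdE)
  obtain ng where ng: "g - a = 4 * ng" using * by (auto elim: dvdE)
  obtain nh where nh: "h - a = 4 * nh" using * by (auto elim: dvdE)
  obtain s where s: "a+b+c+d+e+f+g+h = 8 * s" using * by (auto elim: dvdE)
  have "0 + nb + nc + nd + ne + nf + ng + nh = 2 * (s - 2 * m)" using m nb nc nd ne nf ng nh s by simp
  note M = E8_paramI[OF this, of m]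
  have L: "[2*m+4*0, 2*m+4*nb, 2*m+4*nc, 2*m+4*nd, 2*m+4*ne, 2*m+4*nf, 2*m+4*ng, 2*m+4*nh]
      = [a,b,c,d,e,f,g,h]" using m nb nc nd ne nf ng nh by simp
  show "qv [a,b,c,d,e,f,g,h] \<in> E8" using M unfolding L .
qed

lemma double_E8_qvE:
  assumes "2 *\<^sub>R y \<in> E8"
  obtains m a b c d e f g h k where
    "y = qv [m+2*a, m+2*b, m+2*c, m+2*d, m+2*e, m+2*f, m+2*g, m+2*h]"
    "a + b + c + d + e + f + g + h = 2 * k"
proof -
  obtain m a b c d e f g h k where
    q: "2 *\<^sub>R y = qv [2*m+4*a, 2*m+4*b, 2*m+4*c, 2*m+4*d, 2*m+4*e, 2*m+4*f, 2*m+4*g, 2*m+4*h]"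
    "a + b + c + d + e + f + g + h = 2 * k" using E8_paramE[OF assms] .
  have "y = (1/2) *\<^sub>R (2 *\<^sub>R y)" by simp
  also have "\<dots> = qv [m+2*a, m+2*b, m+2*c, m+2*d, m+2*e, m+2*f, m+2*g, m+2*h]"
    unfolding q(1) by (simp add: vec_eq_iff forall_8)
  finally show ?thesis using q(2) by (rule that)
qed

text \<open>Modulo 8 the square of an even number remembers that number modulo 4, so that a norm
  condition controls a sum of coordinates.\<close>

lemma square_cong: "\<exists>j. (x::int) * x = (if even x then 2 * x else 1) + 8 * j"
proof (cases "even x")
  case True
  then obtain k where k: "x = 2 * k" by (auto elim: evenE)
  have "even (k * (k - 1))" by simp
  then obtain j where "k * (k - 1) = 2 * j" by (rule evenE)
  then have "x * x = 2 * x + 8 * j" by (simp add: k algebra_simps)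
  then show ?thesis using True by auto
next
  case False
  then obtain k where k: "x = 2 * k + 1" by (auto elim: oddE)
  have "even (k * (k + 1))" by simp
  then obtain j where "k * (k + 1) = 2 * j" by (rule evenE)
  then have "x * x = 1 + 8 * j" by (simp add: k algebra_simps)
  then show ?thesis using False by auto
qed

lemma qv_even_norm:
  "even_norm (qv [a,b,c,d,e,f,g,h]) \<longleftrightarrow> 32 dvd (a*a + b*b + c*c + d*d + e*e + f*f + g*g + h*h)"
proof -
  have "even_norm (qv [a,b,c,d,e,f,g,h]) \<longleftrightarrow>
      (\<exists>k. a*a + b*b + c*c + d*d + e*e + f*f + g*g + h*h = 32 * k)" (is "_ \<longleftrightarrow> (\<exists>k. ?S = 32 * k)")
    unfolding even_norm_def qv_inner
  proof (rule ex_cong1)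
    fix k
    show "(real_of_int ?S / 16 = 2 * of_int k) \<longleftrightarrow> ?S = 32 * k"
      using of_int_eq_iff[where 'a=real, of ?S "32 * k"] by (auto simp del: of_int_eq_iff)
  qed
  then show ?thesis by (simp add: dvd_def)
qed

lemma even_group_E8: "even_group E8"
  unfolding even_group_def
proof (intro conjI ballI)
  show "subgrp E8" unfolding subgrp_def
  proof (intro conjI ballI)
    have "qv [0,0,0,0,0,0,0,0] = 0" by (simp add: vec_eq_iff forall_8)
    moreover have "qv [0,0,0,0,0,0,0,0] \<in> E8" unfolding qv_E8 by simp
    ultimately show "0 \<in> E8" by (simp only:)
    fix x y assume x: "x \<in> E8" and y: "y \<in> E8"
    obtain m a b c d e f g h k where
      1: "x = qv [2*m+4*a, 2*m+4*b, 2*m+4*c, 2*m+4*d, 2*m+4*e, 2*m+4*f, 2*m+4*g, 2*m+4*h]"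
      "a + b + c + d + e + f + g + h = 2 * k" using E8_paramE[OF x] .
    obtain m' a' b' c' d' e' f' g' h' k' where
      2: "y = qv [2*m'+4*a', 2*m'+4*b', 2*m'+4*c', 2*m'+4*d', 2*m'+4*e', 2*m'+4*f', 2*m'+4*g', 2*m'+4*h']"
      "a' + b' + c' + d' + e' + f' + g' + h' = 2 * k'" using E8_paramE[OF y] .
    have r: "(2*m+4*u) - (2*m'+4*w) = 2*(m-m')+4*(u-w)" for u w :: int by simp
    show "x - y \<in> E8" unfolding 1(1) 2(1) qv_diff r
      by (rule E8_paramI[of _ _ _ _ _ _ _ _ "k - k'"]) (use 1(2) 2(2) in simp)
  qed
next
  fix x y assume x: "x \<in> E8" and y: "y \<in> E8"
  obtain m a b c d e f g h k where
    1: "x = qv [2*m+4*a, 2*m+4*b, 2*m+4*c, 2*m+4*d, 2*m+4*e, 2*m+4*f, 2*m+4*g, 2*m+4*h]"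
    "a + b + c + d + e + f + g + h = 2 * k" using E8_paramE[OF x] .
  obtain m' a' b' c' d' e' f' g' h' k' where
    2: "y = qv [2*m'+4*a', 2*m'+4*b', 2*m'+4*c', 2*m'+4*d', 2*m'+4*e', 2*m'+4*f', 2*m'+4*g', 2*m'+4*h']"
    "a' + b' + c' + d' + e' + f' + g' + h' = 2 * k'" using E8_paramE[OF y] .
  have "(2*m+4*a)*(2*m'+4*a') + (2*m+4*b)*(2*m'+4*b') + (2*m+4*c)*(2*m'+4*c') + (2*m+4*d)*(2*m'+4*d')
      + (2*m+4*e)*(2*m'+4*e') + (2*m+4*f)*(2*m'+4*f') + (2*m+4*g)*(2*m'+4*g') + (2*m+4*h)*(2*m'+4*h') =
     32 * (m * m') + 8 * m * (a' + b' + c' + d' + e' + f' + g' + h') + 8 * m' * (a + b + c + d + e + f + g + h)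
     + 16 * (a*a' + b*b' + c*c' + d*d' + e*e' + f*f' + g*g' + h*h')"
    by (simp add: algebra_simps)
  also have "\<dots> = 16 * (2 * (m * m') + m * k' + m' * k + (a*a' + b*b' + c*c' + d*d' + e*e' + f*f' + g*g' + h*h'))"
    unfolding 1(2) 2(2) by (simp add: algebra_simps)
  finally show "x \<bullet> y \<in> \<int>" unfolding 1(1) 2(1) qv_inner by (simp only: of_int_16_Ints dvd_triv_left)
next
  fix x assume x: "x \<in> E8"
  obtain m a b c d e f g h k where
    1: "x = qv [2*m+4*a, 2*m+4*b, 2*m+4*c, 2*m+4*d, 2*m+4*e, 2*m+4*f, 2*m+4*g, 2*m+4*h]"
    "a + b + c + d + e + f + g + h = 2 * k" using E8_paramE[OF x] .
  have par: "\<exists>j. n * n = n + 2 * j" for n :: int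
  proof -
    have "even (n * (n - 1))" by simp
    then obtain j where "n * (n - 1) = 2 * j" by (rule evenE)
    then show ?thesis by (intro exI[of _ j]) (simp add: algebra_simps)
  qed
  obtain J where J: "\<And>n::int. n * n = n + 2 * J n" using par by metis
  have j': "a*a + b*b + c*c + d*d + e*e + f*f + g*g + h*h = 2 * (k + J a + J b + J c + J d + J e + J f + J g + J h)"
    unfolding J[of a] J[of b] J[of c] J[of d] J[of e] J[of f] J[of g] J[of h] using 1(2) by simp
  have "(2*m+4*a)*(2*m+4*a) + (2*m+4*b)*(2*m+4*b) + (2*m+4*c)*(2*m+4*c) + (2*m+4*d)*(2*m+4*d)
      + (2*m+4*e)*(2*m+4*e) + (2*m+4*f)*(2*m+4*f) + (2*m+4*g)*(2*m+4*g) + (2*m+4*h)*(2*m+4*h) =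
     32 * (m * m) + 16 * m * (a + b + c + d + e + f + g + h)
     + 16 * (a*a + b*b + c*c + d*d + e*e + f*f + g*g + h*h)"
    by (simp add: algebra_simps)
  also have "\<dots> = 32 * (m * m + m * k + (k + J a + J b + J c + J d + J e + J f + J g + J h))"
    unfolding 1(2) j' by (simp add: algebra_simps)
  finally show "even_norm x" unfolding 1(1) qv_even_norm by (simp only: dvd_triv_left)
qed

section \<open>Reflections\<close>

text \<open>A reflection only for \<open>r \<bullet> r = 2\<close>, where the usual factor 2/(r.r)
  is 1.\<close>

definition refln :: "'a::real_inner \<Rightarrow> 'a \<Rightarrow> 'a" where
  "refln r x = x - (x \<bullet> r) *\<^sub>R r"

lemma refln_refln: "r \<bullet> r = 2 \<Longrightarrow> refln r (refln r x) = x"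
  by (simp add: refln_def inner_diff_left algebra_simps)

lemma refln_orth: "r \<bullet> r = 2 \<Longrightarrow> orthogonal_transformation (refln r)"
  unfolding orthogonal_transformation_def refln_def
  by (auto intro!: linearI simp: inner_add_left inner_diff_left inner_diff_right inner_commute algebra_simps)

lemma refln_mem:
  assumes "even_group K" "r \<in> K" "x \<in> K" shows "refln r x \<in> K"
proof -
  obtain k :: int where "x \<bullet> r = of_int k" using even_groupD(2)[OF assms(1,3,2)] by (auto elim: Ints_cases)
  then show ?thesis unfolding refln_def
    using subgrp_diff[OF even_groupD(1)[OF assms(1)] assms(3) subgrp_int[OF even_groupD(1)[OF assms(1)] assms(2)]]
    by simp
qed

lemma refln_image: "even_group K \<Longrightarrow> r \<in> K \<Longrightarrow> r \<bullet> r = 2 \<Longrightarrow> refln r ` K = K"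
  using refln_mem[of K r] refln_refln[of r] by (auto simp: image_iff) metis

text \<open>The vector \<open>a\<close> is going to be a root of \<open>L\<close> and \<open>N\<close>, or \<open>0\<close> if there is no common root.\<close>

definition sim :: "'a::real_inner set \<Rightarrow> 'a set \<Rightarrow> 'a \<Rightarrow> 'a \<Rightarrow> 'a \<Rightarrow> bool" where
  "sim L N a y t \<longleftrightarrow> (\<exists>h. orthogonal_transformation h \<and> h ` L = L \<and> h ` N = N \<and> h a = a \<and> h y - t \<in> N)"

lemma sim_base: "y - t \<in> N \<Longrightarrow> sim L N a y t"
  unfolding sim_def by (intro exI[of _ "\<lambda>x. x"]) (auto simp: orthogonal_transformation_def linear_id[unfolded id_def])

lemma sim_shift:
  assumes "subgrp N" "y - y' \<in> N" "sim L N a y' t" shows "sim L N a y t"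
proof -
  obtain h where h: "orthogonal_transformation h" "h ` L = L" "h ` N = N" "h a = a" "h y' - t \<in> N"
    using assms(3) unfolding sim_def by blast
  have e: "h y - t = h (y - y') + (h y' - t)" by (simp add: orth_simps[OF h(1)])
  have "h (y - y') \<in> N" using h(3) assms(2) by blast
  then have "h y - t \<in> N" unfolding e using h(5) assms(1) by (intro subgrp_add)
  then show ?thesis unfolding sim_def using h by blast
qed

text \<open>Applied backwards, this replaces \<open>y\<close> by its reflection. Orthogonality of
  \<open>r\<close> to \<open>a\<close> is what keeps the tracked root fixed.\<close>

lemma sim_refl:
  assumes "even_group L" "even_group N" "r \<in> L" "r \<in> N" "r \<bullet> r = 2" "r \<bullet> a = 0" "sim L N a (refln r y) t"
  shows "sim L N a y t"
proof -
  obtain h where h: "orthogonal_transformation h" "h ` L = L" "h ` N = N" "h a = a" "h (refln r y) - t \<in> N"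
    using assms(7) unfolding sim_def by blast
  have "orthogonal_transformation (h \<circ> refln r)"
    using orthogonal_transformation_compose[OF h(1) refln_orth[OF assms(5)]] .
  moreover have "(h \<circ> refln r) ` L = L" "(h \<circ> refln r) ` N = N"
    using h(2,3) refln_image[OF assms(1,3,5)] refln_image[OF assms(2,4,5)] unfolding image_comp[symmetric] by simp_all
  moreover have "(h \<circ> refln r) a = a" using h(4) assms(6) by (simp add: refln_def inner_commute)
  ultimately show ?thesis unfolding sim_def using h(5) by (intro exI[of _ "h \<circ> refln r"]) simp
qed

text \<open>Adjacent transpositions reach every rearrangement: \<open>move\<close> carries an entry
  across a block, and the target list is built up from the left. Each swap will be realised by a
  reflection in some \<open>root k\<close>.\<close>

lemma perm_closed:
  assumes step: "\<And>us x y vs. length us + length vs + 2 = n \<Longrightarrow> P (us @ x # y # vs) \<Longrightarrow> P (us @ y # x # vs)"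
    and "length xs = n" "mset xs = mset ys" "P xs"
  shows "P ys"
proof -
  have move: "P (us @ x # vs @ ws) \<Longrightarrow> length (us @ x # vs @ ws) = n \<Longrightarrow> P (us @ vs @ x # ws)" for us x vs ws
  proof (induction vs arbitrary: us)
    case (Cons v vs)
    have "P (us @ v # x # (vs @ ws))" by (rule step) (use Cons.prems in auto)
    then show ?case using Cons.IH[of "us @ [v]"] Cons.prems by simp
  qed simp
  have "P (us @ xs) \<Longrightarrow> length (us @ xs) = n \<Longrightarrow> mset xs = mset ys \<Longrightarrow> P (us @ ys)" for us
  proof (induction xs arbitrary: us ys)
    case (Cons x xs)
    have "x \<in> set ys" using Cons.prems(3) by (metis list.set_intros(1) mset_eq_setD)
    then obtain vs ws where ys: "ys = vs @ x # ws" by (meson split_list)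
    have "mset xs = mset (vs @ ws)" using Cons.prems(3) by (simp add: ys)
    from Cons.IH[OF _ _ this, of "us @ [x]"] have "P (us @ x # vs @ ws)" using Cons.prems by simp
    moreover have "length (us @ x # vs @ ws) = n"
      using Cons.prems(2) mset_eq_length[OF \<open>mset xs = mset (vs @ ws)\<close>] by simp
    ultimately show ?case using move ys by simp
  qed simp
  from this[of "[]"] assms show ?thesis by simp
qed

lemma parity_split:
  fixes xs :: "int list"
  obtains os es where "mset xs = mset (os @ es)" "\<forall>x\<in>set os. odd x" "\<forall>x\<in>set es. even x"
    "int (length os) = sum_list (map (\<lambda>x. x mod 2) xs)"
proof
  show "mset xs = mset (filter odd xs @ filter even xs)" by simp
  show "int (length (filter odd xs)) = sum_list (map (\<lambda>x. x mod 2) xs)"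
    by (induction xs) (auto simp: odd_iff_mod_2_eq_one)
qed auto

text \<open>For k \<le> 6 these are the simple roots of type A_7, whose reflections exchange
  neighbouring coordinates.\<close>

definition root :: "nat \<Rightarrow> real^8" where
  "root k = qv (replicate k 0 @ [4, -4] @ replicate (6 - k) 0)"

lemma root_simps:
  "root 0 = qv [4,-4,0,0,0,0,0,0]" "root (Suc 0) = qv [0,4,-4,0,0,0,0,0]" "root 2 = qv [0,0,4,-4,0,0,0,0]"
  "root 3 = qv [0,0,0,4,-4,0,0,0]" "root 4 = qv [0,0,0,0,4,-4,0,0]" "root 5 = qv [0,0,0,0,0,4,-4,0]"
  "root 6 = qv [0,0,0,0,0,0,4,-4]"
  by (simp_all add: root_def numeral_eq_Suc)

lemma le_6_cases: "(k::nat) \<le> 6 \<Longrightarrow> k = 0 \<or> k = Suc 0 \<or> k = 2 \<or> k = 3 \<or> k = 4 \<or> k = 5 \<or> k = 6"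
  by auto

lemma root_norm: "k \<le> 6 \<Longrightarrow> root k \<bullet> root k = 2"
  by (drule le_6_cases) (elim disjE; simp add: root_simps qv_inner)

lemma root_E8: "k \<le> 6 \<Longrightarrow> root k \<in> E8"
  by (drule le_6_cases) (elim disjE; simp add: root_simps qv_E8)

lemma refln_root:
  assumes "length us + length vs = 6"
  shows "refln (root (length us)) (qv (us @ x # y # vs)) = qv (us @ y # x # vs)"
proof -
  note roots = root_def[of 0] root_def[of "Suc 0"] root_def[of "Suc (Suc 0)"] root_def[of "Suc (Suc (Suc 0))"]
    root_def[of "Suc (Suc (Suc (Suc 0)))"] root_def[of "Suc (Suc (Suc (Suc (Suc 0))))"]
    root_def[of "Suc (Suc (Suc (Suc (Suc (Suc 0)))))"]
  have *: "refln (root 0) (qv [a,b,c,d,e,f,g,h]) = qv [b,a,c,d,e,f,g,h]"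
    "refln (root (Suc 0)) (qv [a,b,c,d,e,f,g,h]) = qv [a,c,b,d,e,f,g,h]"
    "refln (root (Suc (Suc 0))) (qv [a,b,c,d,e,f,g,h]) = qv [a,b,d,c,e,f,g,h]"
    "refln (root (Suc (Suc (Suc 0)))) (qv [a,b,c,d,e,f,g,h]) = qv [a,b,c,e,d,f,g,h]"
    "refln (root (Suc (Suc (Suc (Suc 0))))) (qv [a,b,c,d,e,f,g,h]) = qv [a,b,c,d,f,e,g,h]"
    "refln (root (Suc (Suc (Suc (Suc (Suc 0)))))) (qv [a,b,c,d,e,f,g,h]) = qv [a,b,c,d,e,g,f,h]"
    "refln (root (Suc (Suc (Suc (Suc (Suc (Suc 0))))))) (qv [a,b,c,d,e,f,g,h]) = qv [a,b,c,d,e,f,h,g]" for a b c d e f g h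
    unfolding roots refln_def by (simp_all add: numeral_eq_Suc qv_inner) (simp_all add: vec_eq_iff forall_8 field_simps)
  have "length us \<le> 6" using assms by simp
  from le_6_cases[OF this] assms show ?thesis
    by (elim disjE) (auto simp: length_Suc_conv numeral_eq_Suc *)
qed

text \<open>The prefix is left alone because the roots acting on it may fail to be orthogonal to
  \<open>a\<close> or to lie in \<open>N\<close>.\<close>

lemma sim_sort:
  assumes L: "even_group L" "even_group N"
    and r: "\<And>k. length pre \<le> k \<Longrightarrow> k \<le> 6 \<Longrightarrow> root k \<in> L \<and> root k \<in> N \<and> root k \<bullet> a = 0"
    and len: "length pre + length xs = 8" and m: "mset xs = mset ys"
    and s: "sim L N a (qv (pre @ ys)) t"
  shows "sim L N a (qv (pre @ xs)) t"
proof (rule perm_closed[where n = "length xs" and P = "\<lambda>zs. sim L N a (qv (pre @ zs)) t" and xs = ys])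
  fix us x y vs assume l: "length us + length vs + 2 = length xs" and s: "sim L N a (qv (pre @ us @ x # y # vs)) t"
  let ?k = "length (pre @ us)"
  have k: "?k \<le> 6" "length pre \<le> ?k" "?k + length vs = 6" using l len by auto
  have "sim L N a (refln (root ?k) (qv ((pre @ us) @ y # x # vs))) t"
    using s refln_root[of "pre @ us" vs y x] k by simp
  from sim_refl[OF L _ _ root_norm[OF k(1)] _ this] r[OF k(2,1)]
  show "sim L N a (qv (pre @ us @ y # x # vs)) t" by simp
qed (use m s mset_eq_length[OF m] in auto)

section \<open>Half-integral coordinates\<close>

definition hv :: "int list \<Rightarrow> real^8" where
  "hv xs = qv (map ((*) 2) xs)"

lemma hv_qv: "hv [a,b,c,d,e,f,g,h] = qv [2*a,2*b,2*c,2*d,2*e,2*f,2*g,2*h]"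
  by (simp add: hv_def)

lemma hv_inner:
  "hv [a,b,c,d,e,f,g,h] \<bullet> hv [a',b',c',d',e',f',g',h'] =
     of_int (a*a' + b*b' + c*c' + d*d' + e*e' + f*f' + g*g' + h*h') / 4"
  by (simp add: hv_qv qv_inner)

lemma hv_inner_Ints:
  "hv [a,b,c,d,e,f,g,h] \<bullet> hv [a',b',c',d',e',f',g',h'] \<in> \<int> \<longleftrightarrow>
     4 dvd (a*a' + b*b' + c*c' + d*d' + e*e' + f*f' + g*g' + h*h')"
  unfolding hv_inner
  using of_int_div_Ints[of 4 "a*a' + b*b' + c*c' + d*d' + e*e' + f*f' + g*g' + h*h'"] by (simp only: of_int_numeral)

lemma hv_add: "hv [a,b,c,d,e,f,g,h] + hv [a',b',c',d',e',f',g',h'] = hv [a+a',b+b',c+c',d+d',e+e',f+f',g+g',h+h']"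
  by (simp add: hv_qv qv_add algebra_simps)

lemma hv_diff: "hv [a,b,c,d,e,f,g,h] - hv [a',b',c',d',e',f',g',h'] = hv [a-a',b-b',c-c',d-d',e-e',f-f',g-g',h-h']"
  by (simp add: hv_qv qv_diff algebra_simps)

lemma hv_double: "2 *\<^sub>R hv [a,b,c,d,e,f,g,h] = hv [2*a,2*b,2*c,2*d,2*e,2*f,2*g,2*h]"
  using qv_scale[of 2] by (simp add: hv_qv)

lemma hv_E8:
  "hv [a,b,c,d,e,f,g,h] \<in> E8 \<longleftrightarrow> even (b-a) \<and> even (c-a) \<and> even (d-a) \<and> even (e-a)
     \<and> even (f-a) \<and> even (g-a) \<and> even (h-a) \<and> 4 dvd (a+b+c+d+e+f+g+h)"
proof -
  have 4: "4 dvd (2*u - 2*w) \<longleftrightarrow> even (u - w)" for u w :: int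
    using dvd_times_left_cancel_iff[of 2 2 "u - w"] by (simp add: algebra_simps)
  have 8: "8 dvd (2*a+2*b+2*c+2*d+2*e+2*f+2*g+2*h) \<longleftrightarrow> 4 dvd (a+b+c+d+e+f+g+h)"
    using dvd_times_left_cancel_iff[of 2 4 "a+b+c+d+e+f+g+h"] by (simp add: algebra_simps)
  show ?thesis unfolding hv_qv qv_E8 4 8 by simp
qed

lemma hv_even_norm:
  "even_norm (hv [a,b,c,d,e,f,g,h]) \<longleftrightarrow> 8 dvd (a*a + b*b + c*c + d*d + e*e + f*f + g*g + h*h)"
  unfolding hv_qv qv_even_norm
  using dvd_times_left_cancel_iff[of 4 8 "a*a + b*b + c*c + d*d + e*e + f*f + g*g + h*h"] by (simp add: algebra_simps)

text \<open>Squares agree with \<open>x mod 2\<close> modulo 4, so the norm counts the odd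
  entries.\<close>

lemma odd_count:
  assumes "even_norm (hv [a,b,c,d,e,f,g,h])"
  shows "4 dvd (a mod 2 + b mod 2 + c mod 2 + d mod 2 + e mod 2 + f mod 2 + g mod 2 + h mod 2)"
proof -
  have "\<exists>j. (x::int) * x = x mod 2 + 4 * j" for x
  proof (cases "even x")
    case True then show ?thesis by (auto elim!: evenE)
  next
    case False
    then obtain k where k: "x = 2 * k + 1" by (auto elim: oddE)
    show ?thesis by (rule exI[of _ "k * k + k"]) (simp add: k algebra_simps)
  qed
  then obtain J where J: "\<And>x::int. x * x = x mod 2 + 4 * J x" by metis
  have "4 dvd (a*a + b*b + c*c + d*d + e*e + f*f + g*g + h*h)"
    using assms unfolding hv_even_norm by (rule dvd_trans[rotated]) simp
  moreover have "a*a + b*b + c*c + d*d + e*e + f*f + g*g + h*h =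
    (a mod 2 + b mod 2 + c mod 2 + d mod 2 + e mod 2 + f mod 2 + g mod 2 + h mod 2)
    + 4 * (J a + J b + J c + J d + J e + J f + J g + J h)"
    unfolding J[of a] J[of b] J[of c] J[of d] J[of e] J[of f] J[of g] J[of h] by simp
  ultimately show ?thesis by (metis dvd_add_left_iff dvd_triv_left)
qed

lemma qv_E8I:
  "even a \<Longrightarrow> 4 dvd (b-a) \<Longrightarrow> 4 dvd (c-a) \<Longrightarrow> 4 dvd (d-a) \<Longrightarrow> 4 dvd (e-a) \<Longrightarrow> 4 dvd (f-a) \<Longrightarrow> 4 dvd (g-a)
    \<Longrightarrow> 4 dvd (h-a) \<Longrightarrow> a+b+c+d+e+f+g+h = 8 * s \<Longrightarrow> qv [a,b,c,d,e,f,g,h] \<in> E8"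
  unfolding qv_E8 by simp

lemma hv_E8I:
  "even (b-a) \<Longrightarrow> even (c-a) \<Longrightarrow> even (d-a) \<Longrightarrow> even (e-a) \<Longrightarrow> even (f-a) \<Longrightarrow> even (g-a)
    \<Longrightarrow> even (h-a) \<Longrightarrow> a+b+c+d+e+f+g+h = 4 * s \<Longrightarrow> hv [a,b,c,d,e,f,g,h] \<in> E8"
  unfolding hv_E8 by simp

text \<open>The reflection in this vector commutes with the one in \<open>root k\<close>, and their
  product negates two neighbouring coordinates.\<close>

definition root' :: "nat \<Rightarrow> real^8" where
  "root' k = qv (replicate k 0 @ [4, 4] @ replicate (6 - k) 0)"

lemma root'_simps:
  "root' 0 = qv [4,4,0,0,0,0,0,0]" "root' (Suc 0) = qv [0,4,4,0,0,0,0,0]" "root' 2 = qv [0,0,4,4,0,0,0,0]"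
  "root' 3 = qv [0,0,0,4,4,0,0,0]" "root' 4 = qv [0,0,0,0,4,4,0,0]" "root' 5 = qv [0,0,0,0,0,4,4,0]"
  "root' 6 = qv [0,0,0,0,0,0,4,4]"
  by (simp_all add: root'_def numeral_eq_Suc)

lemma root'_norm: "k \<le> 6 \<Longrightarrow> root' k \<bullet> root' k = 2"
  by (drule le_6_cases) (elim disjE; simp add: root'_simps qv_inner)

lemma root'_E8: "k \<le> 6 \<Longrightarrow> root' k \<in> E8"
  by (drule le_6_cases) (elim disjE; simp add: root'_simps qv_E8)

lemma refln_root':
  assumes "length us + length vs = 6"
  shows "refln (root' (length us)) (qv (us @ x # y # vs)) = qv (us @ -y # -x # vs)"
proof -
  note roots = root'_def[of 0] root'_def[of "Suc 0"] root'_def[of "Suc (Suc 0)"] root'_def[of "Suc (Suc (Suc 0))"]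
    root'_def[of "Suc (Suc (Suc (Suc 0)))"] root'_def[of "Suc (Suc (Suc (Suc (Suc 0))))"]
    root'_def[of "Suc (Suc (Suc (Suc (Suc (Suc 0)))))"]
  have *: "refln (root' 0) (qv [a,b,c,d,e,f,g,h]) = qv [-b,-a,c,d,e,f,g,h]"
    "refln (root' (Suc 0)) (qv [a,b,c,d,e,f,g,h]) = qv [a,-c,-b,d,e,f,g,h]"
    "refln (root' (Suc (Suc 0))) (qv [a,b,c,d,e,f,g,h]) = qv [a,b,-d,-c,e,f,g,h]"
    "refln (root' (Suc (Suc (Suc 0)))) (qv [a,b,c,d,e,f,g,h]) = qv [a,b,c,-e,-d,f,g,h]"
    "refln (root' (Suc (Suc (Suc (Suc 0))))) (qv [a,b,c,d,e,f,g,h]) = qv [a,b,c,d,-f,-e,g,h]"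
    "refln (root' (Suc (Suc (Suc (Suc (Suc 0)))))) (qv [a,b,c,d,e,f,g,h]) = qv [a,b,c,d,e,-g,-f,h]"
    "refln (root' (Suc (Suc (Suc (Suc (Suc (Suc 0))))))) (qv [a,b,c,d,e,f,g,h]) = qv [a,b,c,d,e,f,-h,-g]" for a b c d e f g h
    unfolding roots refln_def by (simp_all add: numeral_eq_Suc qv_inner) (simp_all add: vec_eq_iff forall_8 field_simps)
  have "length us \<le> 6" using assms by simp
  from le_6_cases[OF this] assms show ?thesis
    by (elim disjE) (auto simp: length_Suc_conv numeral_eq_Suc *)
qed

lemma sim_flip:
  assumes L: "even_group L" "even_group N" and l: "length us + length vs = 6"
    and r: "root (length us) \<in> L \<inter> N" "root' (length us) \<in> L \<inter> N" "root (length us) \<bullet> a = 0" "root' (length us) \<bullet> a = 0"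
    and s: "sim L N a (qv (us @ -x # -y # vs)) t"
  shows "sim L N a (qv (us @ x # y # vs)) t"
proof -
  have k: "length us \<le> 6" using l by simp
  have "sim L N a (qv (us @ y # x # vs)) t"
    by (rule sim_refl[OF L, of "root' (length us)"]) (use r root'_norm[OF k] s refln_root'[OF l, of y x] in auto)
  then show ?thesis
    by - (rule sim_refl[OF L, of "root (length us)"], use r root_norm[OF k] refln_root[OF l, of x y] in auto)
qed

text \<open>Signs change only in neighbouring pairs, so the last entry \<open>w\<close> keeps an
  uncontrolled sign. It is recovered from the sum: negating two odd entries x and y changes the sum
  by 2(x + y), a multiple of 4, so the original sum determines \<open>w\<close> modulo 4 once the
  other entries are 1 modulo 4.\<close>

lemma sim_signs:
  assumes L: "even_group L" "even_group N"
  shows "vs \<noteq> [] \<Longrightarrow> length us + length vs = 8 \<Longrightarrow> \<forall>x\<in>set vs. odd x \<Longrightarrow>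
    (\<And>k. length us \<le> k \<Longrightarrow> k \<le> 6 \<Longrightarrow> root k \<in> L \<inter> N \<and> root' k \<in> L \<inter> N \<and> root k \<bullet> a = 0 \<and> root' k \<bullet> a = 0) \<Longrightarrow>
    \<exists>ws w. length ws + 1 = length vs \<and> (\<forall>x\<in>set ws. x mod 4 = 1) \<and> odd w \<and> 4 dvd (sum_list vs - sum_list ws - w)
      \<and> sum_list (map (\<lambda>x. x * x) vs) = sum_list (map (\<lambda>x. x * x) ws) + w * w
      \<and> (\<forall>t. sim L N a (qv (us @ ws @ [w])) t \<longrightarrow> sim L N a (qv (us @ vs)) t)"
proof (induction "length vs" arbitrary: us vs)
  case (Suc n)
  obtain x vs' where vs: "vs = x # vs'" using Suc.hyps(2) by (cases vs) auto
  show ?case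
  proof (cases vs')
    case Nil
    show ?thesis by (rule exI[of _ "[]"], rule exI[of _ x]) (use Suc.prems in \<open>simp add: vs Nil\<close>)
  next
    case (Cons y vs'')
    have k: "length us \<le> 6" "length us + length vs'' = 6" using Suc.prems(2) by (auto simp: vs Cons)
    have IH: "\<exists>ws w. length ws + 1 = length (y' # vs'') \<and> (\<forall>x\<in>set ws. x mod 4 = 1) \<and> odd w
      \<and> 4 dvd (sum_list (y' # vs'') - sum_list ws - w)
      \<and> sum_list (map (\<lambda>x. x * x) (y' # vs'')) = sum_list (map (\<lambda>x. x * x) ws) + w * w
      \<and> (\<forall>t. sim L N a (qv ((us @ [x']) @ ws @ [w])) t \<longrightarrow> sim L N a (qv ((us @ [x']) @ y' # vs'')) t)"
      if "odd y'" for x' y'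
      by (rule Suc.hyps(1)) (use Suc.hyps(2) Suc.prems that in \<open>auto simp: vs Cons\<close>)
    have odd: "odd x" "odd y" using Suc.prems(3) by (auto simp: vs Cons)
    show ?thesis
    proof (cases "x mod 4 = 1")
      case True
      from IH[OF odd(2), of x] obtain ws w where "length ws + 1 = length (y # vs'')" "\<forall>x\<in>set ws. x mod 4 = 1" "odd w"
        "4 dvd (sum_list (y # vs'') - sum_list ws - w)"
        "sum_list (map (\<lambda>x. x * x) (y # vs'')) = sum_list (map (\<lambda>x. x * x) ws) + w * w"
        "\<forall>t. sim L N a (qv ((us @ [x]) @ ws @ [w])) t \<longrightarrow> sim L N a (qv ((us @ [x]) @ y # vs'')) t" by blast
      then show ?thesis using True
        by (intro exI[of _ "x # ws"] exI[of _ w]) (simp add: vs Cons)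
    next
      case False
      have x: "(- x) mod 4 = 1" using odd(1) False by presburger
      have "odd (- y)" using odd(2) by simp
      from IH[OF this, of "- x"] obtain ws w where ws: "length ws + 1 = length (y # vs'')" "\<forall>x\<in>set ws. x mod 4 = 1" "odd w"
        "4 dvd (sum_list ((- y) # vs'') - sum_list ws - w)"
        "sum_list (map (\<lambda>x. x * x) ((- y) # vs'')) = sum_list (map (\<lambda>x. x * x) ws) + w * w"
        "\<forall>t. sim L N a (qv ((us @ [- x]) @ ws @ [w])) t \<longrightarrow> sim L N a (qv ((us @ [- x]) @ (- y) # vs'')) t" by auto
      have e: "sum_list (x # y # vs'') - sum_list (- x # ws) - w
         = (sum_list ((- y) # vs'') - sum_list ws - w) + 2 * (x + y)" by simp
      have "4 dvd 2 * (x + y)" using odd by presburger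
      with ws(4) have d: "4 dvd (sum_list (x # y # vs'') - sum_list (- x # ws) - w)" unfolding e by (rule dvd_add)
      have "\<forall>t. sim L N a (qv (us @ - x # ws @ [w])) t \<longrightarrow> sim L N a (qv (us @ x # y # vs'')) t"
        using ws(6) sim_flip[OF L k(2), of a x y] Suc.prems(4)[OF order_refl k(1)] by simp
      then show ?thesis using x ws(1-3,5) d
        by (intro exI[of _ "(- x) # ws"] exI[of _ w]) (simp add: vs Cons)
    qed
  qed
qed simp

section \<open>Classes of \<open>E\<^sub>8 / 2E\<^sub>8\<close>\<close>

text \<open>Negating one odd entry \<open>u\<close> and one even entry \<open>w\<close> changes a
  sum by 2 modulo 4. This repairs a wrong residue in several sorted cases below.\<close>

lemma dvd_4_shift:
  fixes S u w :: int
  assumes "even S" "\<not> 4 dvd S" "odd u" "even w" shows "4 dvd (S - 2 * u - 2 * w)"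
proof -
  obtain k where k: "S = 2 * k" using assms(1) by (rule evenE)
  have "odd k" using assms(2) by (auto simp: k)
  then obtain q where q: "k = 2 * q + 1" by (rule oddE)
  obtain i where i: "u = 2 * i + 1" using assms(3) by (rule oddE)
  obtain j where j: "w = 2 * j" using assms(4) by (rule evenE)
  show ?thesis by (rule dvdI[of _ _ "q - i - j"]) (simp add: k q i j)
qed

lemma sim_E8_weight_4:
  assumes odd: "odd a" "odd b" "odd c" "odd d" and even: "even e" "even f" "even g" "even h"
  shows "sim E8 E8 0 (hv [a,b,c,d,e,f,g,h]) (qv [4,0,0,0,0,0,0,0])"
proof -
  note E = even_group_E8 even_group_E8
  have main: "sim E8 E8 0 (hv [a,b,c,d,e,f,g,h]) (qv [4,0,0,0,0,0,0,0])"
    if odd: "odd a" "odd b" "odd c" "odd d" and even: "even e" "even f" "even g" "even h"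
      and "4 dvd (a+b+c+d+e+f+g+h)" for a b c d e f g h
  proof (rule sim_shift[OF even_groupD(1)[OF even_group_E8], of _ "hv [1,1,1,1,0,0,0,0]"])
    obtain s where s: "a+b+c+d+e+f+g+h = 4 * s" using \<open>4 dvd _\<close> by (elim dvdE)
    show "hv [a,b,c,d,e,f,g,h] - hv [1,1,1,1,0,0,0,0] \<in> E8" unfolding hv_diff
      by (rule hv_E8I[of _ _ _ _ _ _ _ _ "s - 1"]) (use odd even s in simp_all)
    \<comment> \<open>Permutations and sign changes keep the number of odd entries, so leaving this
      case takes roots with half-integral coordinates. The second reflection lands on e_4, which is
      e_1 modulo E8.\<close>
    let ?r = "qv [2,2,2,-2,2,2,2,-2]" and ?r' = "qv [-2,-2,-2,2,2,2,2,-2]"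
    have r: "refln ?r (hv [1,1,1,1,0,0,0,0]) = qv [1,1,1,3,-1,-1,-1,1]"
      "refln ?r' (qv [1,1,1,3,-1,-1,-1,1]) = qv [0,0,0,4,0,0,0,0]"
      by (simp_all add: refln_def hv_qv qv_inner vec_eq_iff forall_8)
    show "sim E8 E8 0 (hv [1,1,1,1,0,0,0,0]) (qv [4,0,0,0,0,0,0,0])"
      by (rule sim_refl[OF E, of ?r], simp_all add: qv_E8 qv_inner r,
          rule sim_refl[OF E, of ?r'], simp_all add: qv_E8 qv_inner r,
          rule sim_base, simp add: qv_diff qv_E8)
  qed
  show ?thesis
  proof (cases "4 dvd (a+b+c+d+e+f+g+h)")
    case True then show ?thesis by (rule main[OF odd even])
  next
    case False
    have "even (a+b+c+d+e+f+g+h)" using odd even by simp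
    from dvd_4_shift[OF this False odd(1) even(1)]
    have "sim E8 E8 0 (hv [-a,b,c,d,-e,f,g,h]) (qv [4,0,0,0,0,0,0,0])"
      by (rule_tac main) (use odd even in \<open>simp_all add: algebra_simps\<close>)
    moreover have "refln (qv [4,0,0,0,-4,0,0,0]) (hv [a,b,c,d,e,f,g,h]) = hv [e,b,c,d,a,f,g,h]"
      "refln (qv [4,0,0,0,4,0,0,0]) (hv [e,b,c,d,a,f,g,h]) = hv [-a,b,c,d,-e,f,g,h]"
      by (simp_all add: refln_def hv_qv qv_inner vec_eq_iff forall_8 field_simps)
    ultimately show ?thesis
      by - (rule sim_refl[OF E, of "qv [4,0,0,0,-4,0,0,0]"], simp_all add: qv_E8 qv_inner,
          rule sim_refl[OF E, of "qv [4,0,0,0,4,0,0,0]"], simp_all add: qv_E8 qv_inner)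
  qed
qed

text \<open>The number of odd entries is a multiple of 4. Four odd entries are sorted to the front;
  the counts 0 and 8 are settled by the sum modulo 4 alone.\<close>

lemma sim_E8_half:
  assumes "even (a+b+c+d+e+f+g+h)" and n: "even_norm (hv [a,b,c,d,e,f,g,h])" and no: "hv [a,b,c,d,e,f,g,h] \<notin> E8"
  shows "sim E8 E8 0 (hv [a,b,c,d,e,f,g,h]) (qv [4,0,0,0,0,0,0,0])"
proof -
  obtain os es where oe: "mset [a,b,c,d,e,f,g,h] = mset (os @ es)" "\<forall>x\<in>set os. odd x" "\<forall>x\<in>set es. even x"
    "int (length os) = sum_list (map (\<lambda>x. x mod 2) [a,b,c,d,e,f,g,h])" by (rule parity_split)
  have len: "length os + length es = 8" using mset_eq_length[OF oe(1)] by simp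
  have set: "set [a,b,c,d,e,f,g,h] = set (os @ es)" using mset_eq_setD[OF oe(1)] .
  have "4 dvd int (length os)" unfolding oe(4) using odd_count[OF n]
    by (simp only: list.map sum_list.Cons sum_list.Nil add_0_right add.assoc)
  then have "4 dvd length os" by presburger
  moreover have "length os \<le> 8" using len by simp
  ultimately have "length os = 0 \<or> length os = 4 \<or> length os = 8" by presburger
  then show ?thesis
  proof (elim disjE)
    \<comment> \<open>Here every square is 2x modulo 8, so the even norm would put the vector into
      E8.\<close>
    assume "length os = 0"
    then have ev: "even a" "even b" "even c" "even d" "even e" "even f" "even g" "even h"
      using oe(3) set by auto
    have "\<exists>j. x * x = 2 * x + 8 * j" if "even x" for x :: int using square_cong[of x] that by simp
    then obtain J where J: "\<And>x::int. even x \<Longrightarrow> x * x = 2 * x + 8 * J x" by metis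
    obtain s where "a*a + b*b + c*c + d*d + e*e + f*f + g*g + h*h = 8 * s" using n unfolding hv_even_norm by (elim dvdE)
    then have "a+b+c+d+e+f+g+h = 4 * (s - (J a + J b + J c + J d + J e + J f + J g + J h))"
      unfolding J[OF ev(1)] J[OF ev(2)] J[OF ev(3)] J[OF ev(4)] J[OF ev(5)] J[OF ev(6)] J[OF ev(7)] J[OF ev(8)] by simp
    then have "hv [a,b,c,d,e,f,g,h] \<in> E8" by (rule hv_E8I[rotated 7]) (simp_all add: ev)
    with no show ?thesis by simp
  next
    assume l4: "length os = 4"
    then have "length es = 4" using len by simp
    then obtain a' b' c' d' e' f' g' h' where os: "os = [a',b',c',d']" "es = [e',f',g',h']"
      using l4 by (auto simp: length_Suc_conv numeral_eq_Suc)
    have "sim E8 E8 0 (qv ([] @ [2*a,2*b,2*c,2*d,2*e,2*f,2*g,2*h])) (qv [4,0,0,0,0,0,0,0])"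
    proof (rule sim_sort[OF even_group_E8 even_group_E8])
      show "mset [2*a,2*b,2*c,2*d,2*e,2*f,2*g,2*h] = mset (map ((*) 2) (os @ es))"
        unfolding mset_map oe(1)[symmetric] by simp
      show "sim E8 E8 0 (qv ([] @ map ((*) 2) (os @ es))) (qv [4,0,0,0,0,0,0,0])"
        using sim_E8_weight_4[of a' b' c' d' e' f' g' h'] oe(2,3) by (simp add: hv_def os)
    qed (auto simp: root_E8)
    then show ?thesis by (simp add: hv_def)
  next
    assume "length os = 8"
    then have od: "odd a" "odd b" "odd c" "odd d" "odd e" "odd f" "odd g" "odd h"
      using oe(2) set len by auto
    have "\<not> 4 dvd (a+b+c+d+e+f+g+h)"
    proof
      assume "4 dvd (a+b+c+d+e+f+g+h)"
      then have "hv [a,b,c,d,e,f,g,h] \<in> E8" unfolding hv_E8 using od by simp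
      with no show False by simp
    qed
    moreover obtain u where u: "a+b+c+d+e+f+g+h = 2 * u" using assms(1) by (rule evenE)
    ultimately have "odd u" by auto
    then obtain s where s: "u = 2 * s + 1" by (rule oddE)
    have "hv [a,b,c,d,e,f,g,h] - hv [2,0,0,0,0,0,0,0] \<in> E8" unfolding hv_diff
      by (rule hv_E8I[of _ _ _ _ _ _ _ _ s]) (use od u s in simp_all)
    then show ?thesis by (intro sim_base) (simp add: hv_qv)
  qed
qed

text \<open>Modulo 2 E8, the vector 2y is nonzero and singular for the quadratic form x.x/2, and
  such classes are those of the vectors of norm 4; the target e_1 is half of one of these. As e_1
  has odd norm, it only stands for its class until \<open>to_t1\<close> replaces it.\<close>

lemma sim_E8:
  assumes "2 *\<^sub>R y \<in> E8" "even_norm y" "y \<notin> E8"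
  shows "sim E8 E8 0 y (qv [4,0,0,0,0,0,0,0])"
proof -
  note E = even_group_E8 even_group_E8
  obtain m a b c d e f g h k where y: "y = qv [m+2*a, m+2*b, m+2*c, m+2*d, m+2*e, m+2*f, m+2*g, m+2*h]"
    and k: "a + b + c + d + e + f + g + h = 2 * k" using double_E8_qvE[OF assms(1)] .
  show ?thesis
  proof (cases "even m")
    case True
    then obtain n where n: "m = 2 * n" by (rule evenE)
    have y': "y = hv [n+a, n+b, n+c, n+d, n+e, n+f, n+g, n+h]" unfolding y n hv_qv by (simp add: algebra_simps)
    have s: "(n+a)+(n+b)+(n+c)+(n+d)+(n+e)+(n+f)+(n+g)+(n+h) = 2 * (4 * n + k)" using k by simp
    show ?thesis using assms(2,3) unfolding y' by (intro sim_E8_half) (simp only: s, simp)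
  next
    case False
    let ?vs = "[m+2*a, m+2*b, m+2*c, m+2*d, m+2*e, m+2*f, m+2*g, m+2*h]"
    obtain ws w where ws: "length ws + 1 = length ?vs" "\<forall>x\<in>set ws. x mod 4 = 1" "odd w"
      "4 dvd (sum_list ?vs - sum_list ws - w)"
      "sum_list (map (\<lambda>x. x * x) ?vs) = sum_list (map (\<lambda>x. x * x) ws) + w * w"
      "sim E8 E8 0 (qv ([] @ ws @ [w])) (qv [4,0,0,0,0,0,0,0]) \<longrightarrow> sim E8 E8 0 (qv ([] @ ?vs)) (qv [4,0,0,0,0,0,0,0])"
      using sim_signs[OF E, of ?vs "[]" 0] False by (auto simp: root_E8 root'_E8)
    then have "length ws = 7" by simp
    then obtain x1 x2 x3 x4 x5 x6 x7 where wl: "ws = [x1,x2,x3,x4,x5,x6,x7]"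
      by (auto simp: length_Suc_conv numeral_eq_Suc)
    have z: "\<exists>z. x = 1 + 4 * z" if "x mod 4 = 1" for x :: int
      by (rule exI[of _ "x div 4"]) (use that in presburger)
    then obtain z where z: "\<And>x::int. x mod 4 = 1 \<Longrightarrow> x = 1 + 4 * z x" by metis
    obtain z1 z2 z3 z4 z5 z6 z7 where zs: "x1 = 1 + 4 * z1" "x2 = 1 + 4 * z2" "x3 = 1 + 4 * z3" "x4 = 1 + 4 * z4"
      "x5 = 1 + 4 * z5" "x6 = 1 + 4 * z6" "x7 = 1 + 4 * z7" using ws(2) z by (simp add: wl) metis
    have "4 dvd (w - 1)"
    proof -
      obtain q where "sum_list ?vs - sum_list ws - w = 4 * q" using ws(4) by (rule dvdE)
      then have "w - 1 = 4 * (2 * m + k - 2 - z1 - z2 - z3 - z4 - z5 - z6 - z7 - q)"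
        using k by (simp add: wl zs)
      then show ?thesis by (rule dvdI)
    qed
    then obtain z8 where z8: "w - 1 = 4 * z8" by (rule dvdE)
    then have w: "w = 1 + 4 * z8" by simp
    have "\<exists>j. n * n = n + 2 * j" for n :: int
    proof -
      have "even (n * (n - 1))" by simp
      then obtain j where "n * (n - 1) = 2 * j" by (rule evenE)
      then show ?thesis by (intro exI[of _ j]) (simp add: algebra_simps)
    qed
    then obtain J where J: "\<And>n::int. n * n = n + 2 * J n" by metis
    \<comment> \<open>Through the term 24n, the norm modulo 32 sees the parity of the sum of the
      \<open>z\<close>s, which comes out odd.\<close>
    have sq: "(1 + 4 * n) * (1 + 4 * n) = 1 + 24 * n + 32 * J n" for n :: int
      using J[of n] by (simp add: algebra_simps)
    have "32 dvd sum_list (map (\<lambda>x. x * x) ?vs)"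
      using assms(2) unfolding y qv_even_norm by (simp only: list.map sum_list.Cons sum_list.Nil add_0_right add.assoc)
    then obtain s where "sum_list (map (\<lambda>x. x * x) ?vs) = 32 * s" by (rule dvdE)
    then have "24 * (z1+z2+z3+z4+z5+z6+z7+z8) + 8 = 32 * (s - (J z1 + J z2 + J z3 + J z4 + J z5 + J z6 + J z7 + J z8))"
      using ws(5) unfolding wl zs w list.map sum_list.Cons sum_list.Nil sq by simp
    then have "3 * (z1+z2+z3+z4+z5+z6+z7+z8) + 1 = 4 * (s - (J z1 + J z2 + J z3 + J z4 + J z5 + J z6 + J z7 + J z8))"
      by simp
    then have "even (3 * (z1+z2+z3+z4+z5+z6+z7+z8) + 1)" by simp
    then have "odd (z1+z2+z3+z4+z5+z6+z7+z8)" by simp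
    then obtain r where r: "z1+z2+z3+z4+z5+z6+z7+z8 = 2 * r + 1" by (rule oddE)
    \<comment> \<open>The representative (3,-1,...,-1)/4 is the image of e_1 under the reflection in
      \<open>half_ones\<close>.\<close>
    have "sim E8 E8 0 (qv [x1,x2,x3,x4,x5,x6,x7,w]) (qv [4,0,0,0,0,0,0,0])"
    proof (rule sim_shift[OF even_groupD(1)[OF even_group_E8], of _ "qv [3,-1,-1,-1,-1,-1,-1,-1]"])
      show "qv [x1,x2,x3,x4,x5,x6,x7,w] - qv [3,-1,-1,-1,-1,-1,-1,-1] \<in> E8" unfolding qv_diff zs w
        by (rule qv_E8I[of _ _ _ _ _ _ _ _ "r + 2"]) (presburger | use r in simp)+
      have "refln half_ones (qv [3,-1,-1,-1,-1,-1,-1,-1]) = qv [4,0,0,0,0,0,0,0]"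
        by (simp add: half_ones_qv refln_def qv_inner vec_eq_iff forall_8)
      then show "sim E8 E8 0 (qv [3,-1,-1,-1,-1,-1,-1,-1]) (qv [4,0,0,0,0,0,0,0])"
        by - (rule sim_refl[OF E, of half_ones],
          simp_all add: half_ones_qv qv_E8 qv_inner sim_base subgrp_0[OF even_groupD(1)[OF even_group_E8]])
    qed
    then show ?thesis using ws(6) by (simp add: wl y)
  qed
qed

section \<open>Connecting roots\<close>

text \<open>The norms of x + y and x - y are nonnegative, so x.y is one of 1, 2, -1, -2. For 1 the
  reflection in the root x - y exchanges the two vectors; for -1 the root x + y leads to -y, and the
  reflection in y corrects the sign.\<close>

lemma root_step:
  assumes L: "even_group L" "even_group N" and x: "x \<in> L" "x \<in> N" "x \<bullet> x = 2" and y: "y \<in> L" "y \<in> N" "y \<bullet> y = 2"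
    and xy: "x \<bullet> y \<noteq> 0"
  shows "\<exists>h. orthogonal_transformation h \<and> h ` L = L \<and> h ` N = N \<and> h x = y"
proof -
  note s = even_groupD(1)[OF L(1)] even_groupD(1)[OF L(2)]
  obtain k :: int where k: "x \<bullet> y = of_int k" using even_groupD(2)[OF L(1) x(1) y(1)] by (auto elim: Ints_cases)
  have p: "(x + y) \<bullet> (x + y) = 4 + 2 * of_int k" and m: "(x - y) \<bullet> (x - y) = 4 - 2 * of_int k"
    using k x(3) y(3) by (simp_all add: inner_add_left inner_add_right inner_diff_left inner_diff_right inner_commute)
  have "0 \<le> (x + y) \<bullet> (x + y)" "0 \<le> (x - y) \<bullet> (x - y)" by simp_all
  then have "- 2 \<le> k" "k \<le> 2" unfolding p m by simp_all
  then have "k = 2 \<or> k = 1 \<or> k = -1 \<or> k = -2" using xy k by auto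
  have R: "orthogonal_transformation (refln r) \<and> refln r ` L = L \<and> refln r ` N = N"
    if "r \<in> L" "r \<in> N" "r \<bullet> r = 2" for r
    using refln_orth refln_image[OF L(1)] refln_image[OF L(2)] that by blast
  from \<open>k = 2 \<or> _\<close> show ?thesis
  proof (elim disjE)
    assume "k = 2"
    then have "x = y" using m by simp
    then show ?thesis by (intro exI[of _ "\<lambda>x. x"]) (auto simp: orthogonal_transformation_def linear_id[unfolded id_def])
  next
    assume "k = 1"
    then have "(x - y) \<bullet> (x - y) = 2" using m by simp
    moreover have "refln (x - y) x = y" using \<open>k = 1\<close> k x(3) by (simp add: refln_def inner_diff_right)
    ultimately show ?thesis using R[of "x - y"] x y s by (auto simp: subgrp_diff)
  next
    assume "k = -2"
    then have "x + y = 0" using p by simp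
    then have "y = - x" by (simp add: eq_neg_iff_add_eq_0 add.commute)
    then have "refln x x = y" using x(3) by (simp add: refln_def scaleR_2)
    then show ?thesis using R[of x] x by blast
  next
    assume "k = -1"
    then have pp: "(x + y) \<bullet> (x + y) = 2" using p by simp
    have "refln (x + y) x = - y" using \<open>k = -1\<close> k x(3) by (simp add: refln_def inner_add_right)
    moreover have "refln y (- y) = y" using y(3) by (simp add: refln_def scaleR_2)
    ultimately have "(refln y \<circ> refln (x + y)) x = y" by simp
    moreover have "orthogonal_transformation (refln y \<circ> refln (x + y))"
      by (intro orthogonal_transformation_compose refln_orth y pp)
    moreover have "(refln y \<circ> refln (x + y)) ` L = L" "(refln y \<circ> refln (x + y)) ` N = N"
      unfolding image_comp[symmetric] using R[of y] R[of "x + y"] pp x y s by (auto simp: subgrp_add)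
    ultimately show ?thesis by blast
  qed
qed

lemma root_step2:
  assumes L: "even_group L" "even_group N" and x: "x \<in> L" "x \<in> N" "x \<bullet> x = 2" and y: "y \<in> L" "y \<in> N" "y \<bullet> y = 2"
    and z: "z \<in> L" "z \<in> N" "z \<bullet> z = 2" "x \<bullet> z \<noteq> 0" "z \<bullet> y \<noteq> 0"
  shows "\<exists>h. orthogonal_transformation h \<and> h ` L = L \<and> h ` N = N \<and> h x = y"
proof -
  obtain h h' where h: "orthogonal_transformation h" "h ` L = L" "h ` N = N" "h x = z"
    and h': "orthogonal_transformation h'" "h' ` L = L" "h' ` N = N" "h' z = y"
    using root_step[OF L x z(1-4)] root_step[OF L z(1-3) y z(5)] by blast
  have "(h' \<circ> h) ` L = L" "(h' \<circ> h) ` N = N" unfolding image_comp[symmetric] using h h' by simp_all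
  then show ?thesis using orthogonal_transformation_compose[OF h'(1) h(1)] h(4) h'(4)
    by (intro exI[of _ "h' \<circ> h"]) simp
qed

section \<open>Normal forms of neighbours\<close>

text \<open>\<open>N\<^sub>i\<close> is the standard \<open>(\<int>/2)\<^sup>i\<close>-neighbour, and \<open>tz\<close> generates the standard \<open>\<int>/4\<close>-neighbour. The root \<open>\<alpha>0\<close>
  belongs to all of them except \<open>N\<^sub>4\<close>.\<close>

definition "t1 = hv [3,1,1,1,1,1,1,1]"
definition "t2 = hv [1,1,1,1,0,0,0,2]"
definition "t3 = hv [2,0,-1,-1,1,-1,0,0]"
definition "t4 = hv [1,2,1,0,-1,0,-1,0]"
definition "tz = qv [3,1,3,3,3,3,3,3]"
definition "\<alpha>0 = hv [2,2,0,0,0,0,0,0]"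

definition "N1 = nbr E8 t1"
definition "N2 = nbr N1 t2"
definition "N3 = nbr N2 t3"
definition "N4 = nbr N3 t4"

lemmas t_defs = t1_def t2_def t3_def t4_def \<alpha>0_def

lemma t_even: "even_norm t1" "even_norm t2" "even_norm t3" "even_norm t4" "even_norm tz"
  unfolding t_defs hv_even_norm tz_def qv_even_norm by simp_all

lemma N_even_group: "even_group N1" "even_group N2" "even_group N3" "even_group N4"
proof -
  show 1: "even_group N1" unfolding N1_def by (intro nbr_even_group even_group_E8 t_even)
  show 2: "even_group N2" unfolding N2_def by (intro nbr_even_group 1 t_even)
  show 3: "even_group N3" unfolding N3_def by (intro nbr_even_group 2 t_even)
  show "even_group N4" unfolding N4_def by (intro nbr_even_group 3 t_even)
qed

lemma N1_memI: "x \<in> E8 \<Longrightarrow> x \<bullet> t1 \<in> \<int> \<Longrightarrow> x \<in> N1"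
  and N2_memI: "x \<in> E8 \<Longrightarrow> x \<bullet> t1 \<in> \<int> \<Longrightarrow> x \<bullet> t2 \<in> \<int> \<Longrightarrow> x \<in> N2"
  and N3_memI: "x \<in> E8 \<Longrightarrow> x \<bullet> t1 \<in> \<int> \<Longrightarrow> x \<bullet> t2 \<in> \<int> \<Longrightarrow> x \<bullet> t3 \<in> \<int> \<Longrightarrow> x \<in> N3"
  unfolding N1_def N2_def N3_def by (simp_all add: nbr_memI)

lemma t_inner: "t1 \<bullet> t2 \<in> \<int>" "t1 \<bullet> t3 \<in> \<int>" "t2 \<bullet> t3 \<in> \<int>"
  unfolding t_defs hv_inner_Ints by simp_all

lemma t_mem: "t1 \<in> N1" "t1 \<in> N2" "t2 \<in> N2" "t1 \<in> N3" "t2 \<in> N3" "t3 \<in> N3"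
proof -
  note s = even_groupD(1)[OF even_group_E8] N_even_group[THEN even_groupD(1)]
  show 1: "t1 \<in> N1" unfolding N1_def by (rule nbr_self[OF s(1)])
  show 2: "t1 \<in> N2" unfolding N2_def by (rule nbr_memI[OF 1 t_inner(1)])
  show 3: "t2 \<in> N2" unfolding N2_def by (rule nbr_self[OF s(2)])
  show "t1 \<in> N3" unfolding N3_def by (rule nbr_memI[OF 2 t_inner(2)])
  show "t2 \<in> N3" unfolding N3_def by (rule nbr_memI[OF 3 t_inner(3)])
  show "t3 \<in> N3" unfolding N3_def by (rule nbr_self[OF s(3)])
qed

lemma N_0: "0 \<in> N1" "0 \<in> N2" "0 \<in> N3"
  using N_even_group[THEN even_groupD(1)] subgrp_0 by blast+

lemma qv_t_Ints:
  "qv [a,b,c,d,e,f,g,h] \<bullet> t1 \<in> \<int> \<longleftrightarrow> 8 dvd (3*a+b+c+d+e+f+g+h)"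
proof -
  have e: "a*(2*3)+b*(2*1)+c*(2*1)+d*(2*1)+e*(2*1)+f*(2*1)+g*(2*1)+h*(2*1) = 2*(3*a+b+c+d+e+f+g+h)" by simp
  show ?thesis unfolding t1_def hv_qv qv_inner of_int_16_Ints e
    using dvd_times_left_cancel_iff[of 2 8 "3*a+b+c+d+e+f+g+h"] by simp
qed

text \<open>An odd \<open>m\<close> would make the pairing of 2y with \<open>t1\<close>
  non-integral. So once \<open>t1\<close> has been adjoined, all further generators have
  half-integral coordinates, and their parity patterns can be studied.\<close>

lemma half_coords:
  assumes "2 *\<^sub>R y \<in> E8" "(2 *\<^sub>R y) \<bullet> t1 \<in> \<int>"
  obtains a b c d e f g h where "y = hv [a,b,c,d,e,f,g,h]" "even (a+b+c+d+e+f+g+h)"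
proof -
  obtain m a b c d e f g h k where y: "y = qv [m+2*a, m+2*b, m+2*c, m+2*d, m+2*e, m+2*f, m+2*g, m+2*h]"
    and k: "a + b + c + d + e + f + g + h = 2 * k" using double_E8_qvE[OF assms(1)] .
  have y2: "2 *\<^sub>R y = qv [2*(m+2*a), 2*(m+2*b), 2*(m+2*c), 2*(m+2*d), 2*(m+2*e), 2*(m+2*f), 2*(m+2*g), 2*(m+2*h)]"
    unfolding y using qv_scale[of 2] by simp
  have "8 dvd (3*(2*(m+2*a))+2*(m+2*b)+2*(m+2*c)+2*(m+2*d)+2*(m+2*e)+2*(m+2*f)+2*(m+2*g)+2*(m+2*h))"
    using assms(2) unfolding y2 qv_t_Ints .
  then obtain q where "3*(2*(m+2*a))+2*(m+2*b)+2*(m+2*c)+2*(m+2*d)+2*(m+2*e)+2*(m+2*f)+2*(m+2*g)+2*(m+2*h) = 8 * q"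
    by (rule dvdE)
  then have "m = 2 * (q - k - a - 2 * m)" using k by simp
  then obtain n where n: "m = 2 * n" by blast
  have y': "y = hv [n+a, n+b, n+c, n+d, n+e, n+f, n+g, n+h]" unfolding y n hv_qv by (simp add: algebra_simps)
  have s: "(n+a)+(n+b)+(n+c)+(n+d)+(n+e)+(n+f)+(n+g)+(n+h) = 2 * (4 * n + k)" using k by simp
  show ?thesis by (rule that[OF y']) (simp only: s, simp)
qed

lemma same_parity:
  assumes "even (b-a)" "even (c-a)" "even (d-a)" "even (e-a)" "even (f-a)" "even (g-a)" "even (h-a)"
    "even (a+b+c+d+e+f+g+h)"
  shows "hv [a,b,c,d,e,f,g,h] \<in> E8 \<or> hv [a,b,c,d,e,f,g,h] + t1 \<in> E8"
proof -
  obtain k where k: "a+b+c+d+e+f+g+h = 2 * k" using assms(8) by (rule evenE)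
  show ?thesis
  proof (cases "even k")
    case True
    then obtain s where "k = 2 * s" by (rule evenE)
    then have "hv [a,b,c,d,e,f,g,h] \<in> E8" using k by (intro hv_E8I[of _ _ _ _ _ _ _ _ s] assms) simp
    then show ?thesis ..
  next
    case False
    then obtain s where "k = 2 * s + 1" by (rule oddE)
    then have "hv [a,b,c,d,e,f,g,h] + t1 \<in> E8" unfolding t1_def hv_add using k assms(1-7)
      by (intro hv_E8I[of _ _ _ _ _ _ _ _ "s + 3"]) simp_all
    then show ?thesis ..
  qed
qed

text \<open>This is how independence in a chain is used: a vector of constant parity and even sum
  lies in E8 up to \<open>t1\<close>, so no translate of \<open>y\<close> by \<open>N\<close> is of
  this kind.\<close>

lemma not_same_parity:
  assumes N: "subgrp N" "t1 \<in> N" and no: "\<forall>k\<in>N. y + k \<notin> E8" and s: "s \<in> N"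
    and y: "y + s = hv [a,b,c,d,e,f,g,h]"
    and par: "even (b-a)" "even (c-a)" "even (d-a)" "even (e-a)" "even (f-a)" "even (g-a)" "even (h-a)"
    "even (a+b+c+d+e+f+g+h)"
  shows False
proof -
  from same_parity[OF par] have "y + s \<in> E8 \<or> y + (s + t1) \<in> E8" unfolding y[symmetric] by (simp add: add.assoc)
  then show False using no s subgrp_add[OF N(1) s N(2)] by blast
qed

lemma \<alpha>0_props: "\<alpha>0 \<in> E8" "\<alpha>0 \<bullet> \<alpha>0 = 2" "\<alpha>0 \<in> N1"
proof -
  show E: "\<alpha>0 \<in> E8" "\<alpha>0 \<bullet> \<alpha>0 = 2" unfolding \<alpha>0_def hv_E8 hv_inner by simp_all
  show "\<alpha>0 \<in> N1" by (rule N1_memI[OF E(1)]) (simp add: t1_def \<alpha>0_def hv_inner_Ints)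
qed

text \<open>The common roots of E8 and \<open>N1\<close> have integral coordinates, so they form the
  irreducible system D_8. A root orthogonal to \<open>\<alpha>0\<close> is linked to it through some
  e_1 + e_k with k > 2.\<close>

lemma root_to_\<alpha>0:
  assumes x: "x \<in> E8" "x \<bullet> x = 2" "x \<bullet> t1 \<in> \<int>"
  shows "\<exists>h. orthogonal_transformation h \<and> h ` E8 = E8 \<and> h ` N1 = N1 \<and> h x = \<alpha>0"
proof -
  have s: "subgrp E8" using even_group_E8 by (rule even_groupD)
  note E = even_group_E8 N_even_group(1)
  obtain m a b c d e f g h k where
    x': "x = qv [2*m+4*a, 2*m+4*b, 2*m+4*c, 2*m+4*d, 2*m+4*e, 2*m+4*f, 2*m+4*g, 2*m+4*h]"
    and k: "a + b + c + d + e + f + g + h = 2 * k" using E8_paramE[OF x(1)] .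
  have "8 dvd (3*(2*m+4*a)+(2*m+4*b)+(2*m+4*c)+(2*m+4*d)+(2*m+4*e)+(2*m+4*f)+(2*m+4*g)+(2*m+4*h))"
    using x(3) unfolding x' qv_t_Ints .
  then obtain q where "3*(2*m+4*a)+(2*m+4*b)+(2*m+4*c)+(2*m+4*d)+(2*m+4*e)+(2*m+4*f)+(2*m+4*g)+(2*m+4*h) = 8 * q"
    by (rule dvdE)
  then have "m = 2 * (q - k - a - 2 * m)" using k by simp
  then obtain n where n: "m = 2 * n" by blast
  obtain x1 x2 x3 x4 x5 x6 x7 x8 where xs: "x1 = n+a" "x2 = n+b" "x3 = n+c" "x4 = n+d" "x5 = n+e" "x6 = n+f" "x7 = n+g" "x8 = n+h"
    by blast
  have xq: "x = qv [4*x1,4*x2,4*x3,4*x4,4*x5,4*x6,4*x7,4*x8]" unfolding x' n xs by (simp add: algebra_simps)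
  have "real_of_int (x1*x1+x2*x2+x3*x3+x4*x4+x5*x5+x6*x6+x7*x7+x8*x8) = of_int 2"
    using x(2) unfolding xq qv_inner by simp
  then have nrm: "x1*x1+x2*x2+x3*x3+x4*x4+x5*x5+x6*x6+x7*x7+x8*x8 = 2" by (simp only: of_int_eq_iff)
  have a0: "\<alpha>0 = qv [4,4,0,0,0,0,0,0]" by (simp add: \<alpha>0_def hv_qv)
  have xN: "x \<in> N1" using x by (intro N1_memI)
  have ia: "x \<bullet> \<alpha>0 = of_int (x1 + x2)" unfolding xq a0 qv_inner by simp
  show ?thesis
  proof (cases "x1 + x2 = 0")
    case False
    then have "x \<bullet> \<alpha>0 \<noteq> 0" unfolding ia of_int_eq_0_iff .
    then show ?thesis using root_step[OF E x(1) xN x(2) \<alpha>0_props(1,3,2)] by blast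
  next
    case True
    have *: ?thesis if z: "z \<in> E8" "z \<bullet> t1 \<in> \<int>" "z \<bullet> z = 2" "x \<bullet> z \<noteq> 0" "z \<bullet> \<alpha>0 \<noteq> 0" for z
      using root_step2[OF E x(1) xN x(2) \<alpha>0_props(1,3,2) z(1) N1_memI[OF z(1,2)] z(3-5)] .
    have x2: "x2 = - x1" using True by simp
    have sq: "0 \<le> n * n" for n :: int by simp
    show ?thesis
    proof (cases "x1 = 0")
      case False
      have "x1 * x1 \<ge> 1" using False by (metis int_one_le_iff_zero_less linorder_neqE_linordered_idom zero_less_mult_iff)
      moreover have "2 * (x1*x1)+x3*x3+x4*x4+x5*x5+x6*x6+x7*x7+x8*x8 = 2" using nrm x2 by simp
      ultimately have "x3 * x3 \<le> 0" using sq[of x4] sq[of x5] sq[of x6] sq[of x7] sq[of x8] by linarith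
      then have "x3 = 0" by (metis antisym mult_eq_0_iff sq)
      then show ?thesis using False
        by (intro *[of "qv [4,0,4,0,0,0,0,0]"]) (simp_all add: qv_E8 qv_t_Ints qv_inner xq a0)
    next
      case 0: True
      then have "x3 \<noteq> 0 \<or> x4 \<noteq> 0 \<or> x5 \<noteq> 0 \<or> x6 \<noteq> 0 \<or> x7 \<noteq> 0 \<or> x8 \<noteq> 0" using nrm x2 by auto
      then show ?thesis
      proof (elim disjE)
        assume "x3 \<noteq> 0" then show ?thesis
          by (intro *[of "qv [4,0,4,0,0,0,0,0]"]) (simp_all add: qv_E8 qv_t_Ints qv_inner xq a0 0)
      next
        assume "x4 \<noteq> 0" then show ?thesis
          by (intro *[of "qv [4,0,0,4,0,0,0,0]"]) (simp_all add: qv_E8 qv_t_Ints qv_inner xq a0 0)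
      next
        assume "x5 \<noteq> 0" then show ?thesis
          by (intro *[of "qv [4,0,0,0,4,0,0,0]"]) (simp_all add: qv_E8 qv_t_Ints qv_inner xq a0 0)
      next
        assume "x6 \<noteq> 0" then show ?thesis
          by (intro *[of "qv [4,0,0,0,0,4,0,0]"]) (simp_all add: qv_E8 qv_t_Ints qv_inner xq a0 0)
      next
        assume "x7 \<noteq> 0" then show ?thesis
          by (intro *[of "qv [4,0,0,0,0,0,4,0]"]) (simp_all add: qv_E8 qv_t_Ints qv_inner xq a0 0)
      next
        assume "x8 \<noteq> 0" then show ?thesis
          by (intro *[of "qv [4,0,0,0,0,0,0,4]"]) (simp_all add: qv_E8 qv_t_Ints qv_inner xq a0 0)
      qed
    qed
  qed
qed

section \<open>Normalising the second generator\<close>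

lemma mod_2_succ: "(x + 1) mod 2 = 1 - x mod 2" for x :: int
  by presburger

lemma root_N1: "2 \<le> k \<Longrightarrow> k \<le> 6 \<Longrightarrow> root k \<in> E8 \<and> root k \<in> N1 \<and> root k \<bullet> \<alpha>0 = 0"
  by (drule le_6_cases, elim disjE)
    (auto simp: root_simps qv_E8 t1_def hv_qv qv_inner \<alpha>0_def intro!: N1_memI)

lemma root_N2: "4 \<le> k \<Longrightarrow> k \<le> 6 \<Longrightarrow> root k \<in> E8 \<and> root k \<in> N2 \<and> root k \<bullet> \<alpha>0 = 0"
  by (drule le_6_cases, elim disjE)
    (auto simp: root_simps qv_E8 t1_def t2_def hv_qv qv_inner \<alpha>0_def intro!: N2_memI)

text \<open>These values of \<open>k\<close> belong to the coordinate pairs {1,2}, {3,4}, {5,6},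
  {7,8}, the ones which the parities of \<open>t1\<close>, \<open>t2\<close>, \<open>t3\<close> do
  not separate.\<close>

lemma root_N3: "k = 0 \<or> k = 2 \<or> k = 4 \<or> k = 6 \<Longrightarrow> root k \<in> E8 \<inter> N3 \<and> root' k \<in> E8 \<inter> N3"
  by (elim disjE)
    (auto simp: root_simps root'_simps qv_E8 t1_def t2_def t3_def hv_qv qv_inner intro!: N3_memI)

text \<open>Given the parities, it suffices for congruence to \<open>t2\<close> modulo
  \<open>N1\<close> that the sums of the entries agree modulo 4, and 6 is that sum for
  \<open>t2\<close>. A wrong residue is repaired in coordinates 3 and 8, away from the support of
  \<open>\<alpha>0\<close>.\<close>

lemma sim_N1_sorted:
  assumes odd: "odd a" "odd b" "odd c" "odd d" and even: "even e" "even f" "even g" "even h"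
  shows "sim E8 N1 \<alpha>0 (hv [a,b,c,d,e,f,g,h]) t2"
proof -
  note E = even_group_E8 N_even_group(1)
  have main: "sim E8 N1 \<alpha>0 (hv [a,b,c,d,e,f,g,h]) t2"
    if odd: "odd a" "odd b" "odd c" "odd d" and even: "even e" "even f" "even g" "even h"
      and S: "4 dvd (a+b+c+d+e+f+g+h-6)" for a b c d e f g h
  proof (rule sim_base)
    obtain s where s: "a+b+c+d+e+f+g+h-6 = 4 * s" using S by (rule dvdE)
    obtain j where j: "a = 2 * j + 1" using odd(1) by (rule oddE)
    have e: "hv [a,b,c,d,e,f,g,h] - t2 = hv [a-1,b-1,c-1,d-1,e,f,g,h-2]" by (simp add: t2_def hv_diff)
    show "hv [a,b,c,d,e,f,g,h] - t2 \<in> N1" unfolding e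
    proof (rule N1_memI)
      show "hv [a-1,b-1,c-1,d-1,e,f,g,h-2] \<in> E8"
        by (rule hv_E8I[of _ _ _ _ _ _ _ _ s]) (use odd even s in simp_all)
      show "hv [a-1,b-1,c-1,d-1,e,f,g,h-2] \<bullet> t1 \<in> \<int>" unfolding t1_def hv_inner_Ints
        by (rule dvdI[of _ _ "s + j"]) (use s j in simp)
    qed
  qed
  show ?thesis
  proof (cases "4 dvd (a+b+c+d+e+f+g+h-6)")
    case True then show ?thesis by (rule main[OF odd even])
  next
    case False
    have "even (a+b+c+d+e+f+g+h-6)" using odd even by simp
    from dvd_4_shift[OF this False odd(3) even(4)]
    have "sim E8 N1 \<alpha>0 (hv [a,b,-c,d,e,f,g,-h]) t2"
      by (rule_tac main) (use odd even in \<open>simp_all add: algebra_simps\<close>)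
    moreover have "refln (qv [0,0,4,0,0,0,0,-4]) (hv [a,b,c,d,e,f,g,h]) = hv [a,b,h,d,e,f,g,c]"
      "refln (qv [0,0,4,0,0,0,0,4]) (hv [a,b,h,d,e,f,g,c]) = hv [a,b,-c,d,e,f,g,-h]"
      by (simp_all add: refln_def hv_qv qv_inner vec_eq_iff forall_8 field_simps)
    moreover have "qv [0,0,4,0,0,0,0,-4] \<in> N1" "qv [0,0,4,0,0,0,0,4] \<in> N1"
      by (auto intro!: N1_memI simp: qv_E8 qv_t_Ints)
    ultimately show ?thesis
      by - (rule sim_refl[OF E, of "qv [0,0,4,0,0,0,0,-4]"], simp_all add: qv_E8 qv_inner \<alpha>0_def hv_qv,
          rule sim_refl[OF E, of "qv [0,0,4,0,0,0,0,4]"], simp_all add: qv_E8 qv_inner hv_qv)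
  qed
qed

lemma sim_N1_unsorted:
  assumes odd: "odd a" "odd b" and cnt: "sum_list (map (\<lambda>x. x mod 2) [c,d,e,f,g,h]) = 2"
  shows "sim E8 N1 \<alpha>0 (hv [a,b,c,d,e,f,g,h]) t2"
proof -
  obtain os es where oe: "mset [c,d,e,f,g,h] = mset (os @ es)" "\<forall>x\<in>set os. odd x" "\<forall>x\<in>set es. even x"
    "int (length os) = sum_list (map (\<lambda>x. x mod 2) [c,d,e,f,g,h])" by (rule parity_split)
  have l: "length os = 2" using oe(4) unfolding cnt by simp
  then have "length es = 4" using mset_eq_length[OF oe(1)] by simp
  then obtain c' d' e' f' g' h' where os: "os = [c',d']" "es = [e',f',g',h']"
    using l by (auto simp: length_Suc_conv numeral_eq_Suc)
  have "sim E8 N1 \<alpha>0 (qv ([2*a,2*b] @ [2*c,2*d,2*e,2*f,2*g,2*h])) t2"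
  proof (rule sim_sort[OF even_group_E8 N_even_group(1)])
    show "mset [2*c,2*d,2*e,2*f,2*g,2*h] = mset (map ((*) 2) (os @ es))"
      unfolding mset_map oe(1)[symmetric] by simp
    show "sim E8 N1 \<alpha>0 (qv ([2*a,2*b] @ map ((*) 2) (os @ es))) t2"
      using sim_N1_sorted[of a b c' d' e' f' g' h'] odd oe(2,3) by (simp add: hv_def os)
  qed (use root_N1 in auto)
  then show ?thesis by (simp add: hv_def)
qed

text \<open>Pairing with \<open>\<alpha>0\<close> makes the first two parities equal. Constant
  patterns being excluded, the odd entries are the first two and two others, or the complement of
  such a set. Adding \<open>t1\<close> complements the pattern.\<close>

lemma sim_N1:
  assumes y: "2 *\<^sub>R y \<in> E8" "(2 *\<^sub>R y) \<bullet> t1 \<in> \<int>" "even_norm y" and no: "\<forall>k\<in>N1. y + k \<notin> E8"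
    and ya: "y \<bullet> \<alpha>0 \<in> \<int>"
  shows "sim E8 N1 \<alpha>0 y t2"
proof -
  obtain a b c d e f g h where yh: "y = hv [a,b,c,d,e,f,g,h]" and ev: "even (a+b+c+d+e+f+g+h)"
    using half_coords[OF y(1,2)] .
  note N = even_groupD(1)[OF N_even_group(1)]
  obtain os es where oe: "mset [c,d,e,f,g,h] = mset (os @ es)" "\<forall>x\<in>set os. odd x" "\<forall>x\<in>set es. even x"
    "int (length os) = sum_list (map (\<lambda>x. x mod 2) [c,d,e,f,g,h])" by (rule parity_split)
  have len: "length os + length es = 6" using mset_eq_length[OF oe(1)] by simp
  have set: "set [c,d,e,f,g,h] = set (os @ es)" using mset_eq_setD[OF oe(1)] .
  have cnt: "4 dvd (a mod 2 + (b mod 2 + int (length os)))" unfolding oe(4) using odd_count[OF y(3)[unfolded yh]]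
    by (simp only: list.map sum_list.Cons sum_list.Nil add_0_right add.assoc)
  have "4 dvd (2 * (a + b))" using ya unfolding yh \<alpha>0_def hv_inner_Ints by (simp add: algebra_simps)
  then have ab: "even (a + b)" by presburger
  have same: "even (b-a) \<Longrightarrow> even (c-a) \<Longrightarrow> even (d-a) \<Longrightarrow> even (e-a) \<Longrightarrow> even (f-a) \<Longrightarrow> even (g-a) \<Longrightarrow> even (h-a) \<Longrightarrow> False"
    using not_same_parity[OF N t_mem(1) no N_0(1), of a b c d e f g h] yh ev by simp
  show ?thesis
  proof (cases "even a")
    case False
    then have od: "odd a" "odd b" using ab by simp_all
    then have "4 dvd (2 + int (length os))" using cnt by (simp add: odd_iff_mod_2_eq_one)
    then have "length os = 2 \<or> length os = 6" using len by presburger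
    then show ?thesis
    proof
      assume "length os = 2"
      then show ?thesis unfolding yh by (intro sim_N1_unsorted od) (use oe(4) in simp)
    next
      assume "length os = 6"
      then have "odd c" "odd d" "odd e" "odd f" "odd g" "odd h" using oe(2) set len by auto
      with od same show ?thesis by simp
    qed
  next
    case True
    then have ev: "even a" "even b" using ab by simp_all
    then have "4 dvd int (length os)" using cnt by (simp add: even_iff_mod_2_eq_zero)
    then have "length os = 4 \<or> length os = 0" using len by presburger
    then show ?thesis
    proof
      assume l: "length os = 4"
      have "sum_list (map (\<lambda>x. x mod 2) [c+1,d+1,e+1,f+1,g+1,h+1]) = 6 - sum_list (map (\<lambda>x. x mod 2) [c,d,e,f,g,h])"
        by (simp only: list.map sum_list.Cons sum_list.Nil mod_2_succ)
      also have "\<dots> = 2" using oe(4) l by simp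
      finally have sh: "sim E8 N1 \<alpha>0 (hv [a+3,b+1,c+1,d+1,e+1,f+1,g+1,h+1]) t2"
        by (rule sim_N1_unsorted[rotated 2]) (use ev in simp_all)
      have "y - hv [a+3,b+1,c+1,d+1,e+1,f+1,g+1,h+1] = - t1"
        unfolding yh t1_def hv_diff by (simp add: hv_qv qv_minus)
      then show ?thesis using sim_shift[OF N _ sh, of y] subgrp_minus[OF N t_mem(1)] by simp
    next
      assume "length os = 0"
      then have "even c" "even d" "even e" "even f" "even g" "even h" using oe(3) set by auto
      with ev same show ?thesis by simp
    qed
  qed
qed

section \<open>Normalising the third generator\<close>

lemma sim_N2_sorted:
  assumes even: "even a" "even b" and odd: "odd c" "odd d" "odd e" "odd f" and even': "even g" "even h"
    and S: "4 dvd (a+b+c+d)"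
  shows "sim E8 N2 \<alpha>0 (hv [a,b,c,d,e,f,g,h]) t3"
proof -
  note E = even_group_E8 N_even_group(2)
  have main: "sim E8 N2 \<alpha>0 (hv [a,b,c,d,e,f,g,h]) t3"
    if odd': "odd e" "odd f" and even': "even g" "even h" and S': "4 dvd (e+f+g+h)" for e f g h
  proof (rule sim_base)
    obtain s where s: "a+b+c+d = 4 * s" using S by (rule dvdE)
    obtain s' where s': "e+f+g+h = 4 * s'" using S' by (rule dvdE)
    obtain j where j: "a = 2 * j" using even(1) by (rule evenE)
    obtain i where i: "h = 2 * i" using even'(2) by (rule evenE)
    have e: "hv [a,b,c,d,e,f,g,h] - t3 = hv [a-2,b,c+1,d+1,e-1,f+1,g,h]" by (simp add: t3_def hv_diff)
    show "hv [a,b,c,d,e,f,g,h] - t3 \<in> N2" unfolding e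
    proof (rule N2_memI)
      show "hv [a-2,b,c+1,d+1,e-1,f+1,g,h] \<in> E8"
        by (rule hv_E8I[of _ _ _ _ _ _ _ _ "s + s'"]) (use odd odd' even even' s s' in simp_all)
      show "hv [a-2,b,c+1,d+1,e-1,f+1,g,h] \<bullet> t1 \<in> \<int>" unfolding t1_def hv_inner_Ints
        by (rule dvdI[of _ _ "s + s' + j - 1"]) (use s s' j in simp)
      show "hv [a-2,b,c+1,d+1,e-1,f+1,g,h] \<bullet> t2 \<in> \<int>" unfolding t2_def hv_inner_Ints
        by (rule dvdI[of _ _ "s + i"]) (use s i in simp)
    qed
  qed
  show ?thesis
  proof (cases "4 dvd (e+f+g+h)")
    case True then show ?thesis by (rule main[OF odd(3,4) even'])
  next
    case False
    \<comment> \<open>Negating coordinates 5 and 8 corrects the sum over the second half and leaves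
      the first half, hence \<open>\<alpha>0\<close>, alone.\<close>
    have "even (e+f+g+h)" using odd even' by simp
    from dvd_4_shift[OF this False odd(3) even'(2)]
    have "sim E8 N2 \<alpha>0 (hv [a,b,c,d,-e,f,g,-h]) t3"
      by (rule_tac main) (use odd even' in \<open>simp_all add: algebra_simps\<close>)
    moreover have "refln (qv [0,0,0,0,4,0,0,-4]) (hv [a,b,c,d,e,f,g,h]) = hv [a,b,c,d,h,f,g,e]"
      "refln (qv [0,0,0,0,4,0,0,4]) (hv [a,b,c,d,h,f,g,e]) = hv [a,b,c,d,-e,f,g,-h]"
      by (simp_all add: refln_def hv_qv qv_inner vec_eq_iff forall_8 field_simps)
    moreover have "qv [0,0,0,0,4,0,0,-4] \<in> N2" "qv [0,0,0,0,4,0,0,4] \<in> N2"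
      by (auto intro!: N2_memI simp: qv_E8 qv_t_Ints t2_def hv_qv qv_inner)
    ultimately show ?thesis
      by - (rule sim_refl[OF E, of "qv [0,0,0,0,4,0,0,-4]"], simp_all add: qv_E8 qv_inner \<alpha>0_def hv_qv,
          rule sim_refl[OF E, of "qv [0,0,0,0,4,0,0,4]"], simp_all add: qv_E8 qv_inner hv_qv)
  qed
qed

text \<open>In the first half, negating the two odd entries keeps the sum modulo 4, and negating the
  first two entries would move \<open>\<alpha>0\<close>. A wrong sum is therefore corrected by
  adding t1 - t2 = hv [2,0,0,0,1,1,1,-1], which complements the last four parities and so keeps two
  of them odd.\<close>

lemma sim_N2_unsorted:
  assumes even: "even a" "even b" and odd: "odd c" "odd d"
    and cnt: "sum_list (map (\<lambda>x. x mod 2) [e,f,g,h]) = 2"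
  shows "sim E8 N2 \<alpha>0 (hv [a,b,c,d,e,f,g,h]) t3"
proof -
  note N = even_groupD(1)[OF N_even_group(2)]
  have main: "sim E8 N2 \<alpha>0 (hv [a,b,c,d,e,f,g,h]) t3"
    if even: "even a" "even b" and odd: "odd c" "odd d" and S: "4 dvd (a+b+c+d)"
      and cnt: "sum_list (map (\<lambda>x. x mod 2) [e,f,g,h]) = 2" for a b c d e f g h
  proof -
    obtain os es where oe: "mset [e,f,g,h] = mset (os @ es)" "\<forall>x\<in>set os. odd x" "\<forall>x\<in>set es. even x"
      "int (length os) = sum_list (map (\<lambda>x. x mod 2) [e,f,g,h])" by (rule parity_split)
    have l: "length os = 2" using oe(4) unfolding cnt by simp
    then have "length es = 2" using mset_eq_length[OF oe(1)] by simp
    then obtain e' f' g' h' where os: "os = [e',f']" "es = [g',h']"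
      using l by (auto simp: length_Suc_conv numeral_eq_Suc)
    have "sim E8 N2 \<alpha>0 (qv ([2*a,2*b,2*c,2*d] @ [2*e,2*f,2*g,2*h])) t3"
    proof (rule sim_sort[OF even_group_E8 N_even_group(2)])
      show "mset [2*e,2*f,2*g,2*h] = mset (map ((*) 2) (os @ es))"
        unfolding mset_map oe(1)[symmetric] by simp
      show "sim E8 N2 \<alpha>0 (qv ([2*a,2*b,2*c,2*d] @ map ((*) 2) (os @ es))) t3"
        using sim_N2_sorted[of a b c d e' f' g' h'] even odd S oe(2,3) by (simp add: hv_def os)
    qed (use root_N2 in auto)
    then show ?thesis by (simp add: hv_def)
  qed
  show ?thesis
  proof (cases "4 dvd (a+b+c+d)")
    case True then show ?thesis by (rule main[OF even odd _ cnt])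
  next
    case False
    have "even (a+b+c+d)" using even odd by simp
    then obtain k where k: "a+b+c+d = 2 * k" by (rule evenE)
    with False have "odd k" by auto
    then obtain q where q: "k = 2 * q + 1" by (rule oddE)
    have m1: "(x - 1) mod 2 = 1 - x mod 2" for x :: int by presburger
    have "sum_list (map (\<lambda>x. x mod 2) [e+1,f+1,g+1,h-1]) = 4 - sum_list (map (\<lambda>x. x mod 2) [e,f,g,h])"
      by (simp only: list.map sum_list.Cons sum_list.Nil mod_2_succ m1)
    then have c': "sum_list (map (\<lambda>x. x mod 2) [e+1,f+1,g+1,h-1]) = 2" unfolding cnt by simp
    have S': "4 dvd (a+2+b+c+d)" by (rule dvdI[of _ _ "q + 1"]) (use k q in simp)
    have sh: "sim E8 N2 \<alpha>0 (hv [a+2,b,c,d,e+1,f+1,g+1,h-1]) t3"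
      by (rule main[OF _ even(2) odd S' c']) (use even in simp)
    have "hv [a,b,c,d,e,f,g,h] - hv [a+2,b,c,d,e+1,f+1,g+1,h-1] = t2 - t1"
      by (simp add: t1_def t2_def hv_diff)
    then show ?thesis using sim_shift[OF N _ sh, of "hv [a,b,c,d,e,f,g,h]"] subgrp_diff[OF N t_mem(3,2)] by simp
  qed
qed

lemma even_of_4_dvd: "4 dvd 2 * n \<Longrightarrow> even n" for n :: int
  using dvd_times_left_cancel_iff[of 2 2 n] by simp

text \<open>Integrality with \<open>\<alpha>0\<close> and \<open>t2\<close> makes the parities
  constant on {1,2} and on {3,4}. If the two agree, the pattern is constant on both halves, which
  independence from \<open>t1\<close> and \<open>t2\<close> forbids. If they differ, two of the last
  four entries are odd, and adding \<open>t2\<close> if necessary puts the odd pair at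
  {3,4}.\<close>

lemma sim_N2:
  assumes y: "2 *\<^sub>R y \<in> E8" "(2 *\<^sub>R y) \<bullet> t1 \<in> \<int>" "(2 *\<^sub>R y) \<bullet> t2 \<in> \<int>" "even_norm y"
    and no: "\<forall>k\<in>N2. y + k \<notin> E8" and ya: "y \<bullet> \<alpha>0 \<in> \<int>"
  shows "sim E8 N2 \<alpha>0 y t3"
proof -
  obtain a b c d e f g h where yh: "y = hv [a,b,c,d,e,f,g,h]" and ev: "even (a+b+c+d+e+f+g+h)"
    using half_coords[OF y(1,2)] .
  note N = even_groupD(1)[OF N_even_group(2)]
  obtain os es where oe: "mset [e,f,g,h] = mset (os @ es)" "\<forall>x\<in>set os. odd x" "\<forall>x\<in>set es. even x"
    "int (length os) = sum_list (map (\<lambda>x. x mod 2) [e,f,g,h])" by (rule parity_split)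
  have len: "length os + length es = 4" using mset_eq_length[OF oe(1)] by simp
  have set: "set [e,f,g,h] = set (os @ es)" using mset_eq_setD[OF oe(1)] .
  have cnt: "4 dvd (a mod 2 + (b mod 2 + (c mod 2 + (d mod 2 + int (length os)))))"
    unfolding oe(4) using odd_count[OF y(4)[unfolded yh]]
    by (simp only: list.map sum_list.Cons sum_list.Nil add_0_right add.assoc)
  have "4 dvd (2 * (a + b))" using ya unfolding yh \<alpha>0_def hv_inner_Ints by (simp add: algebra_simps)
  then have ab: "even (a + b)" by (rule even_of_4_dvd)
  have "4 dvd (2 * (a + b + c + d + 2 * h))"
    using y(3) unfolding yh hv_double t2_def hv_inner_Ints by (simp add: algebra_simps)
  then have "even (a + b + c + d + 2 * h)" by (rule even_of_4_dvd)
  then have cd: "even (c + d)" using ab by simp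
  have same0: "even (b-a) \<Longrightarrow> even (c-a) \<Longrightarrow> even (d-a) \<Longrightarrow> even (e-a) \<Longrightarrow> even (f-a) \<Longrightarrow> even (g-a) \<Longrightarrow> even (h-a) \<Longrightarrow> False"
    using not_same_parity[OF N t_mem(2) no N_0(2), of a b c d e f g h] yh ev by simp
  have same1: False if "even (b-a)" "even (c-a)" "even (d-a)" "odd (e-a)" "odd (f-a)" "odd (g-a)" "odd (h-a)"
  proof (rule not_same_parity[OF N t_mem(2) no t_mem(3), of "a+1" "b+1" "c+1" "d+1" e f g "h+2"])
    show "y + t2 = hv [a+1,b+1,c+1,d+1,e,f,g,h+2]" by (simp add: yh t2_def hv_add)
  qed (use that ev in simp_all)
  have os0: "even e \<and> even f \<and> even g \<and> even h" if "length os = 0" using oe(3) set that by auto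
  have os4: "odd e \<and> odd f \<and> odd g \<and> odd h" if "length os = 4" using oe(2) set that len by auto
  show ?thesis
  proof (cases "even a \<longleftrightarrow> even c")
    case True
    have "4 dvd int (length os)"
    proof (cases "even a")
      case True': True
      then have "even a" "even b" "even c" "even d" using True ab cd by simp_all
      then show ?thesis using cnt by (simp add: even_iff_mod_2_eq_zero)
    next
      case False
      then have "odd a" "odd b" "odd c" "odd d" using True ab cd by simp_all
      then have "4 dvd (4 + int (length os))" using cnt by (simp add: odd_iff_mod_2_eq_one)
      then show ?thesis by presburger
    qed
    then have "length os = 0 \<or> length os = 4" using len by presburger
    moreover have "even (b - a)" "even (c - a)" "even (d - a)" using True ab cd by simp_all
    ultimately show ?thesis using os0 os4 same0 same1 by (cases "even a") auto
  next
    case False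
    have m0: "x mod 2 = 0" if "even x" for x :: int using that by presburger
    have m1: "x mod 2 = 1" if "odd x" for x :: int using that by presburger
    have "4 dvd (2 + int (length os))"
    proof (cases "even a")
      case True
      then have P: "even a" "even b" "odd c" "odd d" using False ab cd by simp_all
      show ?thesis using cnt unfolding m0[OF P(1)] m0[OF P(2)] m1[OF P(3)] m1[OF P(4)] by simp
    next
      case F: False
      then have P: "odd a" "odd b" "even c" "even d" using False ab cd by simp_all
      show ?thesis using cnt unfolding m1[OF P(1)] m1[OF P(2)] m0[OF P(3)] m0[OF P(4)] by simp
    qed
    then have "length os = 2" using len by presburger
    then have c2: "sum_list (map (\<lambda>x. x mod 2) [e,f,g,h]) = 2" using oe(4) by simp
    show ?thesis
    proof (cases "even a")
      case True
      then show ?thesis unfolding yh by (intro sim_N2_unsorted c2) (use False ab cd in simp_all)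
    next
      case F: False
      have h2: "(h + 2) mod 2 = h mod 2" by simp
      have c2': "sum_list (map (\<lambda>x. x mod 2) [e,f,g,h+2]) = 2" using c2 unfolding list.map h2 .
      have sh: "sim E8 N2 \<alpha>0 (hv [a+1,b+1,c+1,d+1,e,f,g,h+2]) t3"
        by (rule sim_N2_unsorted[OF _ _ _ _ c2']) (use F False ab cd in simp_all)
      have "y - hv [a+1,b+1,c+1,d+1,e,f,g,h+2] = - t2" by (simp add: yh t2_def hv_diff) (simp add: hv_qv qv_minus)
      then show ?thesis using sim_shift[OF N _ sh, of y] subgrp_minus[OF N t_mem(3)] by simp
    qed
  qed
qed

section \<open>Normalising the fourth generator\<close>

lemma sim_pair:
  assumes L: "even_group L" "even_group N" and l: "length us + length vs = 6"
    and r: "root (length us) \<in> L \<inter> N \<and> root' (length us) \<in> L \<inter> N"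
    and xy: "odd (x + y)" and c: "odd c"
    and s: "\<And>x y. odd x \<Longrightarrow> even y \<Longrightarrow> 4 dvd (x + y - c) \<Longrightarrow> sim L N 0 (hv (us @ x # y # vs)) t"
  shows "sim L N 0 (hv (us @ x # y # vs)) t"
proof -
  have l': "length (map ((*) 2) us) + length (map ((*) 2) vs) = 6" using l by simp
  have k: "length us \<le> 6" using l by simp
  have fl: "sim L N 0 (hv (us @ x # y # vs)) t" if "odd x" "even y" for x y
  proof (cases "4 dvd (x + y - c)")
    case True then show ?thesis using s that by blast
  next
    case False
    \<comment> \<open>An odd sum is \<open>c\<close> or \<open>- c\<close> modulo 4, and negating
      the pair exchanges the two cases.\<close>
    then have "4 dvd (- x + - y - c)" using that c by presburger
    then have "sim L N 0 (hv (us @ - x # - y # vs)) t" using s[of "- x" "- y"] that by simp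
    then show ?thesis
      using sim_flip[OF L l', of 0 "2 * x" "2 * y" t] r by (simp add: hv_def)
  qed
  show ?thesis
  proof (cases "odd x")
    case True then show ?thesis using fl xy by simp
  next
    case False
    then have sw: "sim L N 0 (hv (us @ y # x # vs)) t" using fl xy by simp
    have "refln (root (length us)) (hv (us @ x # y # vs)) = hv (us @ y # x # vs)"
      using refln_root[OF l', of "2 * x" "2 * y"] by (simp add: hv_def)
    with sw show ?thesis
      by - (rule sim_refl[OF L, of "root (length us)"], use r root_norm[OF k] in auto)
  qed
qed

text \<open>The residues 3, 1, -1, -1 are the sums of the entries of \<open>t4\<close> over the four
  coordinate pairs.\<close>

lemma sim_N3_sorted:
  assumes odd: "odd a" "odd c" "odd e" "odd g" and even: "even b" "even d" "even f" "even h"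
    and S: "4 dvd (a + b - 3)" "4 dvd (c + d - 1)" "4 dvd (e + f + 1)" "4 dvd (g + h + 1)"
  shows "sim E8 N3 0 (hv [a,b,c,d,e,f,g,h]) t4"
proof (rule sim_base)
  obtain p where p: "a + b - 3 = 4 * p" using S(1) by (rule dvdE)
  obtain q where q: "c + d - 1 = 4 * q" using S(2) by (rule dvdE)
  obtain r where r: "e + f + 1 = 4 * r" using S(3) by (rule dvdE)
  obtain s where s: "g + h + 1 = 4 * s" using S(4) by (rule dvdE)
  obtain i where i: "a = 2 * i + 1" using odd(1) by (rule oddE)
  obtain j where j: "h = 2 * j" using even(4) by (rule evenE)
  obtain k where k: "f = 2 * k" using even(3) by (rule evenE)
  have b: "b = 4 * p + 3 - a" and d: "d = 4 * q + 1 - c" and e: "e = 4 * r - 1 - f" and g: "g = 4 * s - 1 - h"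
    using p q r s by simp_all
  have eq: "hv [a,b,c,d,e,f,g,h] - t4 = hv [a-1,b-2,c-1,d,e+1,f,g+1,h]" by (simp add: t4_def hv_diff)
  show "hv [a,b,c,d,e,f,g,h] - t4 \<in> N3" unfolding eq
  proof (rule N3_memI)
    show "hv [a-1,b-2,c-1,d,e+1,f,g+1,h] \<in> E8"
      by (rule hv_E8I[of _ _ _ _ _ _ _ _ "p + q + r + s"]) (use odd even b d e g in simp_all)
    show "hv [a-1,b-2,c-1,d,e+1,f,g+1,h] \<bullet> t1 \<in> \<int>" unfolding t1_def hv_inner_Ints
      by (rule dvdI[of _ _ "p + q + r + s + i"]) (simp add: b d e g i)
    show "hv [a-1,b-2,c-1,d,e+1,f,g+1,h] \<bullet> t2 \<in> \<int>" unfolding t2_def hv_inner_Ints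
      by (rule dvdI[of _ _ "p + q + j"]) (simp add: b d i j)
    show "hv [a-1,b-2,c-1,d,e+1,f,g+1,h] \<bullet> t3 \<in> \<int>" unfolding t3_def hv_inner_Ints
      by (rule dvdI[of _ _ "i - q + r - k"]) (simp add: d e i k)
  qed
qed

text \<open>Integrality with \<open>t2\<close> and \<open>t3\<close>, and the even total, give the
  four pair sums the same parity. If they are even, the parities are constant on pairs and, by the
  count of odd entries, form a combination of those of \<open>t1\<close>, \<open>t2\<close>,
  \<open>t3\<close>, which independence forbids. If they are odd, each pair is normalised
  separately.\<close>

lemma sim_N3:
  assumes y: "2 *\<^sub>R y \<in> E8" "(2 *\<^sub>R y) \<bullet> t1 \<in> \<int>" "(2 *\<^sub>R y) \<bullet> t2 \<in> \<int>" "(2 *\<^sub>R y) \<bullet> t3 \<in> \<int>" "even_norm y"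
    and no: "\<forall>k\<in>N3. y + k \<notin> E8"
  shows "sim E8 N3 0 y t4"
proof -
  obtain a b c d e f g h where yh: "y = hv [a,b,c,d,e,f,g,h]" and ev: "even (a+b+c+d+e+f+g+h)"
    using half_coords[OF y(1,2)] .
  note N = even_groupD(1)[OF N_even_group(3)]
  have "4 dvd (2 * (a + b + c + d + 2 * h))"
    using y(3) unfolding yh hv_double t2_def hv_inner_Ints by (simp add: algebra_simps)
  then have "even (a + b + c + d + 2 * h)" by (rule even_of_4_dvd)
  then have abcd: "even ((a + b) + (c + d))" by (simp, blast)
  have "4 dvd (2 * (2 * a - c - d + e - f))"
    using y(4) unfolding yh hv_double t3_def hv_inner_Ints by (simp add: algebra_simps)
  then have "even (2 * a - c - d + e - f)" by (rule even_of_4_dvd)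
  then have cdef: "even ((c + d) + (e + f))" by (simp, blast)
  have efgh: "even ((e + f) + (g + h))" using ev abcd by (simp, blast)
  show ?thesis
  proof (cases "even (a + b)")
    case False
    then have o: "odd (a + b)" "odd (c + d)" "odd (e + f)" "odd (g + h)" using abcd cdef efgh by simp_all
    note E = even_group_E8 N_even_group(3)
    \<comment> \<open>The statements \<open>1\<close>, \<open>2\<close>, \<open>3\<close> treat one
      pair each, from the last to the second, assuming that the pairs before it are already in
      normal form.\<close>
    have 1: "sim E8 N3 0 (hv [a,b,c,d,e,f,g,h]) t4"
      if A: "odd a" "even b" "4 dvd (a + b - 3)" "odd c" "even d" "4 dvd (c + d - 1)"
        "odd e" "even f" "4 dvd (e + f + 1)" for a b c d e f
    proof -
      have l: "length [a,b,c,d,e,f] = 6" by simp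
      have "sim E8 N3 0 (hv ([a,b,c,d,e,f] @ g # h # [])) t4"
      proof (rule sim_pair[OF E _ _ o(4), of _ _ "-1"])
        fix x y :: int assume xy: "odd x" "even y" "4 dvd (x + y - -1)"
        show "sim E8 N3 0 (hv ([a,b,c,d,e,f] @ x # y # [])) t4"
          using sim_N3_sorted[OF A(1,4,7) xy(1) A(2,5,8) xy(2) A(3,6,9)] xy(3) by simp
      qed (unfold l, use root_N3[of 6] in simp_all)
      then show ?thesis by simp
    qed
    have 2: "sim E8 N3 0 (hv [a,b,c,d,e,f,g,h]) t4"
      if A: "odd a" "even b" "4 dvd (a + b - 3)" "odd c" "even d" "4 dvd (c + d - 1)" for a b c d
    proof -
      have l: "length [a,b,c,d] = 4" by simp
      have "sim E8 N3 0 (hv ([a,b,c,d] @ e # f # [g,h])) t4"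
      proof (rule sim_pair[OF E _ _ o(3), of _ _ "-1"])
        fix x y :: int assume xy: "odd x" "even y" "4 dvd (x + y - -1)"
        show "sim E8 N3 0 (hv ([a,b,c,d] @ x # y # [g,h])) t4"
          using 1[OF A xy(1,2)] xy(3) by simp
      qed (unfold l, use root_N3[of 4] in simp_all)
      then show ?thesis by simp
    qed
    have 3: "sim E8 N3 0 (hv [a,b,c,d,e,f,g,h]) t4"
      if A: "odd a" "even b" "4 dvd (a + b - 3)" for a b
    proof -
      have l: "length [a,b] = 2" by simp
      have "sim E8 N3 0 (hv ([a,b] @ c # d # [e,f,g,h])) t4"
      proof (rule sim_pair[OF E _ _ o(2), of _ _ 1])
        fix x y :: int assume xy: "odd x" "even y" "4 dvd (x + y - 1)"
        show "sim E8 N3 0 (hv ([a,b] @ x # y # [e,f,g,h])) t4"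
          using 2[OF A xy] by simp
      qed (unfold l, use root_N3[of 2] in simp_all)
      then show ?thesis by simp
    qed
    have "sim E8 N3 0 (hv ([] @ a # b # [c,d,e,f,g,h])) t4"
    proof (rule sim_pair[OF E _ _ o(1), of _ _ 3])
      fix x y :: int assume xy: "odd x" "even y" "4 dvd (x + y - 3)"
      show "sim E8 N3 0 (hv ([] @ x # y # [c,d,e,f,g,h])) t4"
        using 3[OF xy] by simp
    qed (use root_N3[of 0] in simp_all)
    then show ?thesis by (simp add: yh)
  next
    case True
    then have p: "even (a + b)" "even (c + d)" "even (e + f)" "even (g + h)" using abcd cdef efgh by simp_all
    have ps: "P + Q + R + S + T + U + W + X = 2 * (P + R + T + W)" if "Q = P" "S = R" "U = T" "X = W"
      for P Q R S T U W X :: int using that by simp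
    have pm: "y mod 2 = x mod 2" if "even (x + y)" for x y :: int using that by presburger
    have "4 dvd 2 * (a mod 2 + c mod 2 + e mod 2 + g mod 2)"
      using odd_count[OF y(5)[unfolded yh]]
      unfolding ps[OF pm[OF p(1)] pm[OF p(2)] pm[OF p(3)] pm[OF p(4)]] .
    then have "even (a mod 2 + c mod 2 + e mod 2 + g mod 2)" by (rule even_of_4_dvd)
    then have q: "even (a + c + e + g)" by (simp only: even_add even_mod_2_iff)
    have N': "t2 + t3 \<in> N3" using N t_mem(5,6) by (rule subgrp_add)
    have pb: "even b = even a" "even d = even c" "even f = even e" "even h = even g"
      using p by (simp_all only: even_add)
    have qg: "even g = ((even a = even c) = even e)" using q by (simp only: even_add)
    have False
    proof (cases "even c = even a"; cases "even e = even a")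
      assume A: "even c = even a" "even e = even a"
      show False
        by (rule not_same_parity[OF N t_mem(4) no N_0(3), of a b c d e f g h]) (simp_all add: yh pb qg A)
    next
      assume "even c = even a" "even e \<noteq> even a"
      then have A: "even c = even a" "even e = odd a" by blast+
      show False
      proof (rule not_same_parity[OF N t_mem(4) no t_mem(5), of "a+1" "b+1" "c+1" "d+1" e f g "h+2"])
        show "y + t2 = hv [a+1,b+1,c+1,d+1,e,f,g,h+2]" by (simp add: yh t2_def hv_add)
      qed (simp_all add: pb qg A)
    next
      assume "even c \<noteq> even a" "even e = even a"
      then have A: "even c = odd a" "even e = even a" by blast+
      show False
      proof (rule not_same_parity[OF N t_mem(4) no N', of "a+3" "b+1" c d "e+1" "f-1" g "h+2"])
        show "y + (t2 + t3) = hv [a+3,b+1,c,d,e+1,f-1,g,h+2]" by (simp add: yh t2_def t3_def hv_add)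
      qed (simp_all add: pb qg A)
    next
      assume "even c \<noteq> even a" "even e \<noteq> even a"
      then have A: "even c = odd a" "even e = odd a" by blast+
      show False
      proof (rule not_same_parity[OF N t_mem(4) no t_mem(6), of "a+2" b "c-1" "d-1" "e+1" "f-1" g h])
        show "y + t3 = hv [a+2,b,c-1,d-1,e+1,f-1,g,h]" by (simp add: yh t3_def hv_add)
      qed (simp_all add: pb qg A)
    qed
    then show ?thesis ..
  qed
qed

lemma comp_image: "f ` A = B \<Longrightarrow> g ` B = C \<Longrightarrow> (g \<circ> f) ` A = C"
  unfolding image_comp[symmetric] by simp

section \<open>Normalising the generator of a cyclic neighbour\<close>

lemma Z4_coords:
  assumes y: "2 *\<^sub>R y - t1 \<in> E8" "even_norm y"
  obtains a b c d e f g h k where "y = qv [a,b,c,d,e,f,g,h]" "odd a" "odd b" "odd c" "odd d" "odd e" "odd f" "odd g" "odd h"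
    "a+b+c+d+e+f+g+h = 2 + 4 * k"
proof -
  obtain m a b c d e f g h k where
    l: "2 *\<^sub>R y - t1 = qv [2*m+4*a, 2*m+4*b, 2*m+4*c, 2*m+4*d, 2*m+4*e, 2*m+4*f, 2*m+4*g, 2*m+4*h]"
    and k: "a + b + c + d + e + f + g + h = 2 * k" using E8_paramE[OF y(1)] .
  have "y = (1/2) *\<^sub>R (t1 + (2 *\<^sub>R y - t1))" by simp
  also have "\<dots> = qv [m+3+2*a, m+1+2*b, m+1+2*c, m+1+2*d, m+1+2*e, m+1+2*f, m+1+2*g, m+1+2*h]"
    unfolding l unfolding t1_def hv_qv qv_add by (simp add: vec_eq_iff forall_8 field_simps)
  finally have yq: "y = qv [m+3+2*a, m+1+2*b, m+1+2*c, m+1+2*d, m+1+2*e, m+1+2*f, m+1+2*g, m+1+2*h]" .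
  \<comment> \<open>For odd \<open>m\<close> the coordinates would be half-integral with an odd
    number of odd entries, against the even norm.\<close>
  have "even m"
  proof (rule ccontr)
    assume "odd m"
    then obtain n where n: "m = 2 * n + 1" by (rule oddE)
    have yh: "y = hv [n+2+a, n+1+b, n+1+c, n+1+d, n+1+e, n+1+f, n+1+g, n+1+h]"
      unfolding yq n hv_qv by (simp add: algebra_simps)
    have "even ((n+2+a)*(n+2+a) + (n+1+b)*(n+1+b) + (n+1+c)*(n+1+c) + (n+1+d)*(n+1+d) + (n+1+e)*(n+1+e)
       + (n+1+f)*(n+1+f) + (n+1+g)*(n+1+g) + (n+1+h)*(n+1+h))"
      using y(2) unfolding yh hv_even_norm by (rule dvd_trans[rotated]) simp
    then have "even ((n+2+a) + (n+1+b) + (n+1+c) + (n+1+d) + (n+1+e) + (n+1+f) + (n+1+g) + (n+1+h))"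
      by (simp only: even_add even_mult_iff simp_thms)
    moreover have "(n+2+a) + (n+1+b) + (n+1+c) + (n+1+d) + (n+1+e) + (n+1+f) + (n+1+g) + (n+1+h) = 2 * (4 * n + 4 + k) + 1"
      using k by simp
    ultimately show False by (simp only: even_add even_mult_iff) simp
  qed
  then obtain n where n: "m = 2 * n" by (rule evenE)
  show ?thesis by (rule that[OF yq, of "4 * n + 2 + k"]) (use n k in simp_all)
qed

lemma root_E8_\<alpha>0: "2 \<le> k \<Longrightarrow> k \<le> 6 \<Longrightarrow> root k \<bullet> \<alpha>0 = 0 \<and> root' k \<bullet> \<alpha>0 = 0"
  by (drule le_6_cases, elim disjE) (auto simp: root_simps root'_simps hv_qv qv_inner \<alpha>0_def)

text \<open>Sign changes and the sum fix the residues of all entries modulo 4. What is left is the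
  parity of the sum of the \<open>z\<close>s, whose two values are the classes of \<open>tz\<close>
  and \<open>- tz\<close> modulo E8.\<close>

lemma sim_Z4_signed:
  assumes a: "a mod 4 = 1" and ab: "4 dvd (a + b)"
    and odd: "odd c" "odd d" "odd e" "odd f" "odd g" "odd h" and s: "a+b+c+d+e+f+g+h = 2 + 4 * k"
  shows "sim E8 E8 \<alpha>0 (qv [a,b,c,d,e,f,g,h]) tz \<or> sim E8 E8 \<alpha>0 (qv [a,b,c,d,e,f,g,h]) (- tz)"
proof -
  note E = even_group_E8 even_group_E8
  obtain ws w where ws: "length ws + 1 = length [c,d,e,f,g,h]" "\<forall>x\<in>set ws. x mod 4 = 1"
    "4 dvd (sum_list [c,d,e,f,g,h] - sum_list ws - w)"
    "\<forall>t. sim E8 E8 \<alpha>0 (qv ([a,b] @ ws @ [w])) t \<longrightarrow> sim E8 E8 \<alpha>0 (qv ([a,b] @ [c,d,e,f,g,h])) t"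
    using sim_signs[OF E, of "[c,d,e,f,g,h]" "[a,b]" \<alpha>0] odd root_E8_\<alpha>0 by (auto simp: root_E8 root'_E8)
  have z: "\<exists>z. x = 1 + 4 * z" if "x mod 4 = 1" for x :: int
    by (rule exI[of _ "x div 4"]) (use that in presburger)
  obtain z1 where z1: "a = 1 + 4 * z1" using z[OF a] by blast
  obtain p where p: "a + b = 4 * p" using ab by (rule dvdE)
  have b: "b = -1 + 4 * (p - z1)" using p z1 by simp
  have "length ws = 5" using ws(1) by simp
  then obtain x3 x4 x5 x6 x7 where wl: "ws = [x3,x4,x5,x6,x7]"
    by (auto simp: length_Suc_conv numeral_eq_Suc)
  obtain z3 z4 z5 z6 z7 where zs: "x3 = 1 + 4 * z3" "x4 = 1 + 4 * z4"
    "x5 = 1 + 4 * z5" "x6 = 1 + 4 * z6" "x7 = 1 + 4 * z7" using ws(2) z by (simp add: wl) metis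
  obtain q where "sum_list [c,d,e,f,g,h] - sum_list ws - w = 4 * q" using ws(3) by (rule dvdE)
  then have "w = 1 + 4 * (k - p - 1 - z3 - z4 - z5 - z6 - z7 - q)"
    using s p by (simp add: wl zs)
  then obtain z8 where z8: "w = 1 + 4 * z8" by blast
  obtain z2 where z2: "b = -1 + 4 * z2" using b by blast
  have wsim: "sim E8 E8 \<alpha>0 (qv [a,b,c,d,e,f,g,h]) t"
    if "sim E8 E8 \<alpha>0 (qv [1 + 4*z1, -1 + 4*z2, 1 + 4*z3, 1 + 4*z4, 1 + 4*z5, 1 + 4*z6, 1 + 4*z7, 1 + 4*z8]) t" for t
    using ws(4)[rule_format, of t] that by (simp add: wl zs z8 z1 z2)
  show ?thesis
  proof (cases "even (z1+z2+z3+z4+z5+z6+z7+z8)")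
    case True
    then obtain r where "z1+z2+z3+z4+z5+z6+z7+z8 = 2 * r" by (rule evenE)
    then have "qv [1 + 4*z1, -1 + 4*z2, 1 + 4*z3, 1 + 4*z4, 1 + 4*z5, 1 + 4*z6, 1 + 4*z7, 1 + 4*z8] - tz \<in> E8"
      unfolding tz_def qv_diff by (rule_tac qv_E8I[of _ _ _ _ _ _ _ _ "r - 2"]) (presburger | simp)+
    then show ?thesis using wsim sim_base by blast
  next
    case False
    then obtain r where "z1+z2+z3+z4+z5+z6+z7+z8 = 2 * r + 1" by (rule oddE)
    then have "qv [1 + 4*z1, -1 + 4*z2, 1 + 4*z3, 1 + 4*z4, 1 + 4*z5, 1 + 4*z6, 1 + 4*z7, 1 + 4*z8] - (- tz) \<in> E8"
      unfolding tz_def qv_minus qv_diff by (rule_tac qv_E8I[of _ _ _ _ _ _ _ _ "r + 4"]) (presburger | simp)+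
    then show ?thesis using wsim sim_base by blast
  qed
qed

lemma sim_Z4:
  assumes y: "2 *\<^sub>R y - t1 \<in> E8" "even_norm y" and ya: "y \<bullet> \<alpha>0 \<in> \<int>"
  shows "sim E8 E8 \<alpha>0 y tz \<or> sim E8 E8 \<alpha>0 y (- tz)"
proof -
  note E = even_group_E8 even_group_E8
  obtain a b c d e f g h k where yq: "y = qv [a,b,c,d,e,f,g,h]"
    and odd: "odd a" "odd b" "odd c" "odd d" "odd e" "odd f" "odd g" "odd h"
    and s: "a+b+c+d+e+f+g+h = 2 + 4 * k" using Z4_coords[OF y] .
  have "16 dvd (4 * (a + b))" using ya unfolding yq \<alpha>0_def hv_qv qv_inner of_int_16_Ints by (simp add: algebra_simps)
  then have ab: "4 dvd (a + b)" using dvd_times_left_cancel_iff[of 4 4 "a + b"] by simp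
  show ?thesis
  proof (cases "a mod 4 = 1")
    case True then show ?thesis unfolding yq by (rule sim_Z4_signed[OF _ ab odd(3-8) s])
  next
    case False
    then have b: "b mod 4 = 1" using odd(1) ab by presburger
    have s': "b+a+c+d+e+f+g+h = 2 + 4 * k" using s by simp
    have ba: "4 dvd (b + a)" using ab by (simp add: add.commute)
    have r: "refln (root 0) (qv [a,b,c,d,e,f,g,h]) = qv [b,a,c,d,e,f,g,h]"
      using refln_root[of "[]" "[c,d,e,f,g,h]" a b] by simp
    have "sim E8 E8 \<alpha>0 (qv [a,b,c,d,e,f,g,h]) t" if "sim E8 E8 \<alpha>0 (qv [b,a,c,d,e,f,g,h]) t" for t
      by (rule sim_refl[OF E, of "root 0"])
        (use that in \<open>simp_all add: root_E8 root_norm r, simp_all add: root_simps \<alpha>0_def hv_qv qv_inner\<close>)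
    then show ?thesis using sim_Z4_signed[OF b ba odd(3-8) s'] unfolding yq by blast
  qed
qed

section \<open>Normal form theorems\<close>

text \<open>One link of a chain: similarity is taken relative to the part \<open>N\<close> already
  normalised, and \<open>nbr_cong\<close> absorbs the remaining difference in
  \<open>N\<close>.\<close>

lemma chain_step:
  assumes h: "orthogonal_transformation h" "h ` E8 = E8" "h ` K = N" "h x = a"
    and N: "even_group N" and s: "sim E8 N a (h y) t" and e: "even_norm y" "even_norm t"
  shows "\<exists>h. orthogonal_transformation h \<and> h ` E8 = E8 \<and> h ` nbr K y = nbr N t \<and> h x = a"
proof -
  obtain g where g: "orthogonal_transformation g" "g ` E8 = E8" "g ` N = N" "g a = a" "g (h y) - t \<in> N"
    using s unfolding sim_def by blast
  have o: "orthogonal_transformation (g \<circ> h)" using orthogonal_transformation_compose[OF g(1) h(1)] .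
  have "(g \<circ> h) ` nbr K y = nbr N ((g \<circ> h) y)"
    using nbr_image[OF o, of K y] comp_image[OF h(3) g(3)] by simp
  also have "\<dots> = nbr N t" using g(5) e even_norm_orth[OF o, of y] by (intro nbr_cong[OF N]) simp_all
  finally show ?thesis using o comp_image[OF h(2) g(2)] h(4) g(4) by (intro exI[of _ "g \<circ> h"]) simp
qed

lemma inner_diff_Ints: "x \<bullet> (y - t) \<in> \<int> \<Longrightarrow> x \<bullet> y \<in> \<int> \<Longrightarrow> x \<bullet> t \<in> \<int>" for x :: "'a::real_inner"
  using Ints_diff[of "x \<bullet> y" "x \<bullet> (y - t)"] by (simp add: inner_diff_right)

lemma to_t1:
  assumes "2 *\<^sub>R y \<in> E8" "even_norm y" "y \<notin> E8"
  shows "\<exists>h. orthogonal_transformation h \<and> h ` E8 = E8 \<and> h y - t1 \<in> E8 \<and> h ` nbr E8 y = N1"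
proof -
  obtain h where h: "orthogonal_transformation h" "h ` E8 = E8" "h y - qv [4,0,0,0,0,0,0,0] \<in> E8"
    using sim_E8[OF assms] unfolding sim_def by blast
  \<comment> \<open>\<open>t1\<close> is e_1 + \<open>half_ones\<close>, a representative of even
    norm of the class of e_1.\<close>
  have "qv [4,0,0,0,0,0,0,0] - t1 \<in> E8" by (simp add: t1_def hv_qv qv_diff qv_E8)
  from subgrp_add[OF even_groupD(1)[OF even_group_E8] h(3) this] have y: "h y - t1 \<in> E8" by simp
  have "h ` nbr E8 y = nbr E8 (h y)" using nbr_image[OF h(1)] h(2) by simp
  also have "\<dots> = N1" unfolding N1_def using y assms(2) even_norm_orth[OF h(1)] t_even(1)
    by (intro nbr_cong[OF even_group_E8]) simp_all
  finally show ?thesis using h y by blast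
qed

text \<open>The chosen root is moved to \<open>\<alpha>0\<close> as soon as \<open>t1\<close> is in
  place, while all common roots are still equivalent; the next two links fix it.\<close>

lemma normal_form_1:
  assumes g: "nbr_chain E8 [y1]" and x: "x \<in> E8" "x \<bullet> x = 2" "x \<bullet> y1 \<in> \<int>"
  shows "\<exists>h. orthogonal_transformation h \<and> h ` E8 = E8 \<and> h ` nbrs E8 [y1] = N1 \<and> h x = \<alpha>0"
proof -
  have y: "2 *\<^sub>R y1 \<in> E8" "even_norm y1" using g by auto
  have "y1 \<notin> E8" using g subgrp_0[OF even_groupD(1)[OF even_group_E8]] by force
  from to_t1[OF y this] obtain h where h: "orthogonal_transformation h" "h ` E8 = E8" "h y1 - t1 \<in> E8" "h ` nbr E8 y1 = N1"
    by blast
  have hx: "h x \<in> E8" "h x \<bullet> h x = 2" using x h(1,2) by (auto simp: orth_simps)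
  have "h x \<bullet> t1 \<in> \<int>"
    by (rule inner_diff_Ints[OF even_groupD(2)[OF even_group_E8 hx(1) h(3)]]) (simp add: orth_simps(3)[OF h(1)] x(3))
  from root_to_\<alpha>0[OF hx this] obtain g where g: "orthogonal_transformation g" "g ` E8 = E8" "g ` N1 = N1" "g (h x) = \<alpha>0"
    by blast
  show ?thesis
    using orthogonal_transformation_compose[OF g(1) h(1)] comp_image[OF h(2) g(2)] comp_image[OF h(4) g(3)] g(4)
    by (intro exI[of _ "g \<circ> h"]) simp
qed

lemma nbr_chain_image:
  assumes g: "nbr_chain E8 (y # ys)" and h: "orthogonal_transformation h" "h ` E8 = E8" "h ` nbrs E8 ys = N"
    and N: "even_group N"
  shows "2 *\<^sub>R h y \<in> E8" "even_norm (h y)" "\<forall>k\<in>N. h y + k \<notin> E8" "t \<in> N \<Longrightarrow> (2 *\<^sub>R h y) \<bullet> t \<in> \<int>"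
proof -
  have i: "h x \<in> h ` A \<longleftrightarrow> x \<in> A" for x A
    using orthogonal_transformation_inj[OF h(1)] by (simp add: inj_image_mem_iff)
  have y2: "2 *\<^sub>R y \<in> E8" using g by simp
  show 1: "2 *\<^sub>R h y \<in> E8" using y2 h(2) unfolding orth_simps(2)[OF h(1), symmetric] by blast
  show "even_norm (h y)" using g even_norm_orth[OF h(1)] by simp
  show "\<forall>k\<in>N. h y + k \<notin> E8"
  proof
    fix k assume "k \<in> N"
    then obtain k' where k': "k' \<in> nbrs E8 ys" "k = h k'" using h(3) by auto
    then have "y + k' \<notin> E8" using g by simp
    then show "h y + k \<notin> E8" unfolding k'(2) orth_simps(1)[OF h(1), symmetric] using i h(2) by metis
  qed
  assume t: "t \<in> N"
  have "2 *\<^sub>R y \<in> nbrs E8 ys" using g y2 by (intro nbrs_memI) auto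
  then have "2 *\<^sub>R h y \<in> N" using h(3) unfolding orth_simps(2)[OF h(1), symmetric] by blast
  then show "(2 *\<^sub>R h y) \<bullet> t \<in> \<int>" using even_groupD(2)[OF N _ t] by blast
qed

lemma normal_form_2:
  assumes g: "nbr_chain E8 [y2, y1]" and x: "x \<in> E8" "x \<bullet> x = 2" "x \<bullet> y1 \<in> \<int>" "x \<bullet> y2 \<in> \<int>"
  shows "\<exists>h. orthogonal_transformation h \<and> h ` E8 = E8 \<and> h ` nbrs E8 [y2, y1] = N2 \<and> h x = \<alpha>0"
proof -
  have g1: "nbr_chain E8 [y1]" using g by simp
  obtain h where h: "orthogonal_transformation h" "h ` E8 = E8" "h ` nbrs E8 [y1] = N1" "h x = \<alpha>0"
    using normal_form_1[OF g1 x(1-3)] by blast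
  note cf = nbr_chain_image[OF g h(1-3) N_even_group(1)]
  have "h y2 \<bullet> \<alpha>0 \<in> \<int>" unfolding h(4)[symmetric] orth_simps(3)[OF h(1)] using x(4) by (simp add: inner_commute)
  from sim_N1[OF cf(1) cf(4)[OF t_mem(1)] cf(2,3) this]
  show ?thesis using chain_step[OF h N_even_group(1), of y2 t2] g t_even(2) by (simp add: N2_def)
qed

lemma normal_form_3:
  assumes g: "nbr_chain E8 [y3, y2, y1]"
    and x: "x \<in> E8" "x \<bullet> x = 2" "x \<bullet> y1 \<in> \<int>" "x \<bullet> y2 \<in> \<int>" "x \<bullet> y3 \<in> \<int>"
  shows "\<exists>h. orthogonal_transformation h \<and> h ` E8 = E8 \<and> h ` nbrs E8 [y3, y2, y1] = N3 \<and> h x = \<alpha>0"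
proof -
  have g2: "nbr_chain E8 [y2, y1]" using g by simp
  obtain h where h: "orthogonal_transformation h" "h ` E8 = E8" "h ` nbrs E8 [y2, y1] = N2" "h x = \<alpha>0"
    using normal_form_2[OF g2 x(1-4)] by blast
  note cf = nbr_chain_image[OF g h(1-3) N_even_group(2)]
  have "h y3 \<bullet> \<alpha>0 \<in> \<int>" unfolding h(4)[symmetric] orth_simps(3)[OF h(1)] using x(5) by (simp add: inner_commute)
  from sim_N2[OF cf(1) cf(4)[OF t_mem(2)] cf(4)[OF t_mem(3)] cf(2,3) this]
  show ?thesis using chain_step[OF h N_even_group(2), of y3 t3] g t_even(3) by (simp add: N3_def)
qed

section \<open>Existence of common roots\<close>

lemma half_sum_Ints:
  fixes p q :: real
  assumes "2 * p \<in> \<int>" "2 * q \<in> \<int>" "p \<in> \<int> \<longleftrightarrow> q \<in> \<int>" shows "p + q \<in> \<int>"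
proof -
  obtain m n :: int where m: "2 * p = of_int m" and n: "2 * q = of_int n" using assms(1,2) by (auto elim!: Ints_cases)
  have p: "p = of_int m / of_int 2" and q: "q = of_int n / of_int 2" using m n by simp_all
  have "even m \<longleftrightarrow> even n" using assms(3) unfolding p q by (simp only: of_int_div_Ints)
  then have "even (m + n)" by simp
  then have "of_int (m + n) / of_int 2 \<in> (\<int> :: real set)" by (simp only: of_int_div_Ints)
  then show ?thesis unfolding p q by (simp add: add_divide_distrib)
qed

text \<open>Pigeonhole: \<open>u\<close> and \<open>v\<close> have at most four patterns of integrality on the eight coordinates.\<close>

lemma root_integral_pairing:
  fixes u v :: "real^8"
  assumes u: "\<And>i. 2 * u $ i \<in> \<int>" and v: "\<And>i. 2 * v $ i \<in> \<int>"
  shows "\<exists>x\<in>E8. x \<bullet> x = 2 \<and> x \<bullet> u \<in> \<int> \<and> x \<bullet> v \<in> \<int> \<and> x \<bullet> t1 \<in> \<int>"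
proof -
  define F where "F i = (u $ i \<in> \<int>, v $ i \<in> \<int>)" for i
  have "\<not> inj F"
  proof
    assume "inj F"
    then have "CARD(8) \<le> card (UNIV :: (bool \<times> bool) set)" by (intro card_inj_on_le[of F]) auto
    then show False by (simp add: card_UNIV_bool)
  qed
  then obtain i j where ij: "i \<noteq> j" "F i = F j" by (auto simp: inj_on_def)
  define x :: "real^8" where "x = axis i 1 + axis j 1"
  have x: "x \<bullet> w = w $ i + w $ j" for w by (simp add: x_def inner_add_left inner_axis')
  have "x \<in> D8" unfolding D8_def
  proof (intro CollectI conjI allI exI[of _ 1])
    show "x $ k \<in> \<int>" for k by (simp add: x_def axis_def)
    have "(\<Sum>k\<in>UNIV. x $ k) = x \<bullet> (\<chi> k. 1)" by (simp add: inner_vec_def)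
    then show "(\<Sum>k\<in>UNIV. x $ k) = 2 * of_int 1" by (simp add: x)
  qed
  then have "x \<in> E8" unfolding E8_def by (intro CollectI exI[of _ x] exI[of _ "0::int"]) simp
  moreover have "x \<bullet> x = 2" unfolding x using ij(1) by (simp add: x_def axis_def)
  moreover have "x \<bullet> u \<in> \<int>" "x \<bullet> v \<in> \<int>" unfolding x using ij(2) u v by (auto intro!: half_sum_Ints simp: F_def)
  moreover have "x \<bullet> t1 \<in> \<int>"
  proof -
    \<comment> \<open>All coordinates of \<open>t1\<close> are odd halves, so any two of them add up
      to an integer.\<close>
    have "\<forall>k. 2 * t1 $ k \<in> \<int> \<and> t1 $ k \<notin> \<int>" unfolding forall_8 t1_def hv_qv
      using of_int_div_Ints[of 2 1] of_int_div_Ints[of 2 3] by simp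
    then show ?thesis unfolding x by (intro half_sum_Ints) auto
  qed
  ultimately show ?thesis by blast
qed

text \<open>Once \<open>y\<close> has been moved to \<open>t1\<close>, the vectors \<open>u\<close>
  and \<open>v\<close> have half-integral coordinates, as the pigeonhole argument requires.\<close>

lemma exists_root:
  assumes y: "2 *\<^sub>R y \<in> E8" "even_norm y" "y \<notin> E8"
    and u: "2 *\<^sub>R u \<in> E8" "(2 *\<^sub>R u) \<bullet> y \<in> \<int>" and v: "2 *\<^sub>R v \<in> E8" "(2 *\<^sub>R v) \<bullet> y \<in> \<int>"
  shows "\<exists>x\<in>E8. x \<bullet> x = 2 \<and> x \<bullet> y \<in> \<int> \<and> x \<bullet> u \<in> \<int> \<and> x \<bullet> v \<in> \<int>"
proof -
  obtain h where h: "orthogonal_transformation h" "h ` E8 = E8" "h y - t1 \<in> E8"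
    using to_t1[OF y] by blast
  have half: "2 * (h w) $ i \<in> \<int>" if w: "2 *\<^sub>R w \<in> E8" "(2 *\<^sub>R w) \<bullet> y \<in> \<int>" for w i
  proof -
    have E: "2 *\<^sub>R h w \<in> E8" using w(1) h(2) unfolding orth_simps(2)[OF h(1), symmetric] by blast
    have "(2 *\<^sub>R h w) \<bullet> h y \<in> \<int>" using w(2) unfolding orth_simps(2)[OF h(1), symmetric] orth_simps(3)[OF h(1)] .
    then have "(2 *\<^sub>R h w) \<bullet> t1 \<in> \<int>" using inner_diff_Ints[OF even_groupD(2)[OF even_group_E8 E h(3)]] by blast
    from half_coords[OF E this] obtain a b c d e f g k where "h w = hv [a,b,c,d,e,f,g,k]" .
    then have "\<forall>i. 2 * (h w) $ i \<in> \<int>" by (simp add: forall_8 hv_qv)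
    then show ?thesis by blast
  qed
  obtain x' where x': "x' \<in> E8" "x' \<bullet> x' = 2" "x' \<bullet> h u \<in> \<int>" "x' \<bullet> h v \<in> \<int>" "x' \<bullet> t1 \<in> \<int>"
    using root_integral_pairing[of "h u" "h v"] half[OF u] half[OF v] by blast
  obtain x where x: "x \<in> E8" "x' = h x" using x'(1) h(2) by auto
  have "x' \<bullet> h y = x' \<bullet> (h y - t1) + x' \<bullet> t1" by (simp add: inner_diff_right)
  then have "x' \<bullet> h y \<in> \<int>" using even_groupD(2)[OF even_group_E8 x'(1) h(3)] x'(5) by simp
  then show ?thesis using x x' by (auto simp: orth_simps(3)[OF h(1)])
qed

text \<open>Shorter chains are padded by zero vectors.\<close>

lemma chain_root:
  assumes g: "nbr_chain E8 ys" and l: "length ys \<in> {1,2,3}"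
  shows "\<exists>x\<in>E8. x \<bullet> x = 2 \<and> (\<forall>y\<in>set ys. x \<bullet> y \<in> \<int>)"
proof -
  have z: "2 *\<^sub>R (0::real^8) \<in> E8" "(2 *\<^sub>R (0::real^8)) \<bullet> y \<in> \<int>" for y :: "real^8"
    using subgrp_0[OF even_groupD(1)[OF even_group_E8]] by auto
  have n: "y \<notin> E8" if "\<forall>k\<in>E8. y + k \<notin> E8" for y :: "real^8"
    using that subgrp_0[OF even_groupD(1)[OF even_group_E8]] by force
  have d: "(2 *\<^sub>R w) \<bullet> y \<in> \<int>" if "w \<bullet> y \<in> \<int>" for w y :: "real^8"
    using that by (simp add: Ints_mult)
  consider y1 where "ys = [y1]" | y2 y1 where "ys = [y2,y1]" | y3 y2 y1 where "ys = [y3,y2,y1]"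
    using l by (auto simp: length_Suc_conv numeral_eq_Suc)
  then show ?thesis
  proof cases
    case 1
    then have "2 *\<^sub>R y1 \<in> E8" "even_norm y1" "\<forall>k\<in>E8. y1 + k \<notin> E8" using g by simp_all
    from exists_root[OF this(1,2) n[OF this(3)] z z] show ?thesis unfolding 1 by auto
  next
    case 2
    then have "2 *\<^sub>R y1 \<in> E8" "even_norm y1" "\<forall>k\<in>E8. y1 + k \<notin> E8" "2 *\<^sub>R y2 \<in> E8" "y2 \<bullet> y1 \<in> \<int>"
      using g by simp_all
    from exists_root[OF this(1,2) n[OF this(3)] this(4) d[OF this(5)] z] show ?thesis unfolding 2 by auto
  next
    case 3
    then have "2 *\<^sub>R y1 \<in> E8" "even_norm y1" "\<forall>k\<in>E8. y1 + k \<notin> E8" "2 *\<^sub>R y2 \<in> E8" "y2 \<bullet> y1 \<in> \<int>"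
      "2 *\<^sub>R y3 \<in> E8" "y3 \<bullet> y1 \<in> \<int>"
      using g by simp_all
    from exists_root[OF this(1,2) n[OF this(3)] this(4) d[OF this(5)] this(6) d[OF this(7)]]
    show ?thesis unfolding 3 by auto
  qed
qed

text \<open>The point is the order of quantifiers: \<open>P\<close> depends on \<open>i\<close>
  only, so any two neighbours are related through it.\<close>

lemma chain_normal_form:
  assumes "i \<in> {1,2,3}"
  obtains P where "\<And>ys x. nbr_chain E8 ys \<Longrightarrow> length ys = i \<Longrightarrow> x \<in> E8 \<Longrightarrow> x \<bullet> x = 2 \<Longrightarrow> \<forall>y\<in>set ys. x \<bullet> y \<in> \<int> \<Longrightarrow>
    \<exists>h. orthogonal_transformation h \<and> h ` E8 = E8 \<and> h ` nbrs E8 ys = P \<and> h x = \<alpha>0"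
proof -
  from assms consider "i = 1" | "i = 2" | "i = 3" by auto
  then show ?thesis
  proof cases
    case 1
    show ?thesis by (rule that[of N1]) (auto simp: 1 length_Suc_conv numeral_eq_Suc dest: normal_form_1)
  next
    case 2
    show ?thesis by (rule that[of N2]) (auto simp: 2 length_Suc_conv numeral_eq_Suc intro: normal_form_2[simplified])
  next
    case 3
    show ?thesis by (rule that[of N3]) (auto simp: 3 length_Suc_conv numeral_eq_Suc intro: normal_form_3[simplified])
  qed
qed

lemma normal_form_4:
  assumes g: "nbr_chain E8 ys" and l: "length ys = 4"
  shows "\<exists>h. orthogonal_transformation h \<and> h ` E8 = E8 \<and> h ` nbrs E8 ys = N4"
proof -
  obtain y4 y3 y2 y1 where ys: "ys = [y4, y3, y2, y1]" using l by (auto simp: length_Suc_conv numeral_eq_Suc)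
  have g4: "nbr_chain E8 (y4 # [y3, y2, y1])" and g3: "nbr_chain E8 [y3, y2, y1]" using g unfolding ys by simp_all
  obtain x where x: "x \<in> E8" "x \<bullet> x = 2" "x \<bullet> y1 \<in> \<int>" "x \<bullet> y2 \<in> \<int>" "x \<bullet> y3 \<in> \<int>"
    using chain_root[OF g3] by auto
  obtain h where h: "orthogonal_transformation h" "h ` E8 = E8" "h ` nbrs E8 [y3, y2, y1] = N3"
    using normal_form_3[OF g3 x] by blast
  note cf = nbr_chain_image[OF g4 h N_even_group(3)]
  \<comment> \<open>With no common root left to preserve, the tracked vector is now 0.\<close>
  from sim_N3[OF cf(1) cf(4)[OF t_mem(4)] cf(4)[OF t_mem(5)] cf(4)[OF t_mem(6)] cf(2,3)]
  show ?thesis using chain_step[OF h orth_simps(4)[OF h(1)] N_even_group(3), of y4 t4] g4 t_even(4)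
    by (auto simp: N4_def ys)
qed

lemma even_norm_double: "even_norm y \<Longrightarrow> even_norm (2 *\<^sub>R y)"
proof -
  assume "even_norm y"
  then obtain k :: int where "y \<bullet> y = 2 * of_int k" by (rule even_normE)
  then have "(2 *\<^sub>R y) \<bullet> (2 *\<^sub>R y) = 2 * of_int (4 * k)" by simp
  then show ?thesis unfolding even_norm_def by blast
qed

lemma Z4_to_t1:
  assumes y: "4 *\<^sub>R y \<in> E8" "2 *\<^sub>R y \<notin> E8" "even_norm y"
  shows "\<exists>h. orthogonal_transformation h \<and> h ` E8 = E8 \<and> 2 *\<^sub>R h y - t1 \<in> E8 \<and> h ` nbr E8 (2 *\<^sub>R y) = N1"
proof -
  have "2 *\<^sub>R (2 *\<^sub>R y) \<in> E8" using y(1) by simp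
  from to_t1[OF this even_norm_double[OF y(3)] y(2)]
  obtain h where h: "orthogonal_transformation h" "h ` E8 = E8" "h (2 *\<^sub>R y) - t1 \<in> E8" "h ` nbr E8 (2 *\<^sub>R y) = N1" by blast
  then show ?thesis using orth_simps(2)[OF h(1), of 2 y] by auto
qed

text \<open>For odd a and b, one of a + b and a - b is divisible by 4, so e_1 + e_2 or e_1 - e_2
  pairs integrally with a vector in odd quarters.\<close>

lemma Z4_root:
  assumes y: "4 *\<^sub>R y \<in> E8" "2 *\<^sub>R y \<notin> E8" "even_norm y"
  shows "\<exists>x\<in>E8. x \<bullet> x = 2 \<and> x \<bullet> y \<in> \<int>"
proof -
  obtain h where h: "orthogonal_transformation h" "h ` E8 = E8" "2 *\<^sub>R h y - t1 \<in> E8"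
    using Z4_to_t1[OF y] by blast
  have e: "even_norm (h y)" using y(3) even_norm_orth[OF h(1)] by blast
  obtain a b c d e f g k s where yq: "h y = qv [a,b,c,d,e,f,g,k]" and odd: "odd a" "odd b"
    using Z4_coords[OF h(3) e] by metis
  have "4 dvd (a + b) \<or> 4 dvd (a - b)" using odd by presburger
  then have "\<exists>x\<in>E8. x \<bullet> x = 2 \<and> x \<bullet> h y \<in> \<int>"
  proof
    assume "4 dvd (a + b)"
    then have "16 dvd (4 * (a + b))" using dvd_times_left_cancel_iff[of 4 4 "a + b"] by simp
    then have "qv [4,4,0,0,0,0,0,0] \<bullet> h y \<in> \<int>" unfolding yq qv_inner of_int_16_Ints by (simp add: algebra_simps)
    then show ?thesis by (intro bexI[of _ "qv [4,4,0,0,0,0,0,0]"]) (simp_all add: qv_inner qv_E8)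
  next
    assume "4 dvd (a - b)"
    then have "16 dvd (4 * (a - b))" using dvd_times_left_cancel_iff[of 4 4 "a - b"] by simp
    then have "qv [4,-4,0,0,0,0,0,0] \<bullet> h y \<in> \<int>" unfolding yq qv_inner of_int_16_Ints by (simp add: algebra_simps)
    then show ?thesis by (intro bexI[of _ "qv [4,-4,0,0,0,0,0,0]"]) (simp_all add: qv_inner qv_E8)
  qed
  then obtain x' where x': "x' \<in> E8" "x' \<bullet> x' = 2" "x' \<bullet> h y \<in> \<int>" by blast
  obtain x where "x \<in> E8" "x' = h x" using x'(1) h(2) by auto
  then show ?thesis using x' by (auto simp: orth_simps(3)[OF h(1)])
qed

lemma N1_cases:
  assumes "n \<in> N1" "n \<notin> E8" shows "n - t1 \<in> E8"
proof -
  note s = even_groupD(1)[OF even_group_E8]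
  obtain x k where n: "n = x + of_int k *\<^sub>R t1" "x \<in> E8" using assms(1) unfolding N1_def nbr_def by blast
  have t2: "2 *\<^sub>R t1 \<in> E8" unfolding t1_def hv_double hv_E8 by simp
  show ?thesis
  proof (cases "even k")
    case True
    then obtain j where j: "k = 2 * j" by (rule evenE)
    have "n = x + of_int j *\<^sub>R (2 *\<^sub>R t1)" by (simp add: n j)
    then have "n \<in> E8" using subgrp_add[OF s n(2) subgrp_int[OF s t2]] by simp
    with assms(2) show ?thesis by simp
  next
    case False
    then obtain j where j: "k = 2 * j + 1" by (rule oddE)
    have "n - t1 = x + of_int j *\<^sub>R (2 *\<^sub>R t1)" by (simp add: n j algebra_simps)
    then show ?thesis using subgrp_add[OF s n(2) subgrp_int[OF s t2]] by simp
  qed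
qed

lemma Z4_normal_form:
  assumes y: "4 *\<^sub>R y \<in> E8" "2 *\<^sub>R y \<notin> E8" "even_norm y" and x: "x \<in> E8" "x \<bullet> x = 2" "x \<bullet> y \<in> \<int>"
  shows "\<exists>h. orthogonal_transformation h \<and> h ` E8 = E8 \<and> h ` nbr E8 y = nbr E8 tz \<and> h x = \<alpha>0"
proof -
  note s = even_groupD(1)[OF even_group_E8]
  obtain h where h: "orthogonal_transformation h" "h ` E8 = E8" "2 *\<^sub>R h y - t1 \<in> E8" "h ` nbr E8 (2 *\<^sub>R y) = N1"
    using Z4_to_t1[OF y] by blast
  have hx: "h x \<in> E8" "h x \<bullet> h x = 2" using x h(1,2) by (auto simp: orth_simps)
  have "h x \<bullet> (2 *\<^sub>R h y) \<in> \<int>" using x(3) by (simp add: orth_simps(3)[OF h(1)] Ints_mult)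
  from inner_diff_Ints[OF even_groupD(2)[OF even_group_E8 hx(1) h(3)] this]
  obtain g where g: "orthogonal_transformation g" "g ` E8 = E8" "g ` N1 = N1" "g (h x) = \<alpha>0"
    using root_to_\<alpha>0[OF hx] by blast
  define k where "k = g \<circ> h"
  have k: "orthogonal_transformation k" "k ` E8 = E8" "k ` nbr E8 (2 *\<^sub>R y) = N1" "k x = \<alpha>0"
    unfolding k_def using orthogonal_transformation_compose[OF g(1) h(1)] comp_image[OF h(2) g(2)]
      comp_image[OF h(4) g(3)] g(4) by simp_all
  \<comment> \<open>The isometry taking the root to \<open>\<alpha>0\<close> is only known to
    preserve \<open>N1\<close>. The class of \<open>t1\<close> is recovered as the only nonzero
    class modulo E8 met by \<open>N1\<close>.\<close>
  have "k (2 *\<^sub>R y) \<in> N1" using nbr_self[OF s, of "2 *\<^sub>R y"] k(3) by blast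
  moreover have "k (2 *\<^sub>R y) \<notin> E8"
    using y(2) orthogonal_transformation_inj[OF k(1)] k(2) by (metis inj_image_mem_iff)
  ultimately have a: "2 *\<^sub>R k y - t1 \<in> E8" using N1_cases orth_simps(2)[OF k(1), of 2 y] by metis
  have b: "even_norm (k y)" using y(3) even_norm_orth[OF k(1)] by blast
  have c: "k y \<bullet> \<alpha>0 \<in> \<int>" unfolding k(4)[symmetric] orth_simps(3)[OF k(1)] using x(3) by (simp add: inner_commute)
  have tm: "even_norm (- tz)" using t_even(5) by (simp add: even_norm_def)
  from sim_Z4[OF a b c] show ?thesis
  proof
    assume "sim E8 E8 \<alpha>0 (k y) tz"
    from chain_step[OF k(1,2,2,4) even_group_E8 this y(3) t_even(5)] show ?thesis .
  next
    assume "sim E8 E8 \<alpha>0 (k y) (- tz)"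
    from chain_step[OF k(1,2,2,4) even_group_E8 this y(3) tm] show ?thesis unfolding nbr_minus .
  qed
qed

section \<open>Lattices of small determinant\<close>

lemma lattice_subgrp:
  assumes "is_lattice L" shows "subgrp L"
proof -
  obtain b where L: "L = {\<Sum>i\<in>UNIV. of_int (c i) *\<^sub>R b i | c :: 'a \<Rightarrow> int. True}"
    using assms unfolding is_lattice_def lattice_basis_def by blast
  show ?thesis unfolding subgrp_def
  proof (intro conjI ballI)
    show "0 \<in> L" unfolding L by (intro CollectI exI[of _ "\<lambda>_. 0"]) simp
    fix x y assume "x \<in> L" "y \<in> L"
    then obtain c d where x: "x = (\<Sum>i\<in>UNIV. of_int (c i) *\<^sub>R b i)" and y: "y = (\<Sum>i\<in>UNIV. of_int (d i) *\<^sub>R b i)"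
      unfolding L by blast
    have "x - y = (\<Sum>i\<in>UNIV. of_int (c i - d i) *\<^sub>R b i)"
      by (simp add: x y sum_subtractf scaleR_diff_left)
    then show "x - y \<in> L" unfolding L by (intro CollectI exI[of _ "\<lambda>i. c i - d i"] conjI TrueI)
  qed
qed

lemma even_lattices_even_group: "L \<in> even_lattices \<Longrightarrow> even_group L"
  unfolding even_lattices_def even_lattice_def even_group_def even_norm_def using lattice_subgrp by auto

lemma det_Ints:
  fixes A :: "real^'n^'n"
  assumes "\<And>i j. A $ i $ j \<in> \<int>" shows "det A \<in> \<int>"
  unfolding det_def using assms by (auto intro!: Ints_sum Ints_mult Ints_prod)

lemma lattice_basis_mem:
  assumes "lattice_basis b L" shows "b i \<in> L"
proof -
  have "b i = (\<Sum>j\<in>UNIV. of_int (if j = i then 1 else 0) *\<^sub>R b j)"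
  proof -
    have "(\<Sum>j\<in>UNIV. of_int (if j = i then 1 else 0) *\<^sub>R b j) = (\<Sum>j\<in>UNIV. if j = i then b j else 0)"
      by (rule sum.cong) auto
    then show ?thesis by simp
  qed
  then show ?thesis using assms unfolding lattice_basis_def
    by (auto intro!: exI[of _ "\<lambda>j. if j = i then 1 else 0"])
qed

lemma lattice_basis_span:
  fixes b :: "'n::finite \<Rightarrow> real^'n"
  assumes "lattice_basis b L"
  obtains u where "x = (\<Sum>i\<in>UNIV. u i *\<^sub>R b i)"
proof -
  have i: "inj b" and ind: "independent (range b)" using assms by (auto simp: lattice_basis_def)
  have "card (range b) = dim (UNIV :: (real^'n) set)" using card_image[OF i] by simp
  then have "UNIV \<subseteq> span (range b)"
    using card_eq_dim[of "range b" "UNIV :: (real^'n) set"] ind by simp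
  then have "x \<in> span (range b)" by auto
  then obtain u where u: "x = (\<Sum>v\<in>range b. u v *\<^sub>R v)" by (auto simp: span_finite)
  have "x = (\<Sum>i\<in>UNIV. u (b i) *\<^sub>R b i)" unfolding u by (simp add: sum.reindex[OF i])
  then show ?thesis by (rule that)
qed

text \<open>Adjoining a vector to an integral lattice divides the determinant by the square of the index,
  which cannot happen for determinant \<open>1\<close> or \<open>2\<close>.\<close>

lemma even_lattices_maximal:
  fixes N :: "(real^'n) set"
  assumes N: "N \<in> even_lattices" and x: "\<forall>y\<in>N. x \<bullet> y \<in> \<int>" "x \<bullet> x \<in> \<int>"
  shows "x \<in> N"
proof -
  obtain b where b: "lattice_basis b N"
    using N unfolding even_lattices_def even_lattice_def is_lattice_def by blast
  have D: "det (gram_matrix b) = 1 \<or> det (gram_matrix b) = 2"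
    using N lattice_det_eq[OF b] unfolding even_lattices_def by (auto split: if_splits)
  obtain u where u: "x = (\<Sum>i\<in>UNIV. u i *\<^sub>R b i)" using lattice_basis_span[OF b] .
  let ?B = "(\<chi> i. b i) :: real^'n^'n"
  have int: "y \<bullet> z \<in> \<int>" if "y \<in> N" "z \<in> N" for y z
    using even_groupD(2)[OF even_lattices_even_group[OF N]] that by blast
  have bb: "b i \<bullet> b j \<in> \<int>" for i j using int lattice_basis_mem[OF b] by blast
  have xb: "x \<bullet> b j \<in> \<int>" for j using x(1) lattice_basis_mem[OF b] by blast
  then have bx: "b j \<bullet> x \<in> \<int>" for j by (simp add: inner_commute)
  have "u k \<in> \<int>" for k
  proof -
    \<comment> \<open>Cramer's rule: with \<open>x\<close> as row \<open>k\<close>, the determinant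
      is multiplied by \<open>u k\<close>. For the Gram determinant D and u = \<open>u k\<close>,
      pairing \<open>?C\<close> with \<open>?B\<close> and with itself shows that D u and D u^2 are
      integers. If D = 2, then 2u is an integer with even square, hence even.\<close>
    let ?C = "(\<chi> i. if i = k then x else b i) :: real^'n^'n"
    have "det ?C = u k * det ?B"
      using cramer_lemma_transpose[of k "\<chi> i. u i" ?B] by (simp add: u row_def scalar_mult_eq_scaleR cong: if_cong)
    have G: "det (gram_matrix b) = det ?B * det ?B" by (simp add: gram_matrix_eq det_mul)
    have "det (?C ** transpose ?B) \<in> \<int>"
    proof (rule det_Ints)
      fix i j
      have "(?C ** transpose ?B) $ i $ j = (if i = k then x else b i) \<bullet> b j"
        by (simp add: matrix_matrix_mult_def transpose_def inner_vec_def)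
      then show "(?C ** transpose ?B) $ i $ j \<in> \<int>"
        using xb bb by auto
    qed
    then have 1: "u k * det (gram_matrix b) \<in> \<int>" by (simp add: det_mul \<open>det ?C = _\<close> G mult.assoc)
    have "det (?C ** transpose ?C) \<in> \<int>"
    proof (rule det_Ints)
      fix i j
      have "(?C ** transpose ?C) $ i $ j = (if i = k then x else b i) \<bullet> (if j = k then x else b j)"
        by (simp add: matrix_matrix_mult_def transpose_def inner_vec_def)
      then show "(?C ** transpose ?C) $ i $ j \<in> \<int>"
        using x(2) xb bx bb by auto
    qed
    then have 2: "u k * u k * det (gram_matrix b) \<in> \<int>"
      by (simp add: det_mul \<open>det ?C = _\<close> G algebra_simps)
    show "u k \<in> \<int>"
    proof (cases "det (gram_matrix b) = 1")
      case True then show ?thesis using 1 by simp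
    next
      case False
      then have d2: "det (gram_matrix b) = 2" using D by simp
      obtain p q :: int where p: "u k * 2 = of_int p" and q: "u k * u k * 2 = of_int q"
        using 1 2 unfolding d2 by (auto elim!: Ints_cases)
      have "real_of_int (p * p) = of_int (2 * q)" using p q by (simp flip: p q)
      then have "p * p = 2 * q" by (simp only: of_int_eq_iff)
      then have "even (p * p)" by simp
      then have "even p" by simp
      then obtain r where "p = 2 * r" by (rule evenE)
      then have "u k = of_int r" using p by simp
      then show ?thesis by simp
    qed
  qed
  then have "\<forall>k. \<exists>c::int. u k = of_int c" by (auto elim: Ints_cases)
  then obtain c :: "'n \<Rightarrow> int" where "\<And>k. u k = of_int (c k)" by metis
  then have "x = (\<Sum>i\<in>UNIV. of_int (c i) *\<^sub>R b i)" using u by simp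
  then show ?thesis using b unfolding lattice_basis_def by blast
qed

lemma lattice_basis_image:
  fixes g :: "real^'n \<Rightarrow> real^'n"
  assumes g: "orthogonal_transformation g" and b: "lattice_basis b L"
  shows "lattice_basis (\<lambda>i. g (b i)) (g ` L)"
  unfolding lattice_basis_def
proof (intro conjI)
  have l: "linear g" and i: "inj g" using g orthogonal_transformation_inj orthogonal_transformation_linear by auto
  show "inj (\<lambda>i. g (b i))" using i b unfolding lattice_basis_def inj_def by blast
  have "independent (g ` range b)" using b l i unfolding lattice_basis_def
    by (intro linear_independent_injective_image) (auto intro: inj_on_subset)
  then show "independent (range (\<lambda>i. g (b i)))" by (simp add: image_image)
  have "g (\<Sum>i\<in>UNIV. of_int (c i) *\<^sub>R b i) = (\<Sum>i\<in>UNIV. of_int (c i) *\<^sub>R g (b i))" for c :: "'n \<Rightarrow> int"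
    using l by (simp add: linear_sum linear_scale)
  then show "g ` L = {\<Sum>i\<in>UNIV. of_int (c i) *\<^sub>R g (b i) | c. True}"
    using b unfolding lattice_basis_def by (auto simp: image_iff) metis+
qed

lemma even_lattices_image:
  fixes g :: "real^'n \<Rightarrow> real^'n"
  assumes g: "orthogonal_transformation g" and L: "L \<in> even_lattices"
  shows "g ` L \<in> even_lattices"
proof -
  obtain b where b: "lattice_basis b L"
    using L unfolding even_lattices_def even_lattice_def is_lattice_def by blast
  have "gram_matrix (\<lambda>i. g (b i)) = gram_matrix b" by (simp add: gram_matrix_def orth_simps(3)[OF g])
  then have "lattice_det (g ` L) = lattice_det L"
    using lattice_det_eq[OF b] lattice_det_eq[OF lattice_basis_image[OF g b]] by simp
  moreover have "is_lattice (g ` L)" using lattice_basis_image[OF g b] unfolding is_lattice_def by blast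
  ultimately show ?thesis using L unfolding even_lattices_def even_lattice_def
    by (auto simp: orth_simps(3)[OF g])
qed

section \<open>Quotient groups\<close>

lemma additive_group_simps [simp]:
  "carrier (additive_group L) = L" "x \<otimes>\<^bsub>additive_group L\<^esub> y = x + y" "\<one>\<^bsub>additive_group L\<^esub> = 0"
  by (simp_all add: additive_group_def)

lemma additive_group_comm_group:
  assumes "subgrp L" shows "comm_group (additive_group L)"
proof (rule comm_groupI)
  fix x assume "x \<in> carrier (additive_group L)"
  then show "\<exists>y\<in>carrier (additive_group L). y \<otimes>\<^bsub>additive_group L\<^esub> x = \<one>\<^bsub>additive_group L\<^esub>"
    using subgrp_minus[OF assms, of x] by (intro bexI[of _ "- x"]) auto
qed (use assms in \<open>auto simp: subgrp_add subgrp_0 algebra_simps\<close>)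

text \<open>Trades an isomorphism of the quotient for a surjection with kernel \<open>M\<close>, so
  that cosets disappear from the later arguments; \<open>quotient_isoI\<close> is the way
  back.\<close>

lemma quotient_iso_hom:
  assumes N: "subgrp N" and M: "subgrp M" "M \<subseteq> N" and A: "group A" and iso: "additive_group N Mod M \<cong> A"
  obtains f where "f \<in> hom (additive_group N) A" "f ` N = carrier A" "\<And>x. x \<in> N \<Longrightarrow> f x = \<one>\<^bsub>A\<^esub> \<longleftrightarrow> x \<in> M"
proof -
  let ?N = "additive_group N"
  interpret N: comm_group ?N by (rule additive_group_comm_group[OF N])
  have inv: "inv\<^bsub>?N\<^esub> x = - x" if "x \<in> N" for x
    by (rule N.inv_equality) (use that subgrp_minus[OF N that] in auto)
  have sg: "subgroup M ?N"
    by (rule N.subgroupI) (use M inv subgrp_0[OF M(1)] subgrp_add[OF M(1)] subgrp_minus[OF M(1)] in auto)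
  then interpret normal M ?N by (rule N.subgroup_imp_normal)
  obtain \<phi> where \<phi>: "\<phi> \<in> iso (?N Mod M) A" using iso unfolding is_iso_def by blast
  then have \<phi>h: "\<phi> \<in> hom (?N Mod M) A" and \<phi>b: "bij_betw \<phi> (carrier (?N Mod M)) (carrier A)"
    by (auto simp: iso_def)
  define f where "f x = \<phi> (M #>\<^bsub>?N\<^esub> x)" for x
  have q: "(\<lambda>a. M #>\<^bsub>?N\<^esub> a) \<in> hom ?N (?N Mod M)" by (rule r_coset_hom_Mod)
  have "f \<in> hom ?N A" using hom_compose[OF q \<phi>h] by (simp add: f_def[abs_def] comp_def)
  moreover have "f ` N = carrier A"
  proof -
    have "f ` N = \<phi> ` carrier (?N Mod M)" unfolding carrier_FactGroup f_def[abs_def] by (simp add: image_image)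
    then show ?thesis using \<phi>b by (simp add: bij_betw_def)
  qed
  moreover have "f x = \<one>\<^bsub>A\<^esub> \<longleftrightarrow> x \<in> M" if x: "x \<in> N" for x
  proof -
    have "\<phi> M = \<one>\<^bsub>A\<^esub>" using hom_one[OF \<phi>h factorgroup_is_group A] by simp
    moreover have "M #>\<^bsub>?N\<^esub> x \<in> carrier (?N Mod M)" "M \<in> carrier (?N Mod M)"
      using x hom_in_carrier[OF q, of x] group.is_monoid[OF factorgroup_is_group, THEN monoid.one_closed] by auto
    ultimately have "f x = \<one>\<^bsub>A\<^esub> \<longleftrightarrow> M #>\<^bsub>?N\<^esub> x = M"
      using \<phi>b unfolding f_def bij_betw_def inj_on_def by metis
    also have "\<dots> \<longleftrightarrow> x \<in> M"
      using N.coset_join1[of M x] N.coset_join2[of x M] sg x by (auto simp: subgroup.subset)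
    finally show ?thesis .
  qed
  ultimately show ?thesis by (rule that)
qed

lemma quotient_isoI:
  assumes N: "subgrp N" and A: "group A" and f: "f \<in> hom (additive_group N) A" "f ` N = carrier A"
    and ker: "\<And>x. x \<in> N \<Longrightarrow> f x = \<one>\<^bsub>A\<^esub> \<longleftrightarrow> x \<in> M" "M \<subseteq> N"
  shows "additive_group N Mod M \<cong> A"
proof -
  let ?N = "additive_group N"
  interpret N: comm_group ?N by (rule additive_group_comm_group[OF N])
  interpret group_hom ?N A f using f A by (simp add: group_hom_def group_hom_axioms_def N.is_group)
  have "kernel ?N A f = M" using ker by (auto simp: kernel_def)
  then show ?thesis using FactGroup_iso_set f(2) unfolding is_iso_def by auto
qed

lemma quotient_iso_transfer:
  assumes N: "subgrp N" and M: "subgrp M" "M \<subseteq> N" and A: "group A" and iso: "additive_group N Mod M \<cong> A"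
    and g: "linear g" "inj g" and N': "g ` N = N'" "g ` M = M'"
  shows "additive_group N' Mod M' \<cong> A"
proof -
  obtain f where f: "f \<in> hom (additive_group N) A" "f ` N = carrier A" "\<And>x. x \<in> N \<Longrightarrow> f x = \<one>\<^bsub>A\<^esub> \<longleftrightarrow> x \<in> M"
    using quotient_iso_hom[OF N M A iso] by metis
  have i: "inv_into UNIV g (g x) = x" for x using g(2) by (simp add: inv_f_f)
  show ?thesis
  proof (rule quotient_isoI[where f = "f \<circ> inv_into UNIV g"])
    show "subgrp N'" unfolding N'(1)[symmetric] subgrp_def
    proof (intro conjI ballI)
      show "0 \<in> g ` N" using subgrp_0[OF N] linear_0[OF g(1)] by force
      fix x y assume "x \<in> g ` N" "y \<in> g ` N"
      then show "x - y \<in> g ` N" using subgrp_diff[OF N] by (auto simp flip: linear_diff[OF g(1)])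
    qed
    show "f \<circ> inv_into UNIV g \<in> hom (additive_group N') A"
    proof (rule homI)
      fix x assume "x \<in> carrier (additive_group N')"
      then show "(f \<circ> inv_into UNIV g) x \<in> carrier A" using f(2) by (auto simp: i simp flip: N'(1))
    next
      fix x y assume "x \<in> carrier (additive_group N')" "y \<in> carrier (additive_group N')"
      then obtain x' y' where "x = g x'" "y = g y'" "x' \<in> N" "y' \<in> N" by (auto simp flip: N'(1))
      then show "(f \<circ> inv_into UNIV g) (x \<otimes>\<^bsub>additive_group N'\<^esub> y) = (f \<circ> inv_into UNIV g) x \<otimes>\<^bsub>A\<^esub> (f \<circ> inv_into UNIV g) y"
        using hom_mult[OF f(1), of x' y'] by (simp add: i flip: linear_add[OF g(1)])
    qed
    show "(f \<circ> inv_into UNIV g) ` N' = carrier A" unfolding N'(1)[symmetric] using f(2) by (simp add: image_comp[symmetric] image_image i)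
    show "M' \<subseteq> N'" using M(2) by (auto simp flip: N')
    fix x assume "x \<in> N'"
    then obtain x' where x': "x = g x'" "x' \<in> N" by (auto simp flip: N'(1))
    have "g x' \<in> g ` M \<longleftrightarrow> x' \<in> M" using g(2) by (simp add: inj_image_mem_iff)
    then show "(f \<circ> inv_into UNIV g) x = \<one>\<^bsub>A\<^esub> \<longleftrightarrow> x \<in> M'" using f(3)[OF x'(2)] by (simp add: x'(1) i flip: N'(2))
  qed (rule A)
qed

lemma subgrp_Int: "subgrp A \<Longrightarrow> subgrp B \<Longrightarrow> subgrp (A \<inter> B)"
  by (auto simp: subgrp_def)

lemma neighbours_image:
  assumes A: "group A" and g: "orthogonal_transformation g" "g ` L = L" and N: "N \<in> neighbours A L"
  shows "g ` N \<in> neighbours A L"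
proof -
  have LN: "L \<in> even_lattices" "N \<in> even_lattices" using N by (auto simp: neighbours_def)
  have s: "subgrp L" "subgrp N" using LN even_lattices_even_group even_groupD(1) by blast+
  have i: "inj g" "linear g" using g(1) orthogonal_transformation_inj orthogonal_transformation_linear by auto
  have M: "g ` (L \<inter> N) = L \<inter> g ` N" using g(2) i(1) by (simp add: image_Int)
  note t = quotient_iso_transfer[OF _ subgrp_Int[OF s] _ A _ i(2,1) _ M]
  show ?thesis using N t[OF s(1) _ _ g(2)] t[OF s(2) _ _ refl] even_lattices_image[OF g(1) LN(2)]
    unfolding neighbours_def by auto
qed

section \<open>Coordinates on the quotient of a neighbour\<close>

lemma elementary_2_group: "group (elementary_2_group i)"
  unfolding elementary_2_group_def by simp

lemma elementary_2_group_simps: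
  "carrier (elementary_2_group i) = (\<Pi>\<^sub>E j\<in>{..<i}. {0..<2})"
  "\<one>\<^bsub>elementary_2_group i\<^esub> = (\<lambda>j\<in>{..<i}. 0)"
  "x \<otimes>\<^bsub>elementary_2_group i\<^esub> y = (\<lambda>j\<in>{..<i}. (x j + y j) mod 2)"
  by (simp_all add: elementary_2_group_def carrier_integer_mod_group)

lemma neighbour_parities:
  assumes N: "N \<in> neighbours (elementary_2_group i) L"
  obtains f where "\<And>x y j. x \<in> N \<Longrightarrow> y \<in> N \<Longrightarrow> j < i \<Longrightarrow> f (x + y) j = (f x j + f y j :: int) mod 2"
    "\<And>x. x \<in> N \<Longrightarrow> (\<forall>j<i. f x j = 0) \<longleftrightarrow> x \<in> L"
    "\<And>k. k < i \<Longrightarrow> \<exists>y\<in>N. \<forall>j<i. f y j = (if j = k then 1 else 0)"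
proof -
  let ?A = "elementary_2_group i"
  have s: "subgrp L" "subgrp N" using N even_lattices_even_group even_groupD(1) by (auto simp: neighbours_def)
  have iso: "additive_group N Mod (L \<inter> N) \<cong> ?A" using N by (simp add: neighbours_def)
  obtain f where f: "f \<in> hom (additive_group N) ?A" "f ` N = carrier ?A"
    "\<And>x. x \<in> N \<Longrightarrow> f x = \<one>\<^bsub>?A\<^esub> \<longleftrightarrow> x \<in> L \<inter> N"
    using quotient_iso_hom[OF s(2) subgrp_Int[OF s] _ elementary_2_group iso] by auto
  show ?thesis
  proof (rule that[of f])
    show "f (x + y) j = (f x j + f y j) mod 2" if "x \<in> N" "y \<in> N" "j < i" for x y j
      using hom_mult[OF f(1), of x y] that by (simp add: elementary_2_group_simps)
    show "(\<forall>j<i. f x j = 0) \<longleftrightarrow> x \<in> L" if x: "x \<in> N" for x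
    proof -
      have "f x \<in> carrier ?A" using f(2) x by blast
      then have "f x \<in> extensional {..<i}" by (auto simp: elementary_2_group_simps PiE_def)
      then have "f x = \<one>\<^bsub>?A\<^esub> \<longleftrightarrow> (\<forall>j<i. f x j = 0)"
        by (auto simp: elementary_2_group_simps fun_eq_iff extensional_def)
      then show ?thesis using f(3)[OF x] x by simp
    qed
    show "\<exists>y\<in>N. \<forall>j<i. f y j = (if j = k then 1 else 0)" if "k < i" for k
    proof -
      have "(\<lambda>j\<in>{..<i}. if j = k then 1 else 0) \<in> carrier ?A" by (auto simp: elementary_2_group_simps)
      then obtain y where "y \<in> N" "f y = (\<lambda>j\<in>{..<i}. if j = k then 1 else 0)"
        unfolding f(2)[symmetric] by (auto simp: image_iff)
      then show ?thesis by (intro bexI[of _ y]) simp_all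
    qed
  qed
qed

lemma neighbour_residues:
  assumes N: "N \<in> neighbours (integer_mod_group 4) L"
  obtains f where "\<And>x y. x \<in> N \<Longrightarrow> y \<in> N \<Longrightarrow> f (x + y) = (f x + f y :: int) mod 4"
    "\<And>x. x \<in> N \<Longrightarrow> f x = 0 \<longleftrightarrow> x \<in> L" "\<exists>y\<in>N. f y = 1"
proof -
  let ?A = "integer_mod_group 4"
  have s: "subgrp L" "subgrp N" using N even_lattices_even_group even_groupD(1) by (auto simp: neighbours_def)
  have iso: "additive_group N Mod (L \<inter> N) \<cong> ?A" using N by (simp add: neighbours_def)
  obtain f where f: "f \<in> hom (additive_group N) ?A" "f ` N = carrier ?A"
    "\<And>x. x \<in> N \<Longrightarrow> f x = \<one>\<^bsub>?A\<^esub> \<longleftrightarrow> x \<in> L \<inter> N"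
    using quotient_iso_hom[OF s(2) subgrp_Int[OF s] _ group_integer_mod_group iso] by auto
  show ?thesis
  proof (rule that[of f])
    show "f (x + y) = (f x + f y) mod 4" if "x \<in> N" "y \<in> N" for x y
      using hom_mult[OF f(1), of x y] that by simp
    show "f x = 0 \<longleftrightarrow> x \<in> L" if x: "x \<in> N" for x using f(3)[OF x] x by simp
    have "1 \<in> f ` N" unfolding f(2) by (simp add: carrier_integer_mod_group)
    then show "\<exists>y\<in>N. f y = 1" by auto
  qed
qed

section \<open>Existence of neighbours\<close>

text \<open>An involution preserves the intersection of \<open>L\<close> with its image, so the
  quotient of the image is carried over from that of \<open>L\<close>, and only one kernel has to be
  computed.\<close>

lemma neighbours_involution:
  fixes h :: "real^'n \<Rightarrow> real^'n"
  assumes L: "L \<in> even_lattices" and h: "orthogonal_transformation h" "\<And>x. h (h x) = x" and A: "group A"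
    and f: "f \<in> hom (additive_group L) A" "f ` L = carrier A"
    and ker: "\<And>x. x \<in> L \<Longrightarrow> f x = \<one>\<^bsub>A\<^esub> \<longleftrightarrow> h x \<in> L"
  shows "h ` L \<in> neighbours A L"
proof -
  have s: "subgrp L" using even_groupD(1)[OF even_lattices_even_group[OF L]] .
  have hL: "x \<in> h ` L \<longleftrightarrow> h x \<in> L" for x using h(2) by (metis image_iff)
  have M: "h ` (L \<inter> h ` L) = L \<inter> h ` L" using h(2) hL by (auto simp: image_iff)
  have i: "linear h" "inj h" using h(1) orthogonal_transformation_inj orthogonal_transformation_linear by auto
  have N: "h ` L \<in> even_lattices" by (rule even_lattices_image[OF h(1) L])
  have sM: "subgrp (L \<inter> h ` L)"
    using subgrp_Int[OF s even_groupD(1)[OF even_lattices_even_group[OF N]]] .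
  have 1: "additive_group L Mod (L \<inter> h ` L) \<cong> A"
    by (rule quotient_isoI[OF s A f]) (use ker hL in auto)
  have 2: "additive_group (h ` L) Mod (L \<inter> h ` L) \<cong> A"
    by (rule quotient_iso_transfer[OF s sM _ A 1 i refl M]) simp
  show ?thesis using L N 1 2 by (simp add: neighbours_def)
qed

text \<open>The map is the product of the reflections in the \<open>u j\<close>, with factor 2/4
  because of their norm. It sends a vector z of \<open>L\<close> into \<open>L\<close> exactly when
  all z.u_j are even: pairing with the dual vectors \<open>x k\<close> isolates these numbers, and
  the same vectors show that all parities occur.\<close>

lemma neighbours_elementary:
  fixes u :: "nat \<Rightarrow> real^'n"
  assumes L: "L \<in> even_lattices" and u: "\<And>j. j < i \<Longrightarrow> u j \<in> L"
    and uu: "\<And>j k. j < i \<Longrightarrow> k < i \<Longrightarrow> u j \<bullet> u k = (if j = k then 4 else 0)"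
    and x: "\<And>k. k < i \<Longrightarrow> x k \<in> L" and xu: "\<And>j k. j < i \<Longrightarrow> k < i \<Longrightarrow> x k \<bullet> u j = (if j = k then 1 else 0)"
  shows "(\<lambda>z. z - (\<Sum>j<i. (z \<bullet> u j / 2) *\<^sub>R u j)) ` L \<in> neighbours (elementary_2_group i) L"
proof -
  note E = even_lattices_even_group[OF L]
  note s = even_groupD(1)[OF E]
  define h where "h z = z - (\<Sum>j<i. (z \<bullet> u j / 2) *\<^sub>R u j)" for z
  have sum_in: "(\<Sum>j<k. of_int (c j) *\<^sub>R w j) \<in> L" if "k \<le> i" "\<And>j. j < i \<Longrightarrow> w j \<in> L" for k c and w :: "nat \<Rightarrow> real^'n"
    using that(1) by (induction k) (auto intro!: subgrp_add[OF s] subgrp_int[OF s] that(2) simp: subgrp_0[OF s])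
  have su: "(\<Sum>j<i. c j *\<^sub>R u j) \<bullet> u k = 4 * c k" if "k < i" for c k
  proof -
    have "(\<Sum>j<i. c j *\<^sub>R u j) \<bullet> u k = (\<Sum>j<i. if j = k then 4 * c k else 0)"
      unfolding inner_sum_left by (rule sum.cong) (use uu that in auto)
    then show ?thesis using that by simp
  qed
  have hu: "h z \<bullet> u k = - (z \<bullet> u k)" if "k < i" for z k
    unfolding h_def inner_diff_left su[OF that] by simp
  have hh: "h (h z) = z" for z
  proof -
    have "(\<Sum>j<i. (h z \<bullet> u j / 2) *\<^sub>R u j) = - (\<Sum>j<i. (z \<bullet> u j / 2) *\<^sub>R u j)"
      unfolding sum_negf[symmetric] by (rule sum.cong) (simp_all add: hu)
    then have "h (h z) = h z + (\<Sum>j<i. (z \<bullet> u j / 2) *\<^sub>R u j)" by (subst h_def) simp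
    then show ?thesis by (simp add: h_def)
  qed
  have lin: "linear h" unfolding h_def
    by (intro linearI) (simp_all add: inner_add_left add_divide_distrib scaleR_add_left sum.distrib scaleR_sum_right
        algebra_simps sum_distrib_left)
  have "h z \<bullet> h w = z \<bullet> w" for z w
  proof -
    have "(\<Sum>j<i. (z \<bullet> u j / 2) *\<^sub>R u j) \<bullet> h w = - (\<Sum>j<i. (z \<bullet> u j / 2) *\<^sub>R u j) \<bullet> w"
      unfolding inner_sum_left inner_minus_left sum_negf[symmetric]
      by (rule sum.cong) (simp_all add: hu inner_commute[of "u _"])
    then have a: "h z \<bullet> h w = z \<bullet> h w + (\<Sum>j<i. (z \<bullet> u j / 2) *\<^sub>R u j) \<bullet> w"
      unfolding h_def[of z] by (simp add: inner_diff_left)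
    have "z \<bullet> (\<Sum>j<i. (w \<bullet> u j / 2) *\<^sub>R u j) = (\<Sum>j<i. (z \<bullet> u j / 2) *\<^sub>R u j) \<bullet> w"
      unfolding inner_sum_left inner_sum_right by (rule sum.cong) (simp_all add: inner_commute)
    moreover have "z \<bullet> h w = z \<bullet> w - z \<bullet> (\<Sum>j<i. (w \<bullet> u j / 2) *\<^sub>R u j)" by (simp add: h_def inner_diff_right)
    ultimately show ?thesis using a by simp
  qed
  then have o: "orthogonal_transformation h" using lin by (simp add: orthogonal_transformation_def)
  have int: "\<exists>n::int. z \<bullet> u j = of_int n" if "z \<in> L" "j < i" for z j
    using even_groupD(2)[OF E that(1) u[OF that(2)]] by (auto elim: Ints_cases)
  define f where "f z = (\<lambda>j\<in>{..<i}. \<lfloor>z \<bullet> u j\<rfloor> mod 2)" for z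
  have "h ` L \<in> neighbours (elementary_2_group i) L"
  proof (rule neighbours_involution[OF L o hh elementary_2_group])
    show "f \<in> hom (additive_group L) (elementary_2_group i)"
    proof (rule homI)
      fix z assume "z \<in> carrier (additive_group L)"
      show "f z \<in> carrier (elementary_2_group i)" by (auto simp: elementary_2_group_simps f_def)
    next
      fix z w assume zw: "z \<in> carrier (additive_group L)" "w \<in> carrier (additive_group L)"
      have "\<lfloor>(z + w) \<bullet> u j\<rfloor> mod 2 = (\<lfloor>z \<bullet> u j\<rfloor> mod 2 + \<lfloor>w \<bullet> u j\<rfloor> mod 2) mod 2" if j: "j < i" for j
      proof -
        obtain m :: int where "z \<bullet> u j = of_int m" using int[OF _ j, of z] zw by auto
        moreover obtain n :: int where "w \<bullet> u j = of_int n" using int[OF _ j, of w] zw by auto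
        ultimately have mn: "z \<bullet> u j = of_int m" "w \<bullet> u j = of_int n" by simp_all
        then have "(z + w) \<bullet> u j = of_int (m + n)" by (simp add: inner_add_left)
        then show ?thesis using mn by (simp only: floor_of_int) (simp add: mod_simps)
      qed
      then show "f (z \<otimes>\<^bsub>additive_group L\<^esub> w) = f z \<otimes>\<^bsub>elementary_2_group i\<^esub> f w"
        by (auto simp: elementary_2_group_simps f_def fun_eq_iff)
    qed
    show "f ` L = carrier (elementary_2_group i)"
    proof
      show "f ` L \<subseteq> carrier (elementary_2_group i)"
        unfolding elementary_2_group_simps f_def by (auto split: if_splits)
      show "carrier (elementary_2_group i) \<subseteq> f ` L"
      proof
        fix v assume v: "v \<in> carrier (elementary_2_group i)"
        define z where "z = (\<Sum>j<i. of_int (v j) *\<^sub>R x j)"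
        have "z \<in> L" unfolding z_def by (rule sum_in) (use x in auto)
        moreover have "z \<bullet> u k = of_int (v k)" if "k < i" for k
        proof -
          have "z \<bullet> u k = (\<Sum>j<i. if j = k then of_int (v k) else 0)"
            unfolding z_def inner_sum_left by (rule sum.cong) (use xu that in auto)
          then show ?thesis using that by simp
        qed
        then have "f z = v" using v unfolding f_def elementary_2_group_simps
          by (intro ext) (auto simp: PiE_def Pi_def extensional_def)
        ultimately show "v \<in> f ` L" by blast
      qed
    qed
    fix z assume z: "z \<in> L"
    obtain n where n: "\<And>j. j < i \<Longrightarrow> z \<bullet> u j = of_int (n j)" using int[OF z] by metis
    have "f z = \<one>\<^bsub>elementary_2_group i\<^esub> \<longleftrightarrow> (\<forall>j<i. even (n j))"
      by (auto simp: elementary_2_group_simps f_def fun_eq_iff n even_iff_mod_2_eq_zero)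
    also have "\<dots> \<longleftrightarrow> h z \<in> L"
    proof
      assume "\<forall>j<i. even (n j)"
      then have "(\<Sum>j<i. (z \<bullet> u j / 2) *\<^sub>R u j) = (\<Sum>j<i. of_int (n j div 2) *\<^sub>R u j)"
        by (intro sum.cong) (auto simp: n elim!: evenE)
      then show "h z \<in> L" unfolding h_def using sum_in[OF order_refl u] by (auto intro!: subgrp_diff[OF s z])
    next
      assume "h z \<in> L"
      then have S: "(\<Sum>j<i. (z \<bullet> u j / 2) *\<^sub>R u j) \<in> L" using subgrp_diff[OF s z] unfolding h_def by fastforce
      show "\<forall>j<i. even (n j)"
      proof (intro allI impI)
        fix k assume k: "k < i"
        have "(\<Sum>j<i. (z \<bullet> u j / 2) *\<^sub>R u j) \<bullet> x k = (\<Sum>j<i. if j = k then of_int (n k) / 2 else 0)"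
          unfolding inner_sum_left by (rule sum.cong) (use xu k n in \<open>auto simp: inner_commute[of "u _"]\<close>)
        also have "\<dots> = of_int (n k) / of_int 2" using k by simp
        finally have e: "(\<Sum>j<i. (z \<bullet> u j / 2) *\<^sub>R u j) \<bullet> x k = of_int (n k) / of_int 2" .
        have "of_int (n k) / of_int 2 \<in> (\<int> :: real set)" using even_groupD(2)[OF E S x[OF k]] unfolding e .
        then show "even (n k)" by (simp only: of_int_div_Ints)
      qed
    qed
    finally show "f z = \<one>\<^bsub>elementary_2_group i\<^esub> \<longleftrightarrow> h z \<in> L" .
  qed
  then show ?thesis unfolding h_def .
qed

text \<open>The reflection in a vector of norm 8 has factor 2/8, so the image of z stays in
  \<open>L\<close> exactly when z.w is divisible by 4.\<close>

lemma neighbours_cyclic: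
  fixes w :: "real^'n"
  assumes L: "L \<in> even_lattices" and w: "w \<in> L" "w \<bullet> w = 8" and x: "x \<in> L" "x \<bullet> w = 1"
  shows "(\<lambda>z. z - (z \<bullet> w / 4) *\<^sub>R w) ` L \<in> neighbours (integer_mod_group 4) L"
proof -
  note E = even_lattices_even_group[OF L]
  note s = even_groupD(1)[OF E]
  let ?h = "\<lambda>z. z - (z \<bullet> w / 4) *\<^sub>R w"
  have o: "orthogonal_transformation ?h" unfolding orthogonal_transformation_def
    using w(2) by (auto intro!: linearI simp: inner_add_left inner_diff_left inner_diff_right inner_commute algebra_simps
        add_divide_distrib)
  have int: "\<exists>n::int. z \<bullet> w = of_int n" if "z \<in> L" for z
    using even_groupD(2)[OF E that w(1)] by (auto elim: Ints_cases)
  show ?thesis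
  proof (rule neighbours_involution[OF L o, where f = "\<lambda>z. \<lfloor>z \<bullet> w\<rfloor> mod 4"])
    show "?h (?h z) = z" for z using w(2) by (simp add: inner_diff_left algebra_simps)
    show "(\<lambda>z. \<lfloor>z \<bullet> w\<rfloor> mod 4) \<in> hom (additive_group L) (integer_mod_group 4)"
    proof (rule homI)
      fix z v assume zv: "z \<in> carrier (additive_group L)" "v \<in> carrier (additive_group L)"
      obtain m n :: int where mn: "z \<bullet> w = of_int m" "v \<bullet> w = of_int n" using int zv by fastforce
      then have "(z + v) \<bullet> w = of_int (m + n)" by (simp add: inner_add_left)
      then show "\<lfloor>(z \<otimes>\<^bsub>additive_group L\<^esub> v) \<bullet> w\<rfloor> mod 4 =
          (\<lfloor>z \<bullet> w\<rfloor> mod 4) \<otimes>\<^bsub>integer_mod_group 4\<^esub> (\<lfloor>v \<bullet> w\<rfloor> mod 4)"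
        using mn by (simp only: floor_of_int additive_group_simps) (simp add: mod_simps)
    qed (simp add: carrier_integer_mod_group)
    show "(\<lambda>z. \<lfloor>z \<bullet> w\<rfloor> mod 4) ` L = carrier (integer_mod_group 4)"
    proof
      show "carrier (integer_mod_group 4) \<subseteq> (\<lambda>z. \<lfloor>z \<bullet> w\<rfloor> mod 4) ` L"
      proof
        fix v assume v: "v \<in> carrier (integer_mod_group 4)"
        show "v \<in> (\<lambda>z. \<lfloor>z \<bullet> w\<rfloor> mod 4) ` L"
          by (rule image_eqI[of _ _ "of_int v *\<^sub>R x"]) (use v x(2) subgrp_int[OF s x(1)] in \<open>simp_all add: carrier_integer_mod_group\<close>)
      qed
    qed (auto simp: carrier_integer_mod_group)
    fix z assume z: "z \<in> L"
    obtain n :: int where n: "z \<bullet> w = of_int n" using int[OF z] by blast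
    show "\<lfloor>z \<bullet> w\<rfloor> mod 4 = \<one>\<^bsub>integer_mod_group 4\<^esub> \<longleftrightarrow> ?h z \<in> L"
    proof
      assume "\<lfloor>z \<bullet> w\<rfloor> mod 4 = \<one>\<^bsub>integer_mod_group 4\<^esub>"
      then obtain q where "n = 4 * q" using n by (auto elim: dvdE simp: mod_eq_0_iff_dvd)
      then have "z \<bullet> w / 4 = of_int q" using n by simp
      then have e: "?h z = z - of_int q *\<^sub>R w" by (simp only:)
      show "?h z \<in> L" unfolding e by (rule subgrp_diff[OF s z subgrp_int[OF s w(1)]])
    next
      assume "?h z \<in> L"
      then have "z - ?h z \<in> L" using subgrp_diff[OF s z] by blast
      then have "(z \<bullet> w / 4) *\<^sub>R w \<in> L" by simp
      from even_groupD(2)[OF E this x(1)] have "of_int n / of_int 4 \<in> (\<int> :: real set)"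
        using x(2) n by (simp add: inner_commute[of w])
      then have "4 dvd n" by (simp only: of_int_div_Ints)
      then show "\<lfloor>z \<bullet> w\<rfloor> mod 4 = \<one>\<^bsub>integer_mod_group 4\<^esub>" using n by simp
    qed
  qed simp
qed

section \<open>Actions of orthogonal groups\<close>

lemma orthogonal_transformation_matvec: "orthogonal_transformation (\<lambda>x. g *v x) \<longleftrightarrow> orthogonal_matrix g" for g :: "real^'n^'n"
  by (simp add: orthogonal_transformation_matrix matrix_of_matrix_vector_mul)

lemma orth_group_mem: "g \<in> carrier (orth_group L) \<longleftrightarrow> orthogonal_transformation (\<lambda>x. g *v x) \<and> (\<lambda>x. g *v x) ` L = L"
  by (simp add: orth_group_def orthogonal_transformation_matvec)

lemma special_orth_group_mem: "g \<in> carrier (special_orth_group L) \<longleftrightarrow> g \<in> carrier (orth_group L) \<and> det g = 1"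
  by (auto simp: orth_group_def special_orth_group_def rotation_matrix_def)

lemma matrix_image_transpose:
  fixes g :: "real^'n^'n"
  assumes "orthogonal_matrix g" "(\<lambda>x. g *v x) ` L = L" shows "(\<lambda>x. transpose g *v x) ` L = L"
proof -
  have "transpose g *v (g *v x) = x" for x
    using assms(1) by (simp add: matrix_vector_mul_assoc orthogonal_matrix)
  then have "(\<lambda>x. transpose g *v x) ` (\<lambda>x. g *v x) ` L = L" by (simp add: image_image)
  then show ?thesis using assms(2) by simp
qed

text \<open>Formulated for a set \<open>S\<close> of matrices so that O(L) and SO(L) share the
  argument, with the transpose as inverse.\<close>

lemma orth_subgroup_action:
  fixes L :: "(real^'n) set"
  assumes A: "group A" and S: "S \<subseteq> carrier (orth_group L)" "mat 1 \<in> S" "\<And>g h. g \<in> S \<Longrightarrow> h \<in> S \<Longrightarrow> g ** h \<in> S"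
    "\<And>g. g \<in> S \<Longrightarrow> transpose g \<in> S"
  shows "group_action \<lparr>carrier = S, monoid.mult = (\<lambda>g h. g ** h), one = mat 1\<rparr> (neighbours A L) (neighbour_action A L)"
proof -
  let ?G = "\<lparr>carrier = S, monoid.mult = (\<lambda>g h. g ** h), one = mat 1\<rparr>"
  let ?X = "neighbours A L"
  have G: "group ?G"
  proof (rule groupI)
    fix g assume "g \<in> carrier ?G"
    then show "\<exists>h\<in>carrier ?G. h \<otimes>\<^bsub>?G\<^esub> g = \<one>\<^bsub>?G\<^esub>"
      using S(1,4) by (intro bexI[of _ "transpose g"]) (auto simp: orth_group_def orthogonal_matrix)
  qed (use S in \<open>auto simp: matrix_mul_assoc\<close>)
  have cl: "(\<lambda>x. g *v x) ` N \<in> ?X" if "g \<in> S" "N \<in> ?X" for g N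
    using neighbours_image[OF A _ _ that(2), of "\<lambda>x. g *v x"] that(1) S(1) orth_group_mem[of g L] by auto
  have im: "(\<lambda>x. g *v x) ` (\<lambda>x. h *v x) ` N = (\<lambda>x. (g ** h) *v x) ` N" for g h :: "real^'n^'n" and N
    by (simp add: image_image matrix_vector_mul_assoc)
  have inv: "transpose g ** g = mat 1" "g ** transpose g = mat 1" if "g \<in> S" for g
    using that S(1) by (auto simp: orth_group_def orthogonal_matrix_def)
  have bij: "neighbour_action A L g \<in> Bij ?X" if g: "g \<in> S" for g
  proof -
    have "bij_betw (\<lambda>N. (\<lambda>x. g *v x) ` N) ?X ?X"
      by (rule bij_betw_byWitness[where f' = "\<lambda>N. (\<lambda>x. transpose g *v x) ` N"])
        (use g S(4) cl inv[OF g] in \<open>auto simp: im simp del: transpose_matrix_vector\<close>)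
    then have "bij_betw (neighbour_action A L g) ?X ?X" unfolding neighbour_action_def by (simp cong: bij_betw_cong)
    then show ?thesis by (simp add: Bij_def neighbour_action_def)
  qed
  have "neighbour_action A L \<in> hom ?G (BijGroup ?X)"
  proof (rule homI)
    show "neighbour_action A L g \<in> carrier (BijGroup ?X)" if "g \<in> carrier ?G" for g
      using bij that by (simp add: BijGroup_def)
    show "neighbour_action A L (g \<otimes>\<^bsub>?G\<^esub> h) = neighbour_action A L g \<otimes>\<^bsub>BijGroup ?X\<^esub> neighbour_action A L h"
      if "g \<in> carrier ?G" "h \<in> carrier ?G" for g h
      using bij cl that by (auto simp: BijGroup_def neighbour_action_def compose_def fun_eq_iff im)
  qed
  then show ?thesis using G group_BijGroup
    by (simp add: group_action_def group_hom_def group_hom_axioms_def)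
qed

lemma orth_group_action: "group A \<Longrightarrow> group_action (orth_group L) (neighbours A L) (neighbour_action A L)"
proof -
  assume A: "group A"
  have "group_action \<lparr>carrier = carrier (orth_group L), monoid.mult = (\<lambda>g h. g ** h), one = mat 1\<rparr>
    (neighbours A L) (neighbour_action A L)"
  proof (rule orth_subgroup_action[OF A order_refl])
    show "g ** h \<in> carrier (orth_group L)" if "g \<in> carrier (orth_group L)" "h \<in> carrier (orth_group L)" for g h
    proof -
      have "(\<lambda>x. g *v (h *v x)) ` L = L" using that by (auto simp: orth_group_def image_image[symmetric])
      then show ?thesis using that by (simp add: orth_group_def orthogonal_matrix_mul matrix_vector_mul_assoc)
    qed
  qed (auto simp: orth_group_def orthogonal_matrix_id matrix_image_transpose simp del: transpose_matrix_vector)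
  then show ?thesis by (simp add: orth_group_def)
qed

lemma special_orth_group_action: "group A \<Longrightarrow> group_action (special_orth_group L) (neighbours A L) (neighbour_action A L)"
proof -
  assume A: "group A"
  have "group_action \<lparr>carrier = carrier (special_orth_group L), monoid.mult = (\<lambda>g h. g ** h), one = mat 1\<rparr>
    (neighbours A L) (neighbour_action A L)"
  proof (rule orth_subgroup_action[OF A])
    show "g ** h \<in> carrier (special_orth_group L)"
      if "g \<in> carrier (special_orth_group L)" "h \<in> carrier (special_orth_group L)" for g h
    proof -
      have "(\<lambda>x. g *v (h *v x)) ` L = L" using that by (auto simp: special_orth_group_def image_image[symmetric])
      then show ?thesis using that
        by (simp add: special_orth_group_def rotation_matrix_def orthogonal_matrix_mul matrix_vector_mul_assoc det_mul)
    qed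
  qed (auto simp: special_orth_group_def orth_group_def rotation_matrix_def orthogonal_matrix_id matrix_image_transpose
      simp del: transpose_matrix_vector)
  then show ?thesis by (simp add: special_orth_group_def)
qed

lemma SO_transitiveI:
  fixes L :: "(real^'n) set"
  assumes A: "group A" and ne: "neighbours A L \<noteq> {}"
    and tr: "\<And>N N'. N \<in> neighbours A L \<Longrightarrow> N' \<in> neighbours A L \<Longrightarrow>
      \<exists>h. orthogonal_transformation h \<and> h ` L = L \<and> h ` N = N' \<and> det (matrix h) = 1"
  shows "SO_transitive_on_neighbours A L"
  unfolding SO_transitive_on_neighbours_def transitive_action_def transitive_action_axioms_def
proof (intro conjI allI impI ne special_orth_group_action A)
  fix N N' assume N: "N \<in> neighbours A L" "N' \<in> neighbours A L"
  obtain h where h: "orthogonal_transformation h" "h ` L = L" "h ` N = N'" "det (matrix h) = 1" using tr[OF N] by blast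
  have e: "(\<lambda>x. matrix h *v x) = h" using matrix_vector_mul(2)[OF orthogonal_transformation_linear[OF h(1)]] by simp
  have "matrix h \<in> carrier (special_orth_group L)" unfolding special_orth_group_mem orth_group_mem e using h by simp
  moreover have "neighbour_action A L (matrix h) N = N'" using N h(3) by (simp add: neighbour_action_def e)
  ultimately show "\<exists>g\<in>carrier (special_orth_group L). neighbour_action A L g N = N'" by blast
qed

section \<open>\<open>E\<^sub>8\<close> and \<open>E\<^sub>7\<close> as even lattices\<close>

lemma scalars_zero_independent:
  fixes b :: "'n::finite \<Rightarrow> 'a::real_vector"
  assumes z: "\<And>u i. (\<Sum>i\<in>UNIV. u i *\<^sub>R b i) = 0 \<Longrightarrow> u i = 0"
  shows "inj b" "independent (range b)"
proof -
  show i: "inj b"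
  proof (rule injI, rule ccontr)
    fix i j assume ij: "b i = b j" "i \<noteq> j"
    have "(\<Sum>k\<in>UNIV. (if k = i then 1 else if k = j then -1 else 0) *\<^sub>R b k)
        = (\<Sum>k\<in>UNIV. (if k = i then b i else 0) - (if k = j then b j else 0))"
      by (rule sum.cong) (use ij in auto)
    also have "\<dots> = 0" using ij(1) by (simp add: sum_subtractf)
    finally show False using z[of "\<lambda>k. if k = i then 1 else if k = j then -1 else 0" i] by simp
  qed
  show "independent (range b)"
  proof (rule independent_if_scalars_zero)
    fix f x assume f: "(\<Sum>x\<in>range b. f x *\<^sub>R x) = 0" "x \<in> range b"
    have "(\<Sum>i\<in>UNIV. f (b i) *\<^sub>R b i) = 0" using f(1) by (simp add: sum.reindex[OF i])
    from z[OF this] show "f x = 0" using f(2) by auto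
  qed simp
qed

text \<open>Avoids expanding a determinant: the two Gram determinants are integers with product 1,
  and the first is the square of a real number, so it is 1.\<close>

lemma dual_bases:
  fixes b d :: "'n::finite \<Rightarrow> real^'n"
  assumes L: "even_group L" and b: "\<And>i. b i \<in> L" and d: "\<And>i. d i \<in> L"
    and bd: "\<And>i j. b i \<bullet> d j = (if i = j then 1 else 0)"
  shows "lattice_basis b L" "det (gram_matrix b) = 1" "x = (\<Sum>i\<in>UNIV. (x \<bullet> d i) *\<^sub>R b i)"
proof -
  let ?B = "(\<chi> i. b i) :: real^'n^'n" and ?D = "(\<chi> i. d i) :: real^'n^'n"
  have BD: "?B ** transpose ?D = mat 1"
    by (simp add: vec_eq_iff matrix_matrix_mult_def transpose_def mat_def bd flip: inner_vec_def[where 'a=real, simplified])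
  then have DB: "transpose ?D ** ?B = mat 1" by (simp add: matrix_left_right_inverse)
  show ex: "x = (\<Sum>i\<in>UNIV. (x \<bullet> d i) *\<^sub>R b i)" for x
  proof -
    have e: "(\<Sum>i\<in>UNIV. d i $ j * b i $ k) = (if j = k then 1 else 0)" for j k
      using arg_cong[OF DB, of "\<lambda>M. M $ j $ k"] by (simp add: matrix_matrix_mult_def transpose_def mat_def)
    have "(\<Sum>i\<in>UNIV. (x \<bullet> d i) *\<^sub>R b i) $ k = x $ k" for k
    proof -
      have "(\<Sum>i\<in>UNIV. (x \<bullet> d i) *\<^sub>R b i) $ k = (\<Sum>i\<in>UNIV. \<Sum>j\<in>UNIV. x $ j * (d i $ j * b i $ k))"
        by (simp add: inner_vec_def sum_distrib_right mult.assoc)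
      also have "\<dots> = (\<Sum>j\<in>UNIV. \<Sum>i\<in>UNIV. x $ j * (d i $ j * b i $ k))" by (rule sum.swap)
      also have "\<dots> = (\<Sum>j\<in>UNIV. x $ j * (if j = k then 1 else 0))" by (simp only: sum_distrib_left[symmetric] e)
      also have "\<dots> = (\<Sum>j\<in>UNIV. if j = k then x $ k else 0)" by (rule sum.cong) auto
      finally show ?thesis by simp
    qed
    then show ?thesis by (simp add: vec_eq_iff)
  qed
  have z: "u i = 0" if "(\<Sum>i\<in>UNIV. u i *\<^sub>R b i) = 0" for u i
  proof -
    have "(\<Sum>j\<in>UNIV. u j *\<^sub>R b j) \<bullet> d i = (\<Sum>j\<in>UNIV. if j = i then u i else 0)"
      unfolding inner_sum_left by (rule sum.cong) (auto simp: bd)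
    then show ?thesis using that by simp
  qed
  note s = even_groupD(1)[OF L]
  have sum_in: "(\<Sum>i\<in>A. of_int (c i) *\<^sub>R b i) \<in> L" if "finite A" for A and c :: "'n \<Rightarrow> int"
    using that by (induction A) (auto intro: subgrp_0[OF s] subgrp_add[OF s] subgrp_int[OF s] b)
  have "inj b" "independent (range b)" using scalars_zero_independent[of b] z by blast+
  then show "lattice_basis b L" unfolding lattice_basis_def
  proof (intro conjI equalityI subsetI)
    fix x assume x: "x \<in> L"
    have "\<forall>i. \<exists>c::int. x \<bullet> d i = of_int c" using even_groupD(2)[OF L x d] by (auto elim: Ints_cases)
    then obtain c :: "'n \<Rightarrow> int" where "\<And>i. x \<bullet> d i = of_int (c i)" by metis
    then have "x = (\<Sum>i\<in>UNIV. of_int (c i) *\<^sub>R b i)" using ex[of x] by simp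
    then show "x \<in> {\<Sum>i\<in>UNIV. of_int (c i) *\<^sub>R b i | c. True}" by blast
  qed (use sum_in in auto)
  have pos: "det (gram_matrix e) = det (\<chi> i. e i) * det (\<chi> i. e i)" for e :: "'n \<Rightarrow> real^'n"
    by (simp add: gram_matrix_eq det_mul)
  have "det ?B * det ?D = 1" using arg_cong[OF BD, of det] by (simp add: det_mul)
  then have "det (gram_matrix b) * det (gram_matrix d) = 1" unfolding pos by (metis mult.assoc mult.commute mult_1)
  moreover have "det (gram_matrix b) \<in> \<int>" "det (gram_matrix d) \<in> \<int>"
    using even_groupD(2)[OF L] b d by (auto intro!: det_Ints simp: gram_matrix_def)
  then obtain m n :: int where mn: "det (gram_matrix b) = of_int m" "det (gram_matrix d) = of_int n"
    by (auto elim!: Ints_cases)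
  ultimately have "m * n = 1" by (metis of_int_eq_1_iff of_int_mult)
  moreover have "0 \<le> m" using pos[of b] mn(1) by (metis of_int_0_le_iff zero_le_square)
  ultimately have "m = 1" by (auto simp: zmult_eq_1_iff)
  then show "det (gram_matrix b) = 1" using mn(1) by simp
qed

text \<open>A basis adapted to a particular \<open>(\<int>/2)\<^sup>4\<close>-neighbour: the first four vectors pair to the identity
  modulo \<open>4\<close> with the last four, and the halves of the latter belong to the neighbour.\<close>

definition E8_basis :: "8 \<Rightarrow> real^8" where
  "E8_basis i = hv ([[2,6,0,4,12,-6,-8,-2], [3,1,1,9,23,-9,-7,-1], [-3,7,1,13,5,-1,1,9], [-3,-1,-1,-3,-15,5,7,3],
     [2,0,-2,0,2,4,2,0], [-2,-4,0,2,0,2,-2,0], [-4,-2,-6,-4,4,2,-2,0], [0,0,4,0,-2,2,-6,-2]] ! pos8 i)"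

text \<open>The inverse transpose of the matrix of \<open>E8_basis\<close>. That its rows lie in E8
  certifies that \<open>E8_basis\<close> generates E8.\<close>

definition E8_dual_basis :: "8 \<Rightarrow> real^8" where
  "E8_dual_basis i = hv ([[1482,-600,-586,-352,-366,-356,-990,1808], [11286,-4572,-4456,-2686,-2784,-2710,-7538,13776],
     [-2740,1110,1082,652,676,658,1830,-3344], [17616,-7136,-6956,-4192,-4346,-4230,-11766,21502],
     [2968,-1202,-1172,-706,-732,-712,-1982,3622], [-5227,2117,2063,1245,1289,1255,3491,-6381],
     [2145,-869,-847,-511,-529,-515,-1433,2619], [6969,-2823,-2751,-1659,-1719,-1673,-4655,8507]] ! pos8 i)"

lemma E8_bases:
  "E8_basis i \<in> E8" "E8_dual_basis i \<in> E8" "E8_basis i \<bullet> E8_dual_basis j = (if i = j then 1 else 0)"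
proof -
  have "\<forall>i. E8_basis i \<in> E8" unfolding forall_8 E8_basis_def by (simp add: hv_E8)
  then show "E8_basis i \<in> E8" by blast
  have "\<forall>i. E8_dual_basis i \<in> E8" unfolding forall_8 E8_dual_basis_def by (simp add: hv_E8)
  then show "E8_dual_basis i \<in> E8" by blast
  have "\<forall>i j. E8_basis i \<bullet> E8_dual_basis j = (if i = j then 1 else 0)"
    unfolding forall_8 E8_basis_def E8_dual_basis_def by (simp add: hv_inner)
  then show "E8_basis i \<bullet> E8_dual_basis j = (if i = j then 1 else 0)" by blast
qed

lemma E8_even_lattices: "E8 \<in> even_lattices"
  using dual_bases(1,2)[OF even_group_E8 E8_bases] lattice_det_eq even_group_E8
  unfolding even_lattices_def even_lattice_def is_lattice_def even_group_def even_norm_def by fastforce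

section \<open>The lattice E7\<close>

lemma exhaust_7: "x = 1 \<or> x = 2 \<or> x = 3 \<or> x = 4 \<or> x = 5 \<or> x = 6 \<or> x = 7" for x :: 7
proof (induct x)
  case (of_int z)
  then have "z \<in> {0..<7}" by simp
  then have "z = 0 \<or> z = 1 \<or> z = 2 \<or> z = 3 \<or> z = 4 \<or> z = 5 \<or> z = 6" by auto
  then show ?case by auto
qed

lemma forall_7: "(\<forall>i::7. P i) \<longleftrightarrow> P 1 \<and> P 2 \<and> P 3 \<and> P 4 \<and> P 5 \<and> P 6 \<and> P 7"
  by (metis exhaust_7)

lemma UNIV_7: "(UNIV :: 7 set) = {7, 1, 2, 3, 4, 5, 6}"
proof -
  have "x \<in> {7, 1, 2, 3, 4, 5, 6}" for x :: 7
    unfolding insert_iff using exhaust_7[of x] by blast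
  then show ?thesis by (rule UNIV_eq_I)
qed

text \<open>The order on the type \<open>7\<close> starts with \<open>7 = 0\<close>.\<close>

definition pos7 :: "7 \<Rightarrow> nat" where
  "pos7 i = (if i = 7 then 0 else if i = 1 then 1 else if i = 2 then 2 else if i = 3 then 3
     else if i = 4 then 4 else if i = 5 then 5 else 6)"

lemma pos7_simps [simp]:
  "pos7 1 = 1" "pos7 2 = 2" "pos7 3 = 3" "pos7 4 = 4" "pos7 5 = 5" "pos7 6 = 6" "pos7 7 = 0"
  by (simp_all add: pos7_def)

lemma sum_7: "sum f (UNIV :: 7 set) = f 7 + (f 1 + (f 2 + (f 3 + (f 4 + (f 5 + f 6)))))"
  unfolding UNIV_7 by simp

lemma prod_7: "prod f (UNIV :: 7 set) = f 7 * (f 1 * (f 2 * (f 3 * (f 4 * (f 5 * f 6)))))"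
  unfolding UNIV_7 by simp

text \<open>Simple roots for the diagram E_7: a path of six nodes, with the last vector attached to
  the third node. Their Gram matrix is the Cartan matrix.\<close>

definition E7_basis :: "7 \<Rightarrow> real^8" where
  "E7_basis i = hv ([[0,2,-2,0,0,0,0,0], [0,0,2,-2,0,0,0,0], [0,0,0,2,-2,0,0,0], [0,0,0,0,2,-2,0,0],
     [0,0,0,0,0,2,-2,0], [0,0,0,0,0,0,2,-2], [-1,-1,-1,-1,1,1,1,1]] ! pos7 i)"

text \<open>Together with \<open>E7_upper\<close> this is the LU factorisation of the Cartan matrix
  of E_7; the pivots 2, 3/2, 4/3, 5/4, 6/5, 7/6, 2/7 multiply to 2.\<close>

definition E7_lower :: "real^7^7" where
  "E7_lower = (\<chi> i j. [[1,0,0,0,0,0,0], [-1/2,1,0,0,0,0,0], [0,-2/3,1,0,0,0,0], [0,0,-3/4,1,0,0,0],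
     [0,0,0,-4/5,1,0,0], [0,0,0,0,-5/6,1,0], [0,0,-3/4,-3/5,-1/2,-3/7,1]] ! pos7 i ! pos7 j)"

definition E7_upper :: "real^7^7" where
  "E7_upper = (\<chi> i j. [[2,-1,0,0,0,0,0], [0,3/2,-1,0,0,0,0], [0,0,4/3,-1,0,0,-1], [0,0,0,5/4,-1,0,-3/4],
     [0,0,0,0,6/5,-1,-3/5], [0,0,0,0,0,7/6,-1/2], [0,0,0,0,0,0,2/7]] ! pos7 i ! pos7 j)"

lemma E7_gram_det: "det ((\<chi> i j. E7_basis i \<bullet> E7_basis j) :: real^7^7) = 2"
proof -
  have e: "((\<chi> i j. E7_basis i \<bullet> E7_basis j) :: real^7^7) = E7_lower ** E7_upper"
    unfolding vec_eq_iff forall_7 matrix_matrix_mult_def E7_lower_def E7_upper_def E7_basis_def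
    by (simp add: hv_inner sum_7)
  have "\<forall>i j::7. i < j \<longrightarrow> E7_lower $ i $ j = 0"
    unfolding forall_7 E7_lower_def by (simp add: less_bit1_def bit1.Rep_numeral bit1.Rep_1)
  then have "det E7_lower = (\<Prod>i\<in>UNIV. E7_lower $ i $ i)" by (intro det_lowerdiagonal) blast
  then have l: "det E7_lower = 1" by (simp add: prod_7 E7_lower_def)
  have "\<forall>i j::7. i > j \<longrightarrow> E7_upper $ i $ j = 0"
    unfolding forall_7 E7_upper_def by (simp add: less_bit1_def bit1.Rep_numeral bit1.Rep_1)
  then have "det E7_upper = (\<Prod>i\<in>UNIV. E7_upper $ i $ i)" by (intro det_upperdiagonal) blast
  then have u: "det E7_upper = 2" by (simp add: prod_7 E7_upper_def)
  show ?thesis unfolding e det_mul l u by simp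
qed

lemma E7_iff: "x \<in> E7 \<longleftrightarrow> x \<in> E8 \<and> x \<bullet> half_ones = 0"
proof -
  have "x \<bullet> half_ones = (\<Sum>i\<in>UNIV. x $ i) / 2" by (simp add: inner_vec_def half_ones_def sum_divide_distrib)
  then have "(\<Sum>i\<in>UNIV. x $ i) = 0 \<longleftrightarrow> x \<bullet> half_ones = 0" by (simp only:) simp
  then show ?thesis by (simp add: E7_def)
qed

lemma half_ones_root: "half_ones \<in> E8" "half_ones \<bullet> half_ones = 2"
  unfolding half_ones_qv qv_E8 qv_inner by simp_all

lemma subgrp_E7: "subgrp E7"
  using even_groupD(1)[OF even_group_E8] by (auto simp: subgrp_def E7_iff inner_diff_left)

lemma E7_basis_mem: "E7_basis i \<in> E7"
proof -
  have "\<forall>i. E7_basis i \<in> E7" unfolding forall_7 E7_basis_def E7_iff half_ones_qv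
    by (simp add: hv_E8) (simp add: hv_qv qv_inner)
  then show ?thesis by blast
qed

lemma E7_combination:
  assumes "x \<in> E7" obtains c :: "7 \<Rightarrow> int" where "x = (\<Sum>i\<in>UNIV. of_int (c i) *\<^sub>R E7_basis i)"
proof -
  have x: "x \<in> E8" "x \<bullet> half_ones = 0" using assms by (simp_all add: E7_iff)
  obtain m a b c d e f g h k where
    x': "x = qv [2*m+4*a, 2*m+4*b, 2*m+4*c, 2*m+4*d, 2*m+4*e, 2*m+4*f, 2*m+4*g, 2*m+4*h]"
    and k: "a + b + c + d + e + f + g + h = 2 * k" using E8_paramE[OF x(1)] .
  have "real_of_int ((2*m+4*a)*2+(2*m+4*b)*2+(2*m+4*c)*2+(2*m+4*d)*2+(2*m+4*e)*2+(2*m+4*f)*2+(2*m+4*g)*2+(2*m+4*h)*2) = of_int 0"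
    using x(2) unfolding x' half_ones_qv qv_inner by simp
  then have "(2*m+4*a)*2+(2*m+4*b)*2+(2*m+4*c)*2+(2*m+4*d)*2+(2*m+4*e)*2+(2*m+4*f)*2+(2*m+4*g)*2+(2*m+4*h)*2 = 0"
    by (simp only: of_int_eq_iff)
  then have h: "h = - 4 * m - a - b - c - d - e - f - g" by simp
  \<comment> \<open>Only the last basis vector has a nonzero first coordinate, which forces its
    coefficient -m-2a; the following coordinates determine the other coefficients in turn.\<close>
  define C where "C i = [b-a, b+c-2*a, b+c+d-3*a, b+c+d+e-2*a+m, b+c+d+e+f-a+2*m, b+c+d+e+f+g+3*m, -m-2*a] ! pos7 i" for i
  show ?thesis
  proof (rule that[of C])
    show "x = (\<Sum>i\<in>UNIV. of_int (C i) *\<^sub>R E7_basis i)"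
      unfolding sum_7 C_def E7_basis_def x' h by (simp add: vec_eq_iff forall_8 hv_qv field_simps)
  qed
qed

lemma E7_even_lattices:
  assumes "hyperplane_isometry \<iota>" shows "\<iota> -` E7 \<in> even_lattices"
proof -
  have l: "linear \<iota>" and i: "\<And>x y. \<iota> x \<bullet> \<iota> y = x \<bullet> y" and r: "range \<iota> = {x. x \<bullet> half_ones = 0}"
    using assms by (auto simp: hyperplane_isometry_def)
  have "\<forall>k. \<exists>z. \<iota> z = E7_basis k" using r E7_basis_mem by (auto simp: E7_iff set_eq_iff image_iff) metis
  then obtain b where b: "\<And>k. \<iota> (b k) = E7_basis k" by metis
  have G: "gram_matrix b = (\<chi> i j. E7_basis i \<bullet> E7_basis j)" by (simp add: gram_matrix_def flip: b i)
  have d2: "det (gram_matrix b) = 2" unfolding G by (rule E7_gram_det)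
  then have dB: "det (\<chi> i. b i) \<noteq> 0" by (auto simp: gram_matrix_eq det_mul)
  have inj: "x = y" if "\<iota> x = \<iota> y" for x y
  proof -
    have "(x - y) \<bullet> (x - y) = 0" using that unfolding i[symmetric] by (simp add: linear_diff[OF l])
    then show ?thesis by simp
  qed
  have z: "u k = 0" if "(\<Sum>k\<in>UNIV. u k *\<^sub>R b k) = 0" for u k
  proof -
    \<comment> \<open>Replacing row \<open>k\<close> by the vanishing combination multiplies the
      nonzero determinant by \<open>u k\<close>, which gives independence.\<close>
    let ?C = "(\<chi> i. if i = k then (\<Sum>k\<in>UNIV. u k *\<^sub>R b k) else b i) :: real^7^7"
    have "det ?C = u k * det (\<chi> i. b i)"
      using cramer_lemma_transpose[of k "\<chi> i. u i" "\<chi> i. b i"]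
      by (simp add: row_def scalar_mult_eq_scaleR cong: if_cong)
    moreover have "det ?C = 0" by (rule det_zero_row(1)[of k]) (simp add: row_def that vec_eq_iff)
    ultimately show ?thesis using dB by simp
  qed
  have sum: "\<iota> (\<Sum>k\<in>UNIV. of_int (c k) *\<^sub>R b k) = (\<Sum>k\<in>UNIV. of_int (c k) *\<^sub>R E7_basis k)" for c :: "7 \<Rightarrow> int"
    by (simp add: linear_sum[OF l] linear_scale[OF l] b)
  have sum_in: "(\<Sum>k\<in>A. of_int (c k) *\<^sub>R E7_basis k) \<in> E7" if "finite A" for A and c :: "7 \<Rightarrow> int"
    using that by (induction A) (auto intro: subgrp_0 subgrp_add subgrp_int subgrp_E7 E7_basis_mem)
  have "inj b" "independent (range b)" using scalars_zero_independent[of b] z by blast+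
  then have lb: "lattice_basis b (\<iota> -` E7)" unfolding lattice_basis_def
  proof (intro conjI equalityI subsetI)
    fix x assume "x \<in> \<iota> -` E7"
    then obtain c :: "7 \<Rightarrow> int" where "\<iota> x = (\<Sum>k\<in>UNIV. of_int (c k) *\<^sub>R E7_basis k)" using E7_combination by auto
    then have "x = (\<Sum>k\<in>UNIV. of_int (c k) *\<^sub>R b k)" unfolding sum[symmetric] by (rule inj)
    then show "x \<in> {\<Sum>k\<in>UNIV. of_int (c k) *\<^sub>R b k | c. True}" by blast
  next
    fix x assume "x \<in> {\<Sum>k\<in>UNIV. of_int (c k) *\<^sub>R b k | c. True}"
    then show "x \<in> \<iota> -` E7" using sum sum_in[of UNIV] by auto
  qed
  have "is_lattice (\<iota> -` E7)" using lb unfolding is_lattice_def by blast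
  moreover have "lattice_det (\<iota> -` E7) = 2" using lattice_det_eq[OF lb] d2 by simp
  moreover have "x \<bullet> y \<in> \<int>" if "x \<in> \<iota> -` E7" "y \<in> \<iota> -` E7" for x y
    using that even_groupD(2)[OF even_group_E8, of "\<iota> x" "\<iota> y"] by (simp add: E7_iff i)
  moreover have "even_norm x" if "x \<in> \<iota> -` E7" for x
    using that even_groupD(3)[OF even_group_E8, of "\<iota> x"] by (simp add: E7_iff even_norm_def i)
  ultimately show ?thesis by (simp add: even_lattices_def even_lattice_def even_norm_def)
qed

section \<open>Determinants of orthogonal transformations\<close>

text \<open>An orthogonal matrix carrying a unit vector of the standard basis to the normalised
  \<open>r\<close> conjugates the reflection to a diagonal matrix with a single -1.\<close>

lemma det_refln:
  fixes r :: "real^'n"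
  assumes r: "r \<bullet> r = 2" shows "det (matrix (refln r)) = -1"
proof -
  obtain k :: 'n where True by simp
  let ?s = "sqrt 2"
  have "norm r = ?s" using r by (simp add: norm_eq_sqrt_inner)
  then have "norm (r /\<^sub>R ?s) = 1" by simp
  then obtain A :: "real^'n^'n" where A: "orthogonal_matrix A" "A *v axis k 1 = r /\<^sub>R ?s"
    using orthogonal_matrix_exists_basis[of "r /\<^sub>R ?s" k] by blast
  define D :: "real^'n^'n" where "D = (\<chi> i j. if i = j then (if i = k then -1 else 1) else 0)"
  have Ak: "r = ?s *\<^sub>R (A *v axis k 1)" using A(2) by simp
  have o: "orthogonal_transformation (\<lambda>v. A *v v)" using A(1) by (simp add: orthogonal_transformation_matvec)
  have Dv: "D *v v = v - (2 * v $ k) *\<^sub>R axis k 1" for v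
  proof -
    have "(D *v v) $ i = (v - (2 * v $ k) *\<^sub>R axis k 1) $ i" for i
    proof -
      have "(D *v v) $ i = (\<Sum>j\<in>UNIV. D $ i $ j * v $ j)" by (simp add: matrix_vector_mult_def)
      also have "\<dots> = (\<Sum>j\<in>UNIV. if i = j then (if i = k then - v $ i else v $ i) else 0)"
        by (rule sum.cong) (auto simp: D_def)
      finally show ?thesis by (simp add: axis_def)
    qed
    then show ?thesis by (simp add: vec_eq_iff)
  qed
  have lin: "linear (refln r)" using refln_orth[OF r] orthogonal_transformation_linear by blast
  have "refln r (A *v v) = A *v (D *v v)" for v
  proof -
    have "(A *v v) \<bullet> r = ?s * v $ k"
      unfolding Ak inner_scaleR_right orth_simps(3)[OF o] by (simp add: inner_axis)
    then show ?thesis unfolding refln_def Dv Ak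
      by (simp add: matrix_vector_mult_diff_distrib matrix_vector_mult_scaleR)
  qed
  then have "(matrix (refln r) ** A) *v v = (A ** D) *v v" for v
    using matrix_vector_mul(2)[OF lin] by (simp add: fun_eq_iff flip: matrix_vector_mul_assoc)
  then have "matrix (refln r) ** A = A ** D" by (simp add: matrix_eq)
  then have "det (matrix (refln r)) * det A = det A * det D" by (metis det_mul)
  moreover have "det A \<noteq> 0" using det_orthogonal_matrix[OF A(1)] by auto
  moreover have "det D = -1"
  proof -
    have "det D = (\<Prod>i\<in>UNIV. D $ i $ i)" by (rule det_diagonal) (simp add: D_def)
    also have "\<dots> = -1" by (simp add: D_def)
    finally show ?thesis .
  qed
  ultimately show ?thesis by (metis mult.commute mult_cancel_left)
qed

lemma det_matrix_compose:
  fixes f g :: "real^'n \<Rightarrow> real^'n"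
  assumes "orthogonal_transformation f" "orthogonal_transformation g"
  shows "det (matrix (g \<circ> f)) = det (matrix g) * det (matrix f)"
  using matrix_compose[OF orthogonal_transformation_linear[OF assms(1)] orthogonal_transformation_linear[OF assms(2)]]
  by (simp add: det_mul)

lemma det_orth_cases:
  fixes g :: "real^'n \<Rightarrow> real^'n"
  assumes "orthogonal_transformation g" shows "det (matrix g) = 1 \<or> det (matrix g) = -1"
  using assms det_orthogonal_matrix orthogonal_transformation_matrix by blast

lemma orth_inverse:
  fixes h :: "real^'n \<Rightarrow> real^'n"
  assumes "orthogonal_transformation h"
  obtains k where "orthogonal_transformation k" "\<And>x. k (h x) = x" "\<And>x. h (k x) = x"
proof -
  have i: "inj h" and s: "surj h" using assms orthogonal_transformation_inj orthogonal_transformation_surj by auto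
  show ?thesis by (rule that[of "inv_into UNIV h"])
      (use assms i s orthogonal_transformation_inv in \<open>auto simp: inv_f_f surj_f_inv_f\<close>)
qed

lemma orth_connect:
  fixes h h' :: "real^'n \<Rightarrow> real^'n"
  assumes h: "orthogonal_transformation h" "h ` L = L" "h ` N = P" "h x = a"
    and h': "orthogonal_transformation h'" "h' ` L = L" "h' ` N' = P" "h' x' = a"
  obtains g where "orthogonal_transformation g" "g ` L = L" "g ` N = N'" "g x = x'"
proof -
  obtain k where k: "orthogonal_transformation k" "\<And>x. k (h' x) = x" using orth_inverse[OF h'(1)] by metis
  have kL: "k ` h' ` A = A" for A using k(2) by (simp add: image_image)
  show ?thesis
  proof (rule that[of "k \<circ> h"])
    show "orthogonal_transformation (k \<circ> h)" using orthogonal_transformation_compose[OF k(1) h(1)] .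
    show "(k \<circ> h) ` L = L" unfolding image_comp[symmetric] h(2) using kL[of L] h'(2) by simp
    show "(k \<circ> h) ` N = N'" unfolding image_comp[symmetric] h(3) using kL[of N'] h'(3) by simp
    show "(k \<circ> h) x = x'" using h(4) k(2)[of x'] h'(4) by simp
  qed
qed

lemma special_connect:
  fixes g :: "real^'n \<Rightarrow> real^'n"
  assumes g: "orthogonal_transformation g" "g ` L = L" "g ` N = N'"
    and E: "even_group L" "even_group N" and r: "r \<in> L" "r \<in> N" "r \<bullet> r = 2"
  shows "\<exists>h. orthogonal_transformation h \<and> h ` L = L \<and> h ` N = N' \<and> det (matrix h) = 1"
proof (cases "det (matrix g) = 1")
  case True then show ?thesis using g by blast
next
  case False
  then have d: "det (matrix g) = -1" using det_orth_cases[OF g(1)] by simp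
  let ?h = "g \<circ> refln r"
  have "orthogonal_transformation ?h" using orthogonal_transformation_compose[OF g(1) refln_orth[OF r(3)]] .
  moreover have "?h ` L = L" by (rule comp_image[OF refln_image[OF E(1) r(1,3)] g(2)])
  moreover have "?h ` N = N'" by (rule comp_image[OF refln_image[OF E(2) r(2,3)] g(3)])
  moreover have "det (matrix ?h) = 1" using det_matrix_compose[OF refln_orth[OF r(3)] g(1)] d det_refln[OF r(3)] by simp
  ultimately show ?thesis by blast
qed

section \<open>Neighbours of \<open>E\<^sub>8\<close>\<close>

lemma subgrp_UNIV: "subgrp UNIV"
  by (simp add: subgrp_def)

lemma E8_neighbour_chain:
  assumes N: "N \<in> neighbours (elementary_2_group i) E8"
  shows "\<exists>ys. length ys = i \<and> nbr_chain E8 ys \<and> N = nbrs E8 ys"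
proof -
  obtain f where f: "\<And>x y j. x \<in> N \<Longrightarrow> y \<in> N \<Longrightarrow> j < i \<Longrightarrow> f (x + y) j = (f x j + f y j :: int) mod 2"
    "\<And>x. x \<in> N \<Longrightarrow> (\<forall>j<i. f x j = 0) \<longleftrightarrow> x \<in> E8"
    "\<And>k. k < i \<Longrightarrow> \<exists>y\<in>N. \<forall>j<i. f y j = (if j = k then 1 else 0)"
  proof (rule neighbour_parities[OF N], goal_cases)
    case (1 f)
    show ?case by (rule 1(1)[OF 1(2-4)])
  qed
  have NL: "N \<in> even_lattices" using N by (simp add: neighbours_def)
  have "\<exists>ys. length ys = i \<and> nbr_chain E8 ys \<and> set ys \<subseteq> N \<and> N = nbrs E8 ys \<inter> UNIV"
    by (rule chain_exists[OF even_group_E8 even_lattices_even_group[OF NL] _ subgrp_UNIV _ f])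
      (auto intro: even_lattices_maximal[OF NL] even_groupD(2)[OF even_group_E8])
  then show ?thesis by auto
qed

lemma E8_neighbour_cyclic:
  assumes N: "N \<in> neighbours (integer_mod_group 4) E8"
  shows "\<exists>y. N = nbr E8 y \<and> even_norm y \<and> 4 *\<^sub>R y \<in> E8 \<and> 2 *\<^sub>R y \<notin> E8"
proof -
  obtain f where f: "\<And>x y. x \<in> N \<Longrightarrow> y \<in> N \<Longrightarrow> f (x + y) = (f x + f y :: int) mod 4"
    "\<And>x. x \<in> N \<Longrightarrow> f x = 0 \<longleftrightarrow> x \<in> E8" "\<exists>y\<in>N. f y = 1"
  proof (rule neighbour_residues[OF N], goal_cases)
    case (1 f)
    show ?case by (rule 1(1)[OF 1(2-4)])
  qed
  have NL: "N \<in> even_lattices" using N by (simp add: neighbours_def)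
  have "\<exists>y\<in>N. N = nbr E8 y \<inter> UNIV \<and> even_norm y \<and> 4 *\<^sub>R y \<in> E8 \<and> 2 *\<^sub>R y \<notin> E8"
    by (rule cyclic_exists[OF even_group_E8 even_lattices_even_group[OF NL] _ subgrp_UNIV _ f])
      (auto intro: even_lattices_maximal[OF NL] even_groupD(2)[OF even_group_E8])
  then show ?thesis by auto
qed

text \<open>\<open>E8_flip i\<close> below is the product of the reflections in the pairwise orthogonal vectors \<open>E8_u j\<close> of norm \<open>4\<close>.
  The vectors \<open>E8_x j\<close> are dual to them, so that \<open>z \<mapsto> (z \<bullet> E8_u j mod 2)\<^sub>j\<close> is onto.\<close>

definition E8_u :: "nat \<Rightarrow> real^8" where
  "E8_u j = hv ([[0,0,0,0,0,0,0,4], [2,2,2,2,0,0,0,0], [2,-2,0,0,2,2,0,0], [2,0,-2,0,-2,0,2,0]] ! j)"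

definition E8_x :: "nat \<Rightarrow> real^8" where
  "E8_x j = hv ([[1,1,-1,-1,1,-1,-1,1], [0,2,0,0,0,2,0,0], [0,-2,0,2,0,0,0,0], [0,0,-2,2,0,0,0,0]] ! j)"

lemma less_4_cases: "j < 4 \<Longrightarrow> j = 0 \<or> j = Suc 0 \<or> j = 2 \<or> j = 3" for j :: nat
  by auto

definition E8_flip :: "nat \<Rightarrow> real^8 \<Rightarrow> real^8" where
  "E8_flip i z = z - (\<Sum>j<i. (z \<bullet> E8_u j / 2) *\<^sub>R E8_u j)"

lemma E8_flip_neighbour:
  assumes "i \<le> 4" shows "E8_flip i ` E8 \<in> neighbours (elementary_2_group i) E8"
proof -
  have 1: "E8_u j \<in> E8" "E8_x j \<in> E8" if "j < 4" for j
    using less_4_cases[OF that] by (elim disjE; simp add: E8_u_def E8_x_def hv_E8)+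
  have 2: "E8_u j \<bullet> E8_u k = (if j = k then 4 else 0)" "E8_x k \<bullet> E8_u j = (if j = k then 1 else 0)" if "j < 4" "k < 4" for j k
    using less_4_cases[OF that(1)] less_4_cases[OF that(2)]
    by (elim disjE; simp add: E8_u_def E8_x_def hv_inner)+
  show ?thesis unfolding E8_flip_def[abs_def]
    by (rule neighbours_elementary[OF E8_even_lattices, where x = E8_x]) (use 1 2 assms in auto)
qed

lemma E8_elementary_transitive:
  assumes i: "i \<in> {1,2,3}"
  shows "SO_transitive_on_neighbours (elementary_2_group i) E8"
proof (rule SO_transitiveI[OF elementary_2_group])
  show "neighbours (elementary_2_group i) E8 \<noteq> {}" using E8_flip_neighbour[of i] i by auto
  obtain P where P: "\<And>ys x. nbr_chain E8 ys \<Longrightarrow> length ys = i \<Longrightarrow> x \<in> E8 \<Longrightarrow> x \<bullet> x = 2 \<Longrightarrow> \<forall>y\<in>set ys. x \<bullet> y \<in> \<int> \<Longrightarrow>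
    \<exists>h. orthogonal_transformation h \<and> h ` E8 = E8 \<and> h ` nbrs E8 ys = P \<and> h x = \<alpha>0" using chain_normal_form[OF i] by metis
  have *: "\<exists>x h. x \<in> E8 \<and> x \<in> N \<and> x \<bullet> x = 2 \<and> even_group N \<and> orthogonal_transformation h \<and> h ` E8 = E8 \<and> h ` N = P \<and> h x = \<alpha>0"
    if N: "N \<in> neighbours (elementary_2_group i) E8" for N
  proof -
    obtain ys where ys: "length ys = i" "nbr_chain E8 ys" "N = nbrs E8 ys" using E8_neighbour_chain[OF N] by blast
    obtain x where x: "x \<in> E8" "x \<bullet> x = 2" "\<forall>y\<in>set ys. x \<bullet> y \<in> \<int>" using chain_root[OF ys(2)] ys(1) i by auto
    from P[OF ys(2,1) x] show ?thesis using x nbrs_memI[OF x(1,3)] nbrs_even_group[OF even_group_E8 ys(2)] unfolding ys(3) by blast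
  qed
  fix N N' assume N: "N \<in> neighbours (elementary_2_group i) E8" and N': "N' \<in> neighbours (elementary_2_group i) E8"
  obtain x h where h: "x \<in> E8" "x \<in> N" "x \<bullet> x = 2" "even_group N"
    "orthogonal_transformation h" "h ` E8 = E8" "h ` N = P" "h x = \<alpha>0" using *[OF N] by blast
  obtain x' h' where h': "orthogonal_transformation h'" "h' ` E8 = E8" "h' ` N' = P" "h' x' = \<alpha>0" using *[OF N'] by blast
  obtain g where g: "orthogonal_transformation g" "g ` E8 = E8" "g ` N = N'" using orth_connect[OF h(5-8) h'] by metis
  show "\<exists>h. orthogonal_transformation h \<and> h ` E8 = E8 \<and> h ` N = N' \<and> det (matrix h) = 1"
    by (rule special_connect[OF g even_group_E8 h(4,1,2,3)])
qed

lemma E8_cyclic_transitive: "SO_transitive_on_neighbours (integer_mod_group 4) E8"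
proof (rule SO_transitiveI[OF group_integer_mod_group])
  show "neighbours (integer_mod_group 4) E8 \<noteq> {}"
    using neighbours_cyclic[OF E8_even_lattices, of "hv [2,2,2,2,2,2,2,-2]" "hv [-1,-1,1,1,1,1,1,1]"]
    by (auto simp: hv_E8 hv_inner)
  have *: "\<exists>x h. x \<in> E8 \<and> x \<in> N \<and> x \<bullet> x = 2 \<and> even_group N \<and> orthogonal_transformation h \<and> h ` E8 = E8
      \<and> h ` N = nbr E8 tz \<and> h x = \<alpha>0"
    if N: "N \<in> neighbours (integer_mod_group 4) E8" for N
  proof -
    obtain y where y: "N = nbr E8 y" "even_norm y" "4 *\<^sub>R y \<in> E8" "2 *\<^sub>R y \<notin> E8" using E8_neighbour_cyclic[OF N] by blast
    obtain x where x: "x \<in> E8" "x \<bullet> x = 2" "x \<bullet> y \<in> \<int>" using Z4_root[OF y(3,4,2)] by blast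
    from Z4_normal_form[OF y(3,4,2) x] show ?thesis
      using x nbr_memI[OF x(1,3)] nbr_even_group[OF even_group_E8 y(2)] unfolding y(1) by blast
  qed
  fix N N' assume N: "N \<in> neighbours (integer_mod_group 4) E8" and N': "N' \<in> neighbours (integer_mod_group 4) E8"
  obtain x h where h: "x \<in> E8" "x \<in> N" "x \<bullet> x = 2" "even_group N"
    "orthogonal_transformation h" "h ` E8 = E8" "h ` N = nbr E8 tz" "h x = \<alpha>0" using *[OF N] by blast
  obtain x' h' where h': "orthogonal_transformation h'" "h' ` E8 = E8" "h' ` N' = nbr E8 tz" "h' x' = \<alpha>0" using *[OF N'] by blast
  obtain g where g: "orthogonal_transformation g" "g ` E8 = E8" "g ` N = N'" using orth_connect[OF h(5-8) h'] by metis
  show "\<exists>h. orthogonal_transformation h \<and> h ` E8 = E8 \<and> h ` N = N' \<and> det (matrix h) = 1"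
    by (rule special_connect[OF g even_group_E8 h(4,1,2,3)])
qed

section \<open>Neighbours of \<open>E\<^sub>7\<close>\<close>

context
  fixes \<iota> :: "real^7 \<Rightarrow> real^8"
  assumes iso: "hyperplane_isometry \<iota>"
begin

lemma \<iota>_linear: "linear \<iota>"
  and \<iota>_inner: "\<iota> x \<bullet> \<iota> y = x \<bullet> y"
  and \<iota>_range: "range \<iota> = {x. x \<bullet> half_ones = 0}"
  using iso by (auto simp: hyperplane_isometry_def)

lemma \<iota>_inj: "inj \<iota>"
proof (rule injI)
  fix x y assume "\<iota> x = \<iota> y"
  then have "(x - y) \<bullet> (x - y) = 0" unfolding \<iota>_inner[symmetric] by (simp add: linear_diff[OF \<iota>_linear])
  then show "x = y" by simp
qed

lemma \<iota>_ex: "x \<bullet> half_ones = 0 \<Longrightarrow> \<exists>z. \<iota> z = x"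
  using \<iota>_range by (auto simp: set_eq_iff image_iff) metis

lemma \<iota>_orth: "\<iota> z \<bullet> half_ones = 0"
  using \<iota>_range by auto

lemma \<iota>_image_even_group:
  assumes "N \<in> even_lattices" shows "even_group (\<iota> ` N)"
proof -
  note E = even_lattices_even_group[OF assms]
  show ?thesis unfolding even_group_def
  proof (intro conjI ballI)
    show "subgrp (\<iota> ` N)" unfolding subgrp_def
    proof (intro conjI ballI)
      show "0 \<in> \<iota> ` N" using subgrp_0[OF even_groupD(1)[OF E]] linear_0[OF \<iota>_linear] by force
      show "x - y \<in> \<iota> ` N" if "x \<in> \<iota> ` N" "y \<in> \<iota> ` N" for x y
        using that subgrp_diff[OF even_groupD(1)[OF E]] by (auto simp flip: linear_diff[OF \<iota>_linear])
    qed
  qed (use even_groupD(2,3)[OF E] in \<open>auto simp: \<iota>_inner even_norm_def\<close>)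
qed

lemma \<iota>_image_maximal:
  assumes N: "N \<in> even_lattices" and x: "x \<in> E8" "x \<in> {x. x \<bullet> half_ones = 0}" "\<forall>y\<in>\<iota> ` N. x \<bullet> y \<in> \<int>"
  shows "x \<in> \<iota> ` N"
proof -
  obtain z where z: "\<iota> z = x" using \<iota>_ex x(2) by auto
  have "z \<in> N"
    by (rule even_lattices_maximal[OF N])
      (use x(3) even_groupD(2)[OF even_group_E8 x(1) x(1)] in \<open>auto simp: \<iota>_inner simp flip: z\<close>)
  then show ?thesis using z by blast
qed

lemma hyperplane_subgrp: "subgrp {x::real^8. x \<bullet> half_ones = 0}"
  by (auto simp: subgrp_def inner_diff_left)

lemma \<iota>_image_hyperplane: "\<iota> ` N \<subseteq> {x. x \<bullet> half_ones = 0}"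
  using \<iota>_orth by auto

lemma \<iota>_mem_E7: "\<iota> z \<in> E8 \<longleftrightarrow> z \<in> \<iota> -` E7"
  by (simp add: E7_iff \<iota>_orth)

text \<open>The chain is built over E8: its vectors lie in the hyperplane, so
  \<open>half_ones\<close> pairs to 0 with them and is a root of the resulting lattice, of which
  \<open>N\<close> is the hyperplane section.\<close>

lemma E7_neighbour_chain:
  assumes N: "N \<in> neighbours (elementary_2_group i) (\<iota> -` E7)"
  shows "\<exists>ys. length ys = i \<and> nbr_chain E8 ys \<and> (\<forall>y\<in>set ys. half_ones \<bullet> y = 0)
    \<and> N = \<iota> -` (nbrs E8 ys \<inter> {x. x \<bullet> half_ones = 0})"
proof -
  obtain f where f: "\<And>x y j. x \<in> N \<Longrightarrow> y \<in> N \<Longrightarrow> j < i \<Longrightarrow> f (x + y) j = (f x j + f y j :: int) mod 2"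
    "\<And>x. x \<in> N \<Longrightarrow> (\<forall>j<i. f x j = 0) \<longleftrightarrow> x \<in> \<iota> -` E7"
    "\<And>k. k < i \<Longrightarrow> \<exists>y\<in>N. \<forall>j<i. f y j = (if j = k then 1 else 0)"
  proof (rule neighbour_parities[OF N], goal_cases)
    case (1 f)
    show ?case by (rule 1(1)[OF 1(2-4)])
  qed
  have NL: "N \<in> even_lattices" using N by (simp add: neighbours_def)
  let ?V = "{x. x \<bullet> half_ones = 0}" and ?f = "\<lambda>x. f (inv_into UNIV \<iota> x)"
  have inv: "inv_into UNIV \<iota> (\<iota> z) = z" for z using \<iota>_inj by (rule inv_f_f)
  have "\<exists>ys. length ys = i \<and> nbr_chain E8 ys \<and> set ys \<subseteq> \<iota> ` N \<and> \<iota> ` N = nbrs E8 ys \<inter> ?V"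
  proof (rule chain_exists[OF even_group_E8 \<iota>_image_even_group[OF NL] \<iota>_image_hyperplane hyperplane_subgrp
        \<iota>_image_maximal[OF NL], where f = ?f])
    show "?f (x + y) j = (?f x j + ?f y j) mod 2" if "x \<in> \<iota> ` N" "y \<in> \<iota> ` N" "j < i" for x y j
      using that f(1) by (auto simp: inv simp flip: linear_add[OF \<iota>_linear])
    show "(\<forall>j<i. ?f x j = 0) \<longleftrightarrow> x \<in> E8" if x: "x \<in> \<iota> ` N" for x
    proof -
      obtain z where z: "z \<in> N" "x = \<iota> z" using x by blast
      show ?thesis using f(2)[OF z(1)] by (simp add: z(2) inv \<iota>_mem_E7)
    qed
    show "\<exists>y\<in>\<iota> ` N. \<forall>j<i. ?f y j = (if j = k then 1 else 0)" if "k < i" for k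
      using f(3)[OF that] by (auto simp: inv)
  qed
  then obtain ys where ys: "length ys = i" "nbr_chain E8 ys" "set ys \<subseteq> \<iota> ` N" "\<iota> ` N = nbrs E8 ys \<inter> ?V" by blast
  have "\<forall>y\<in>set ys. half_ones \<bullet> y = 0" using ys(3) \<iota>_orth by (auto simp: inner_commute)
  moreover have "N = \<iota> -` (nbrs E8 ys \<inter> ?V)" unfolding ys(4)[symmetric] by (simp add: inj_vimage_image_eq \<iota>_inj)
  ultimately show ?thesis using ys(1,2) by blast
qed

lemma E7_neighbour_cyclic:
  assumes N: "N \<in> neighbours (integer_mod_group 4) (\<iota> -` E7)"
  shows "\<exists>y. even_norm y \<and> 4 *\<^sub>R y \<in> E8 \<and> 2 *\<^sub>R y \<notin> E8 \<and> half_ones \<bullet> y = 0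
    \<and> N = \<iota> -` (nbr E8 y \<inter> {x. x \<bullet> half_ones = 0})"
proof -
  obtain f where f: "\<And>x y. x \<in> N \<Longrightarrow> y \<in> N \<Longrightarrow> f (x + y) = (f x + f y :: int) mod 4"
    "\<And>x. x \<in> N \<Longrightarrow> f x = 0 \<longleftrightarrow> x \<in> \<iota> -` E7" "\<exists>y\<in>N. f y = 1"
  proof (rule neighbour_residues[OF N], goal_cases)
    case (1 f)
    show ?case by (rule 1(1)[OF 1(2-4)])
  qed
  have NL: "N \<in> even_lattices" using N by (simp add: neighbours_def)
  let ?V = "{x. x \<bullet> half_ones = 0}" and ?f = "\<lambda>x. f (inv_into UNIV \<iota> x)"
  have inv: "inv_into UNIV \<iota> (\<iota> z) = z" for z using \<iota>_inj by (rule inv_f_f)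
  have "\<exists>y\<in>\<iota> ` N. \<iota> ` N = nbr E8 y \<inter> ?V \<and> even_norm y \<and> 4 *\<^sub>R y \<in> E8 \<and> 2 *\<^sub>R y \<notin> E8"
  proof (rule cyclic_exists[OF even_group_E8 \<iota>_image_even_group[OF NL] \<iota>_image_hyperplane hyperplane_subgrp
        \<iota>_image_maximal[OF NL], where f = ?f])
    show "?f (x + y) = (?f x + ?f y) mod 4" if "x \<in> \<iota> ` N" "y \<in> \<iota> ` N" for x y
      using that f(1) by (auto simp: inv simp flip: linear_add[OF \<iota>_linear])
    show "?f x = 0 \<longleftrightarrow> x \<in> E8" if x: "x \<in> \<iota> ` N" for x
    proof -
      obtain z where z: "z \<in> N" "x = \<iota> z" using x by blast
      show ?thesis using f(2)[OF z(1)] by (simp add: z(2) inv \<iota>_mem_E7)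
    qed
    show "\<exists>y\<in>\<iota> ` N. ?f y = 1" using f(3) by (auto simp: inv)
  qed
  then obtain y where y: "y \<in> \<iota> ` N" "\<iota> ` N = nbr E8 y \<inter> ?V" "even_norm y" "4 *\<^sub>R y \<in> E8" "2 *\<^sub>R y \<notin> E8" by blast
  have "half_ones \<bullet> y = 0" using y(1) \<iota>_orth by (auto simp: inner_commute)
  moreover have "N = \<iota> -` (nbr E8 y \<inter> ?V)" unfolding y(2)[symmetric] by (simp add: inj_vimage_image_eq \<iota>_inj)
  ultimately show ?thesis using y(3-5) by blast
qed

text \<open>In odd dimension, the sign of the determinant is adjusted by \<open>-1\<close>.\<close>

lemma E7_transport:
  assumes g: "orthogonal_transformation g" "g ` E8 = E8" "g half_ones = half_ones" "g ` K = K'"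
    and K: "even_group K" "even_group K'"
  shows "\<exists>h. orthogonal_transformation h \<and> h ` (\<iota> -` E7) = \<iota> -` E7
    \<and> h ` (\<iota> -` (K \<inter> {x. x \<bullet> half_ones = 0})) = \<iota> -` (K' \<inter> {x. x \<bullet> half_ones = 0}) \<and> det (matrix h) = 1"
proof -
  have gV: "g x \<bullet> half_ones = x \<bullet> half_ones" for x
    using orth_simps(3)[OF g(1), of x half_ones] g(3) by simp
  have "\<forall>z. \<exists>w. \<iota> w = g (\<iota> z)" using \<iota>_ex gV \<iota>_orth by simp
  \<comment> \<open>As \<open>g\<close> fixes \<open>half_ones\<close>, it preserves the hyperplane;
    \<open>k\<close> is its restriction.\<close>
  then obtain k where k: "\<And>z. \<iota> (k z) = g (\<iota> z)" by metis
  have inj: "x = y" if "\<iota> x = \<iota> y" for x y using that \<iota>_inj by (simp add: inj_eq)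
  have ko: "orthogonal_transformation k" unfolding orthogonal_transformation_def
  proof (intro conjI allI linearI)
    show "k (x + y) = k x + k y" for x y
      by (rule inj) (simp add: k linear_add[OF \<iota>_linear] orth_simps(1)[OF g(1)])
    show "k (c *\<^sub>R x) = c *\<^sub>R k x" for c x
      by (rule inj) (simp add: k linear_scale[OF \<iota>_linear] orth_simps(2)[OF g(1)])
    show "k x \<bullet> k y = x \<bullet> y" for x y
      unfolding \<iota>_inner[symmetric] k orth_simps(3)[OF g(1)] ..
  qed
  let ?V = "{x. x \<bullet> half_ones = 0}"
  have tr: "k ` (\<iota> -` (S \<inter> ?V)) = \<iota> -` (S' \<inter> ?V)" if S: "g ` S = S'" for S S'
  proof (intro equalityI subsetI)
    fix w assume "w \<in> k ` (\<iota> -` (S \<inter> ?V))"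
    then show "w \<in> \<iota> -` (S' \<inter> ?V)" using S k \<iota>_orth by auto
  next
    fix w assume "w \<in> \<iota> -` (S' \<inter> ?V)"
    then obtain v where v: "v \<in> S" "\<iota> w = g v" using S by auto
    then have "v \<bullet> half_ones = 0" using gV[of v] \<iota>_orth[of w] by simp
    then obtain z where "\<iota> z = v" using \<iota>_ex by blast
    moreover then have "k z = w" using v k inj by metis
    ultimately show "w \<in> k ` (\<iota> -` (S \<inter> ?V))" using v(1) \<iota>_orth by auto
  qed
  have E7: "E7 = E8 \<inter> ?V" by (auto simp: E7_iff)
  note t1 = tr[OF g(2), folded E7] and t2 = tr[OF g(4)]
  show ?thesis
  proof (cases "det (matrix k) = 1")
    case True then show ?thesis using ko t1 t2 by blast
  next
    case False
    then have d: "det (matrix k) = -1" using det_orth_cases[OF ko] by simp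
    define m where "m = (\<lambda>x::real^7. (-1) *\<^sub>R x)"
    have mo: "orthogonal_transformation m" unfolding m_def orthogonal_transformation_def
      by (auto intro!: linearI)
    have dm: "det (matrix m) = -1" unfolding m_def det_matrix_scaleR by simp
    have ms: "m ` (\<iota> -` S) = \<iota> -` S" if "subgrp S" for S
    proof (intro equalityI subsetI)
      fix w assume "w \<in> m ` (\<iota> -` S)"
      then show "w \<in> \<iota> -` S" using subgrp_minus[OF that] by (auto simp: m_def linear_neg[OF \<iota>_linear])
    next
      fix w assume w: "w \<in> \<iota> -` S"
      have "w = m (- w)" by (simp add: m_def)
      moreover have "- w \<in> \<iota> -` S" using w subgrp_minus[OF that] by (auto simp: linear_neg[OF \<iota>_linear])
      ultimately show "w \<in> m ` (\<iota> -` S)" by blast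
    qed
    have "(m \<circ> k) ` (\<iota> -` E7) = \<iota> -` E7" by (rule comp_image[OF t1 ms[OF subgrp_E7]])
    moreover have "(m \<circ> k) ` (\<iota> -` (K \<inter> ?V)) = \<iota> -` (K' \<inter> ?V)"
      by (rule comp_image[OF t2 ms[OF subgrp_Int[OF even_groupD(1)[OF K(2)] hyperplane_subgrp]]])
    moreover have "det (matrix (m \<circ> k)) = 1" using det_matrix_compose[OF ko mo] d dm by simp
    ultimately show ?thesis using orthogonal_transformation_compose[OF mo ko] by blast
  qed
qed

lemma E7_elements:
  assumes "\<And>j. u j \<in> E7" shows "\<exists>v. \<forall>j. \<iota> (v j) = u j"
  using assms \<iota>_ex by (auto simp: E7_iff intro: choice)

lemma E7_elementary_transitive:
  assumes i: "i \<in> {1,2,3}"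
  shows "SO_transitive_on_neighbours (elementary_2_group i) (\<iota> -` E7)"
proof (rule SO_transitiveI[OF elementary_2_group])
  \<comment> \<open>The index is reduced modulo 3 so that \<open>u j\<close> and \<open>x j\<close>
    lie in \<open>E7\<close> for every \<open>j\<close>, as \<open>E7_elements\<close> asks.\<close>
  define u where "u j = hv ([[2,2,-2,-2,0,0,0,0], [2,-2,0,0,2,-2,0,0], [2,0,2,0,-2,0,-2,0]] ! (j mod 3))" for j
  define x where "x j = hv ([[0,2,0,0,0,-2,0,0], [0,0,0,0,2,0,-2,0], [0,0,2,-2,0,0,0,0]] ! (j mod 3))" for j
  have c: "j mod 3 = 0 \<or> j mod 3 = Suc 0 \<or> j mod 3 = 2" for j :: nat by presburger
  have ux: "u j \<in> E7" "x j \<in> E7" for j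
    using c[of j] unfolding E7_iff half_ones_qv u_def x_def
    by (elim disjE; simp add: hv_E8; simp add: hv_qv qv_inner)+
  obtain v w where v: "\<And>j. \<iota> (v j) = u j" and w: "\<And>j. \<iota> (w j) = x j"
    using E7_elements[of u, OF ux(1)] E7_elements[of x, OF ux(2)] by metis
  have l3: "j = 0 \<or> j = Suc 0 \<or> j = 2" if "j < i" for j using that i by auto
  have "(\<lambda>z. z - (\<Sum>j<i. (z \<bullet> v j / 2) *\<^sub>R v j)) ` (\<iota> -` E7) \<in> neighbours (elementary_2_group i) (\<iota> -` E7)"
  proof (rule neighbours_elementary[OF E7_even_lattices[OF iso], where x = w])
    show "v j \<in> \<iota> -` E7" "w j \<in> \<iota> -` E7" for j using ux by (simp_all add: v w)
    show "v j \<bullet> v k = (if j = k then 4 else 0)" if "j < i" "k < i" for j k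
      unfolding \<iota>_inner[symmetric] v u_def using l3[OF that(1)] l3[OF that(2)] by (elim disjE; simp add: hv_inner)
    show "w k \<bullet> v j = (if j = k then 1 else 0)" if "j < i" "k < i" for j k
      unfolding \<iota>_inner[symmetric] v w u_def x_def using l3[OF that(1)] l3[OF that(2)] by (elim disjE; simp add: hv_inner)
  qed
  then show "neighbours (elementary_2_group i) (\<iota> -` E7) \<noteq> {}" by blast
  obtain P where P: "\<And>ys x. nbr_chain E8 ys \<Longrightarrow> length ys = i \<Longrightarrow> x \<in> E8 \<Longrightarrow> x \<bullet> x = 2 \<Longrightarrow> \<forall>y\<in>set ys. x \<bullet> y \<in> \<int> \<Longrightarrow>
    \<exists>h. orthogonal_transformation h \<and> h ` E8 = E8 \<and> h ` nbrs E8 ys = P \<and> h x = \<alpha>0" using chain_normal_form[OF i] by metis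
  have *: "\<exists>K h. N = \<iota> -` (K \<inter> {x. x \<bullet> half_ones = 0}) \<and> even_group K \<and> orthogonal_transformation h \<and> h ` E8 = E8
      \<and> h ` K = P \<and> h half_ones = \<alpha>0"
    if N: "N \<in> neighbours (elementary_2_group i) (\<iota> -` E7)" for N
  proof -
    obtain ys where ys: "length ys = i" "nbr_chain E8 ys" "\<forall>y\<in>set ys. half_ones \<bullet> y = 0"
      "N = \<iota> -` (nbrs E8 ys \<inter> {x. x \<bullet> half_ones = 0})" using E7_neighbour_chain[OF N] by blast
    have "\<forall>y\<in>set ys. half_ones \<bullet> y \<in> \<int>" using ys(3) by simp
    from P[OF ys(2,1) half_ones_root this] show ?thesis using nbrs_even_group[OF even_group_E8 ys(2)] ys(4) by blast
  qed
  fix N N' assume N: "N \<in> neighbours (elementary_2_group i) (\<iota> -` E7)" and N': "N' \<in> neighbours (elementary_2_group i) (\<iota> -` E7)"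
  obtain K h where h: "N = \<iota> -` (K \<inter> {x. x \<bullet> half_ones = 0})" "even_group K"
    "orthogonal_transformation h" "h ` E8 = E8" "h ` K = P" "h half_ones = \<alpha>0" using *[OF N] by blast
  obtain K' h' where h': "N' = \<iota> -` (K' \<inter> {x. x \<bullet> half_ones = 0})" "even_group K'"
    "orthogonal_transformation h'" "h' ` E8 = E8" "h' ` K' = P" "h' half_ones = \<alpha>0" using *[OF N'] by blast
  \<comment> \<open>Both normal forms send \<open>half_ones\<close> to \<open>\<alpha>0\<close>, so
    the connecting isometry fixes \<open>half_ones\<close>.\<close>
  obtain g where g: "orthogonal_transformation g" "g ` E8 = E8" "g ` K = K'" "g half_ones = half_ones"
    using orth_connect[OF h(3-6) h'(3-6)] by metis
  show "\<exists>h. orthogonal_transformation h \<and> h ` (\<iota> -` E7) = \<iota> -` E7 \<and> h ` N = N' \<and> det (matrix h) = 1"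
    unfolding h(1) h'(1) by (rule E7_transport[OF g(1,2,4,3) h(2) h'(2)])
qed

lemma E7_cyclic_transitive: "SO_transitive_on_neighbours (integer_mod_group 4) (\<iota> -` E7)"
proof (rule SO_transitiveI[OF group_integer_mod_group])
  let ?w = "hv [4,-2,-2,2,-2,0,0,0]" and ?x = "hv [2,0,0,-2,0,0,0,0]"
  have wx: "?w \<in> E7" "?x \<in> E7" unfolding E7_iff half_ones_qv by (simp_all add: hv_E8) (simp_all add: hv_qv qv_inner)
  obtain w x where w: "\<iota> w = ?w" and x: "\<iota> x = ?x" using wx \<iota>_ex by (metis E7_iff)
  have "(\<lambda>z. z - (z \<bullet> w / 4) *\<^sub>R w) ` (\<iota> -` E7) \<in> neighbours (integer_mod_group 4) (\<iota> -` E7)"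
    by (rule neighbours_cyclic[OF E7_even_lattices[OF iso], of w x])
      (use wx in \<open>simp_all add: w x hv_inner flip: \<iota>_inner\<close>)
  then show "neighbours (integer_mod_group 4) (\<iota> -` E7) \<noteq> {}" by blast
  have *: "\<exists>K h. N = \<iota> -` (K \<inter> {x. x \<bullet> half_ones = 0}) \<and> even_group K \<and> orthogonal_transformation h \<and> h ` E8 = E8
      \<and> h ` K = nbr E8 tz \<and> h half_ones = \<alpha>0"
    if N: "N \<in> neighbours (integer_mod_group 4) (\<iota> -` E7)" for N
  proof -
    obtain y where y: "even_norm y" "4 *\<^sub>R y \<in> E8" "2 *\<^sub>R y \<notin> E8" "half_ones \<bullet> y = 0"
      "N = \<iota> -` (nbr E8 y \<inter> {x. x \<bullet> half_ones = 0})" using E7_neighbour_cyclic[OF N] by blast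
    have "half_ones \<bullet> y \<in> \<int>" using y(4) by simp
    from Z4_normal_form[OF y(2,3,1) half_ones_root this] show ?thesis using nbr_even_group[OF even_group_E8 y(1)] y(5) by blast
  qed
  fix N N' assume N: "N \<in> neighbours (integer_mod_group 4) (\<iota> -` E7)" and N': "N' \<in> neighbours (integer_mod_group 4) (\<iota> -` E7)"
  obtain K h where h: "N = \<iota> -` (K \<inter> {x. x \<bullet> half_ones = 0})" "even_group K"
    "orthogonal_transformation h" "h ` E8 = E8" "h ` K = nbr E8 tz" "h half_ones = \<alpha>0" using *[OF N] by blast
  obtain K' h' where h': "N' = \<iota> -` (K' \<inter> {x. x \<bullet> half_ones = 0})" "even_group K'"
    "orthogonal_transformation h'" "h' ` E8 = E8" "h' ` K' = nbr E8 tz" "h' half_ones = \<alpha>0" using *[OF N'] by blast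
  obtain g where g: "orthogonal_transformation g" "g ` E8 = E8" "g ` K = K'" "g half_ones = half_ones"
    using orth_connect[OF h(3-6) h'(3-6)] by metis
  show "\<exists>h. orthogonal_transformation h \<and> h ` (\<iota> -` E7) = \<iota> -` E7 \<and> h ` N = N' \<and> det (matrix h) = 1"
    unfolding h(1) h'(1) by (rule E7_transport[OF g(1,2,4,3) h(2) h'(2)])
qed

end

section \<open>Determinants modulo \<open>4\<close>\<close>

lemma det_reindex:
  fixes M :: "'a::comm_ring_1^'n^'n" and p :: "'n \<Rightarrow> 'n"
  assumes "bij p" shows "det (\<chi> i j. M $ p i $ p j) = det M"
proof -
  have p: "p permutes UNIV" using assms by (intro bij_imp_permutes) auto
  have "det (\<chi> i j. M $ p i $ p j) = of_int (sign p) * det (\<chi> i. M $ p i)"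
    using det_permute_columns[OF p, of "\<chi> i. M $ p i"] by simp
  also have "\<dots> = of_int (sign p * sign p) * det M" unfolding det_permute_rows[OF p] of_int_mult mult.assoc ..
  finally show ?thesis by (simp add: sign_idempotent)
qed

lemma det_of_int:
  fixes T :: "'n::finite \<Rightarrow> 'n \<Rightarrow> int"
  shows "det ((\<chi> i j. of_int (T i j)) :: 'a::comm_ring_1^'n^'n) = of_int (det (\<chi> i j. T i j))"
  by (simp add: det_def)

definition low8 :: "8 \<Rightarrow> bool" where
  "low8 i \<longleftrightarrow> pos8 i < 4"

lemma low8_simps [simp]:
  "low8 1" "low8 2" "low8 3" "low8 4" "\<not> low8 5" "\<not> low8 6" "\<not> low8 7" "\<not> low8 8"
  by (simp_all add: low8_def)

lemma low8_cases: "low8 i \<Longrightarrow> i = 1 \<or> i = 2 \<or> i = 3 \<or> i = 4"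
  and high8_cases: "\<not> low8 i \<Longrightarrow> i = 5 \<or> i = 6 \<or> i = 7 \<or> i = 8"
proof -
  have "\<forall>i. if low8 i then i = 1 \<or> i = 2 \<or> i = 3 \<or> i = 4 else i = 5 \<or> i = 6 \<or> i = 7 \<or> i = 8"
    unfolding forall_8 by simp
  then show "low8 i \<Longrightarrow> i = 1 \<or> i = 2 \<or> i = 3 \<or> i = 4"
    and "\<not> low8 i \<Longrightarrow> i = 5 \<or> i = 6 \<or> i = 7 \<or> i = 8" by (metis (full_types))+
qed

lemma wrap8: "(9::8) = 1" "(10::8) = 2" "(11::8) = 3" "(12::8) = 4"
  by simp_all

lemma low8_shift: "low8 (i + 4) \<longleftrightarrow> \<not> low8 i"
proof -
  have "\<forall>i. low8 (i + 4) \<longleftrightarrow> \<not> low8 i" unfolding forall_8 by (simp add: wrap8)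
  then show ?thesis by blast
qed

text \<open>\<open>?A\<close> and \<open>?D\<close> are the diagonal blocks completed by the
  identity, \<open>?U\<close> carries the upper right block, and the matrix factors as
  \<open>?D ** (?U ** ?A)\<close>. By \<open>AD\<close> one diagonal block is the inverse transpose
  of the other; the index shift by 4 brings the second into the position of the first.\<close>

lemma det_block_triangular:
  fixes T :: "8 \<Rightarrow> 8 \<Rightarrow> 'a::comm_ring_1"
  assumes C: "\<And>i j. \<not> low8 i \<Longrightarrow> low8 j \<Longrightarrow> T i j = 0"
    and AD: "\<And>i j. low8 i \<Longrightarrow> low8 j \<Longrightarrow> (\<Sum>k | low8 k. T i k * T (j + 4) (k + 4)) = (if i = j then 1 else 0)"
  shows "det (\<chi> i j. T i j) = 1"
proof -
  let ?A = "(\<chi> i j. if low8 i \<and> low8 j then T i j else if i = j then 1 else 0) :: 'a^8^8"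
  let ?D = "(\<chi> i j. if \<not> low8 i \<and> \<not> low8 j then T i j else if i = j then 1 else 0) :: 'a^8^8"
  let ?D' = "(\<chi> i j. if low8 i \<and> low8 j then T (i + 4) (j + 4) else if i = j then 1 else 0) :: 'a^8^8"
  let ?U = "(\<chi> i j. if low8 i \<and> \<not> low8 j then T i j else if i = j then 1 else 0) :: 'a^8^8"
  have UA: "?U ** ?A = (\<chi> i j. if low8 i then T i j else if i = j then 1 else 0)"
    unfolding vec_eq_iff forall_8 by (simp add: matrix_matrix_mult_def sum_8)
  have DUA: "?D ** (?U ** ?A) = (\<chi> i j. T i j)"
    unfolding UA vec_eq_iff forall_8 by (simp add: matrix_matrix_mult_def sum_8 C)
  have "{k. low8 k} = {1,2,3,4}" using low8_cases by auto
  then have AD': "T i 1 * T (j+4) 5 + (T i 2 * T (j+4) 6 + (T i 3 * T (j+4) 7 + T i 4 * T (j+4) 8)) = (if i = j then 1 else 0)"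
    if "low8 i" "low8 j" for i j using AD[OF that] by simp
  have "?A ** transpose ?D' = mat 1"
    unfolding vec_eq_iff forall_8
    using AD'[of 1 1] AD'[of 1 2] AD'[of 1 3] AD'[of 1 4] AD'[of 2 1] AD'[of 2 2] AD'[of 2 3] AD'[of 2 4]
      AD'[of 3 1] AD'[of 3 2] AD'[of 3 3] AD'[of 3 4] AD'[of 4 1] AD'[of 4 2] AD'[of 4 3] AD'[of 4 4]
    by (simp add: matrix_matrix_mult_def transpose_def mat_def sum_8 add.assoc)
  from arg_cong[OF this, of det] have 1: "det ?A * det ?D' = 1" by (simp only: det_mul det_transpose det_I)
  have b: "bij (\<lambda>i::8. i + c)" for c by (rule bij_betwI[where g = "\<lambda>i. i - c"]) auto
  have "?D' = (\<chi> i j. ?D $ (i + 4) $ (j + 4))" unfolding vec_eq_iff forall_8 by (simp add: wrap8)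
  then have "det ?D' = det (\<chi> i j. ?D $ (i + 4) $ (j + 4))" by (rule arg_cong)
  also have "\<dots> = det ?D" by (rule det_reindex[OF b])
  finally have 2: "det ?D' = det ?D" .
  \<comment> \<open>Since \<open>8 = 0\<close> comes first in the order on the index type, the shift by \<open>1\<close> is needed to make \<open>?U\<close> triangular.\<close>
  have "det ?U = det (\<chi> i j. ?U $ (i + 1) $ (j + 1))" by (rule det_reindex[OF b, symmetric])
  also have "\<dots> = (\<Prod>i\<in>UNIV. (\<chi> i j. ?U $ (i + 1) $ (j + 1)) $ i $ i)"
  proof (rule det_upperdiagonal)
    have "\<forall>i j::8. i > j \<longrightarrow> ?U $ (i + 1) $ (j + 1) = 0"
      unfolding forall_8 by (simp add: wrap8 less_bit0_def bit0.Rep_numeral bit0.Rep_1)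
    then show "(\<chi> i j. ?U $ (i + 1) $ (j + 1)) $ i $ j = 0" if "i > j" for i j :: 8 using that by simp
  qed
  also have "\<dots> = 1" by simp
  finally have 3: "det ?U = 1" .
  have "det (\<chi> i j. T i j) = det ?D * (det ?U * det ?A)" unfolding DUA[symmetric] by (simp only: det_mul)
  then show ?thesis using 1 2 3 by (simp add: mult.commute)
qed

text \<open>Only meaningful on integers.\<close>

definition mod4 :: "real \<Rightarrow> 4" where
  "mod4 x = of_int \<lfloor>x\<rfloor>"

lemma mod4_of_int: "mod4 (of_int k) = of_int k"
  by (simp add: mod4_def)

lemma mod4_times4:
  assumes "x \<in> \<int>" shows "mod4 (4 * x) = 0"
proof -
  obtain k where "x = of_int k" using assms by (rule Ints_cases)
  then have "mod4 (4 * x) = of_int (4 * k)" using mod4_of_int[of "4 * k"] by simp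
  moreover have "(4::4) = 0" by simp
  ultimately show ?thesis by (simp only: of_int_mult of_int_numeral mult_zero_left)
qed

lemma mod4_sum:
  assumes "\<And>i. i \<in> A \<Longrightarrow> y i \<in> \<int>"
  shows "mod4 (\<Sum>i\<in>A. of_int (c i) * y i) = (\<Sum>i\<in>A. of_int (c i) * mod4 (y i))"
proof -
  have "\<forall>i\<in>A. \<exists>k. y i = of_int k" using assms by (auto elim: Ints_cases)
  then obtain k where k: "\<And>i. i \<in> A \<Longrightarrow> y i = of_int (k i)" by metis
  have "(\<Sum>i\<in>A. of_int (c i) * y i) = of_int (\<Sum>i\<in>A. c i * k i)" using k by simp
  then have "mod4 (\<Sum>i\<in>A. of_int (c i) * y i) = (\<Sum>i\<in>A. of_int (c i) * of_int (k i))" by (simp only: mod4_of_int) simp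
  also have "\<dots> = (\<Sum>i\<in>A. of_int (c i) * mod4 (y i))" by (rule sum.cong) (simp_all add: k mod4_of_int)
  finally show ?thesis .
qed

section \<open>The \<open>(\<int>/2)\<^sup>4\<close>-neighbours of \<open>E\<^sub>8\<close>\<close>

lemma E8_basis_pairing:
  "\<not> low8 j \<Longrightarrow> mod4 (E8_basis i \<bullet> E8_basis j) = (if low8 i \<and> j = i + 4 then 1 else 0)"
proof -
  have "\<forall>i j. \<not> low8 j \<longrightarrow> mod4 (E8_basis i \<bullet> E8_basis j) = (if low8 i \<and> j = i + 4 then 1 else 0)"
    unfolding forall_8 E8_basis_def mod4_def by (simp add: hv_inner)
  then show "\<not> low8 j \<Longrightarrow> mod4 (E8_basis i \<bullet> E8_basis j) = (if low8 i \<and> j = i + 4 then 1 else 0)" by blast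
qed

lemma E8_basis_half:
  assumes "\<not> low8 i" shows "(1/2) *\<^sub>R E8_basis i \<in> E8_flip 4 ` E8"
proof -
  have u: "E8_flip 4 z = z - ((z \<bullet> E8_u 0 / 2) *\<^sub>R E8_u 0 + (z \<bullet> E8_u 1 / 2) *\<^sub>R E8_u 1
    + (z \<bullet> E8_u 2 / 2) *\<^sub>R E8_u 2 + (z \<bullet> E8_u 3 / 2) *\<^sub>R E8_u 3)" for z
    by (simp add: E8_flip_def numeral_eq_Suc lessThan_Suc add.commute add.left_commute)
  note E = E8_u_def hv_inner E8_basis_def hv_qv vec_eq_iff forall_8
  \<comment> \<open>\<open>E8_flip 4\<close> is an involution, so applying it to the halves yields
    their preimages.\<close>
  have "(1/2) *\<^sub>R E8_basis 5 = E8_flip 4 (hv [-2,2,0,0,0,0,0,0])"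
    "(1/2) *\<^sub>R E8_basis 6 = E8_flip 4 (hv [0,0,0,2,-2,0,0,0])"
    "(1/2) *\<^sub>R E8_basis 7 = E8_flip 4 (hv [2,4,0,2,0,0,0,0])"
    "(1/2) *\<^sub>R E8_basis 8 = E8_flip 4 (hv [1,-1,-1,-1,-3,1,-1,1])"
    unfolding u by (simp_all add: E8_u_def hv_inner E8_basis_def) (simp_all add: vec_eq_iff forall_8 hv_qv)
  moreover have "i = 5 \<or> i = 6 \<or> i = 7 \<or> i = 8" using high8_cases[OF assms] .
  ultimately show ?thesis by (auto simp: hv_E8)
qed

text \<open>Modulo \<open>4\<close>, an element of the stabiliser is block triangular in the basis \<^const>\<open>E8_basis\<close>, and
  the diagonal blocks are inverse transposes of each other.\<close>

lemma stabiliser_det: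
  assumes g: "orthogonal_transformation g" "g ` E8 = E8" "g ` E8_flip 4 ` E8 = E8_flip 4 ` E8"
  shows "det (matrix g) = 1"
proof -
  let ?b = E8_basis and ?d = E8_dual_basis
  have gE: "g x \<in> E8" if "x \<in> E8" for x using that g(2) by blast
  note int = even_groupD(2)[OF even_group_E8]
  have "\<forall>i j. \<exists>t::int. g (?b i) \<bullet> ?d j = of_int t"
    by (meson int[OF gE[OF E8_bases(1)] E8_bases(2)] Ints_cases)
  then obtain T :: "8 \<Rightarrow> 8 \<Rightarrow> int" where T: "\<And>i j. g (?b i) \<bullet> ?d j = of_int (T i j)" by metis
  have gb: "g (?b i) = (\<Sum>k\<in>UNIV. of_int (T i k) *\<^sub>R ?b k)" for i
    using dual_bases(3)[OF even_group_E8 E8_bases, of "g (?b i)"] by (simp add: T)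
  have pair: "mod4 (g (?b i) \<bullet> x) = (\<Sum>k\<in>UNIV. of_int (T i k) * mod4 (?b k \<bullet> x))" if "x \<in> E8" for i x
    unfolding gb inner_sum_left inner_scaleR_left by (rule mod4_sum) (rule int[OF E8_bases(1) that])
  \<comment> \<open>Modulo 4, pairing with a high basis vector reads off the coefficient at the
    matching low one.\<close>
  have pair_high: "mod4 (g (?b i) \<bullet> ?b (j + 4)) = of_int (T i j)" if j: "low8 j" for i j
  proof -
    have nj: "\<not> low8 (j + 4)" using j by (simp add: low8_shift)
    have "mod4 (g (?b i) \<bullet> ?b (j + 4)) = (\<Sum>k\<in>UNIV. if k = j then of_int (T i j) else 0)"
      unfolding pair[OF E8_bases(1)] using E8_basis_pairing[OF nj] j by (intro sum.cong) auto
    then show ?thesis by simp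
  qed
  have N: "even_group (E8_flip 4 ` E8)"
    by (rule even_lattices_even_group) (use E8_flip_neighbour[of 4] in \<open>simp add: neighbours_def\<close>)
  \<comment> \<open>Both halves lie in the neighbour, which is integral and preserved by
    \<open>g\<close>; clearing the two denominators gives the factor 4.\<close>
  have C: "of_int (T i j) = (0::4)" if ij: "\<not> low8 i" "low8 j" for i j
  proof -
    have nj: "\<not> low8 (j + 4)" using ij(2) by (simp add: low8_shift)
    have "g ((1/2) *\<^sub>R ?b i) \<bullet> ((1/2) *\<^sub>R ?b (j + 4)) \<in> \<int>"
      using even_groupD(2)[OF N] E8_basis_half[OF ij(1)] E8_basis_half[OF nj] g(3) by blast
    then have "mod4 (4 * (g ((1/2) *\<^sub>R ?b i) \<bullet> ((1/2) *\<^sub>R ?b (j + 4)))) = 0" by (rule mod4_times4)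
    then show ?thesis using pair_high[OF ij(2), of i] by (simp add: orth_simps(2)[OF g(1)])
  qed
  \<comment> \<open>Expand the image of basis vector j + 4 in its product with the image of basis
    vector i: its low coefficients vanish by \<open>C\<close>, and the high ones meet the values
    given by \<open>pair_high\<close>.\<close>
  have AD: "(\<Sum>k | low8 k. of_int (T i k) * of_int (T (j + 4) (k + 4))) = (if i = j then 1 else (0::4))"
    if ij: "low8 i" "low8 j" for i j
  proof -
    have nj: "\<not> low8 (j + 4)" using ij(2) by (simp add: low8_shift)
    have "(if i = j then 1 else (0::4)) = mod4 (g (?b (j + 4)) \<bullet> g (?b i))"
      unfolding orth_simps(3)[OF g(1)] using E8_basis_pairing[OF nj, of i] ij by (simp add: inner_commute)
    also have "\<dots> = (\<Sum>l\<in>UNIV. of_int (T (j + 4) l) * mod4 (g (?b i) \<bullet> ?b l))"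
      unfolding pair[OF gE[OF E8_bases(1)]] by (simp add: inner_commute)
    also have "\<dots> = (\<Sum>l | \<not> low8 l. of_int (T (j + 4) l) * mod4 (g (?b i) \<bullet> ?b l))"
      by (rule sum.mono_neutral_right) (use C[OF nj] in auto)
    also have "\<dots> = (\<Sum>k | low8 k. of_int (T (j + 4) (k + 4)) * mod4 (g (?b i) \<bullet> ?b (k + 4)))"
    proof (rule sum.reindex_bij_witness[where i = "\<lambda>k. k + 4" and j = "\<lambda>k. k - 4"])
      show "l - 4 \<in> {k. low8 k}" if "l \<in> {l. \<not> low8 l}" for l using that low8_shift[of "l - 4"] by simp
      show "k + 4 \<in> {k. \<not> low8 k}" if "k \<in> {k. low8 k}" for k using that low8_shift[of k] by simp
    qed auto
    also have "\<dots> = (\<Sum>k | low8 k. of_int (T i k) * of_int (T (j + 4) (k + 4)))"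
      by (rule sum.cong) (simp_all add: pair_high mult.commute)
    finally show ?thesis by simp
  qed
  have d4: "det ((\<chi> i j. of_int (T i j)) :: 4^8^8) = 1" by (rule det_block_triangular[OF C AD])
  let ?B = "(\<chi> i. ?b i) :: real^8^8" and ?T = "(\<chi> i j. of_int (T i j)) :: real^8^8"
  have 1: "(\<chi> i. g (?b i)) = ?T ** ?B" by (simp add: gb matrix_matrix_mult_def vec_eq_iff)
  have gk: "g v $ k = (\<Sum>l\<in>UNIV. matrix g $ k $ l * v $ l)" for v k
  proof -
    have "g v = matrix g *v v"
      using fun_cong[OF matrix_vector_mul(2)[OF orthogonal_transformation_linear[OF g(1)]], of v] by simp
    then show ?thesis by (subst (asm) matrix_vector_mult_def) simp
  qed
  have 2: "(\<chi> i. g (?b i)) = ?B ** transpose (matrix g)"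
    by (simp add: matrix_matrix_mult_def transpose_def vec_eq_iff gk mult.commute)
  have "det ?T * det ?B = det ?B * det (matrix g)"
    using arg_cong[OF trans[OF 1[symmetric] 2], of det] by (simp only: det_mul det_transpose)
  moreover have "det ?B \<noteq> 0" using dual_bases(2)[OF even_group_E8 E8_bases] by (auto simp: gram_matrix_eq det_mul)
  ultimately have e: "det ?T = det (matrix g)" by simp
  show ?thesis
  proof (rule ccontr)
    assume "\<not> ?thesis"
    then have "of_int (det (\<chi> i j. T i j)) = (of_int (-1) :: real)" using e det_orth_cases[OF g(1)] by (simp add: det_of_int)
    then have "det (\<chi> i j. T i j) = -1" by (simp only: of_int_eq_iff)
    then show False using d4 by (simp add: det_of_int)
  qed
qed

lemma orbit_orth:
  assumes "N \<in> neighbours A L"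
  shows "orbit (orth_group L) (neighbour_action A L) N = {h ` N | h. orthogonal_transformation h \<and> h ` L = L}"
proof (intro equalityI subsetI)
  fix M assume "M \<in> {h ` N | h. orthogonal_transformation h \<and> h ` L = L}"
  then obtain h where h: "orthogonal_transformation h" "h ` L = L" "M = h ` N" by blast
  have e: "(*v) (matrix h) = h" using matrix_vector_mul(2)[OF orthogonal_transformation_linear[OF h(1)]] by simp
  then have "matrix h \<in> carrier (orth_group L)" using h(1,2) by (simp add: orth_group_mem)
  then show "M \<in> orbit (orth_group L) (neighbour_action A L) N"
    unfolding orbit_def using h(3) e assms by (auto simp: neighbour_action_def intro!: exI[of _ "matrix h"])
qed (use assms in \<open>auto simp: orbit_def neighbour_action_def orth_group_mem\<close>)

lemma orbit_special_orth:
  assumes "N \<in> neighbours A L"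
  shows "orbit (special_orth_group L) (neighbour_action A L) N
    = {h ` N | h. orthogonal_transformation h \<and> h ` L = L \<and> det (matrix h) = 1}"
proof (intro equalityI subsetI)
  fix M assume "M \<in> {h ` N | h. orthogonal_transformation h \<and> h ` L = L \<and> det (matrix h) = 1}"
  then obtain h where h: "orthogonal_transformation h" "h ` L = L" "M = h ` N" "det (matrix h) = 1" by blast
  have e: "(*v) (matrix h) = h" using matrix_vector_mul(2)[OF orthogonal_transformation_linear[OF h(1)]] by simp
  then have "matrix h \<in> carrier (special_orth_group L)" using h by (simp add: orth_group_mem special_orth_group_mem)
  then show "M \<in> orbit (special_orth_group L) (neighbour_action A L) N"
    unfolding orbit_def using h(3) e assms by (auto simp: neighbour_action_def intro!: exI[of _ "matrix h"])
next
  fix M assume "M \<in> orbit (special_orth_group L) (neighbour_action A L) N"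
  then obtain g where g: "g \<in> carrier (special_orth_group L)" "M = (*v) g ` N"
    using assms by (auto simp: orbit_def neighbour_action_def)
  then show "M \<in> {h ` N | h. orthogonal_transformation h \<and> h ` L = L \<and> det (matrix h) = 1}"
    by (intro CollectI exI[of _ "(*v) g"]) (simp add: orth_group_mem special_orth_group_mem)
qed

text \<open>All these neighbours are equivalent to \<open>N4\<close>, the form that the reflections
  reach. The base point is changed here to the neighbour to which \<open>E8_basis\<close> is
  adapted.\<close>

lemma E8_neighbours_4:
  "neighbours (elementary_2_group 4) E8 = {h ` E8_flip 4 ` E8 | h. orthogonal_transformation h \<and> h ` E8 = E8}"
proof (intro equalityI subsetI)
  let ?X = "neighbours (elementary_2_group 4) E8" and ?N = "E8_flip 4 ` E8"
  have N: "?N \<in> ?X" by (rule E8_flip_neighbour) simp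
  have nf: "\<exists>h. orthogonal_transformation h \<and> h ` E8 = E8 \<and> h ` M = N4" if M: "M \<in> ?X" for M
    using E8_neighbour_chain[OF M] normal_form_4 by blast
  obtain h where h: "orthogonal_transformation h" "h ` E8 = E8" "h ` ?N = N4" using nf[OF N] by blast
  fix M assume "M \<in> ?X"
  from nf[OF this] obtain h' where h': "orthogonal_transformation h'" "h' ` E8 = E8" "h' ` M = N4" by blast
  obtain g where "orthogonal_transformation g" "g ` E8 = E8" "g ` ?N = M"
    by (rule orth_connect[OF h orth_simps(4)[OF h(1)] h' orth_simps(4)[OF h'(1)]])
  then show "M \<in> {h ` ?N | h. orthogonal_transformation h \<and> h ` E8 = E8}" by blast
next
  fix M assume "M \<in> {h ` E8_flip 4 ` E8 | h. orthogonal_transformation h \<and> h ` E8 = E8}"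
  then show "M \<in> neighbours (elementary_2_group 4) E8"
    using neighbours_image[OF elementary_2_group _ _ E8_flip_neighbour[of 4]] by auto
qed

text \<open>For \<open>d\<close> equal to 1 and -1 these will be the two orbits of the special
  orthogonal group. An isometry from the base neighbour is determined up to its stabiliser, so that
  they differ rests on \<open>stabiliser_det\<close>.\<close>

definition E8_half :: "real \<Rightarrow> (real^8) set set" where
  "E8_half d = {h ` E8_flip 4 ` E8 | h. orthogonal_transformation h \<and> h ` E8 = E8 \<and> det (matrix h) = d}"

lemma E8_half_orbit:
  assumes h: "orthogonal_transformation h" "h ` E8 = E8"
  shows "orbit (special_orth_group E8) (neighbour_action (elementary_2_group 4) E8) (h ` E8_flip 4 ` E8)
    = E8_half (det (matrix h))"
proof -
  let ?N = "E8_flip 4 ` E8"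
  have "h ` ?N \<in> neighbours (elementary_2_group 4) E8" unfolding E8_neighbours_4 using h by blast
  note o = orbit_special_orth[OF this]
  show ?thesis unfolding o E8_half_def
  proof (intro equalityI subsetI)
    fix M assume "M \<in> {k ` h ` ?N | k. orthogonal_transformation k \<and> k ` E8 = E8 \<and> det (matrix k) = 1}"
    then obtain k where k: "M = k ` h ` ?N" "orthogonal_transformation k" "k ` E8 = E8" "det (matrix k) = 1" by blast
    show "M \<in> {k ` ?N | k. orthogonal_transformation k \<and> k ` E8 = E8 \<and> det (matrix k) = det (matrix h)}"
      using orthogonal_transformation_compose[OF k(2) h(1)] comp_image[OF h(2) k(3)] det_matrix_compose[OF h(1) k(2)] k(1,4)
      by (intro CollectI exI[of _ "k \<circ> h"]) (simp add: image_comp)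
  next
    fix M assume "M \<in> {k ` ?N | k. orthogonal_transformation k \<and> k ` E8 = E8 \<and> det (matrix k) = det (matrix h)}"
    then obtain k where k: "M = k ` ?N" "orthogonal_transformation k" "k ` E8 = E8" "det (matrix k) = det (matrix h)" by blast
    obtain i where i: "orthogonal_transformation i" "\<And>x. i (h x) = x" "\<And>x. h (i x) = x" using orth_inverse[OF h(1)] by metis
    have iE: "i ` E8 = E8" using arg_cong[OF h(2), of "(`) i"] by (simp add: image_image i(2))
    let ?k = "k \<circ> i"
    have ki: "(k \<circ> i) \<circ> h = k" using i(2) by auto
    have o: "orthogonal_transformation ?k" by (rule orthogonal_transformation_compose[OF k(2) i(1)])
    have "det (matrix ?k) * det (matrix h) = det (matrix h)" using det_matrix_compose[OF h(1) o] unfolding ki k(4) by simp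
    then have "det (matrix ?k) = 1" using det_orth_cases[OF h(1)] by auto
    moreover have "M = ?k ` h ` ?N" using k(1) by (simp add: image_image i(2))
    moreover have "?k ` E8 = E8" by (rule comp_image[OF iE k(3)])
    ultimately show "M \<in> {k ` h ` ?N | k. orthogonal_transformation k \<and> k ` E8 = E8 \<and> det (matrix k) = 1}"
      using o by blast
  qed
qed

lemma orthogonal_id:
  "orthogonal_transformation (id :: real^'n \<Rightarrow> real^'n)" "det (matrix (id :: real^'n \<Rightarrow> real^'n)) = 1"
proof -
  show "orthogonal_transformation (id :: real^'n \<Rightarrow> real^'n)" unfolding id_def by (rule orthogonal_transformation_id)
  show "det (matrix (id :: real^'n \<Rightarrow> real^'n)) = 1" unfolding matrix_id_mat_1 by (rule det_I)
qed

lemma E8_half_distinct: "E8_half 1 \<noteq> E8_half (-1)"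
proof
  assume "E8_half 1 = E8_half (-1)"
  moreover have "E8_flip 4 ` E8 \<in> E8_half 1" unfolding E8_half_def
    by (intro CollectI exI[of _ id]) (simp add: orthogonal_id)
  ultimately have "E8_flip 4 ` E8 \<in> E8_half (-1)" by simp
  then obtain h where "orthogonal_transformation h" "h ` E8 = E8" "det (matrix h) = -1"
    "E8_flip 4 ` E8 = h ` E8_flip 4 ` E8" unfolding E8_half_def by blast
  then show False using stabiliser_det[of h] by simp
qed

lemma E8_orbits:
  "orbits (special_orth_group E8) (neighbours (elementary_2_group 4) E8) (neighbour_action (elementary_2_group 4) E8)
    = {E8_half 1, E8_half (-1)}"
proof (intro equalityI subsetI)
  fix M assume "M \<in> orbits (special_orth_group E8) (neighbours (elementary_2_group 4) E8)
    (neighbour_action (elementary_2_group 4) E8)"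
  then obtain h where h: "orthogonal_transformation h" "h ` E8 = E8"
    "M = orbit (special_orth_group E8) (neighbour_action (elementary_2_group 4) E8) (h ` E8_flip 4 ` E8)"
    unfolding orbits_def E8_neighbours_4 by blast
  then show "M \<in> {E8_half 1, E8_half (-1)}" using E8_half_orbit[OF h(1,2)] det_orth_cases[OF h(1)] by auto
next
  have *: "E8_half (det (matrix h)) \<in> orbits (special_orth_group E8) (neighbours (elementary_2_group 4) E8)
    (neighbour_action (elementary_2_group 4) E8)" if "orthogonal_transformation h" "h ` E8 = E8" for h
    unfolding orbits_def E8_neighbours_4 E8_half_orbit[OF that, symmetric] using that by blast
  fix M assume "M \<in> {E8_half 1, E8_half (-1)}"
  \<comment> \<open>The identity and the reflection in the root \<open>half_ones\<close> realise the
    two determinants.\<close>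
  then show "M \<in> orbits (special_orth_group E8) (neighbours (elementary_2_group 4) E8)
    (neighbour_action (elementary_2_group 4) E8)"
    using *[OF orthogonal_id(1)] *[OF refln_orth[OF half_ones_root(2)] refln_image[OF even_group_E8 half_ones_root]]
    by (auto simp: orthogonal_id det_refln half_ones_root)
qed

theorem proposition1p0p2:
  fixes \<iota> :: "real^7 \<Rightarrow> real^8"
  assumes "hyperplane_isometry \<iota>"
  shows
    "(\<forall>i\<in>{1..3}. SO_transitive_on_neighbours (elementary_2_group i) (\<iota> -` E7) \<and>
                 SO_transitive_on_neighbours (elementary_2_group i) E8)
     \<and> (SO_transitive_on_neighbours (integer_mod_group 4) (\<iota> -` E7) \<and>
        SO_transitive_on_neighbours (integer_mod_group 4) E8)
     \<and> (let A = elementary_2_group 4; X = neighbours A E8; \<phi> = neighbour_action A E8 in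
          group_action (special_orth_group E8) X \<phi> \<and> group_action (orth_group E8) X \<phi> \<and>
          card (orbits (special_orth_group E8) X \<phi>) = 2 \<and>
          orbits (orth_group E8) X \<phi> = {\<Union> (orbits (special_orth_group E8) X \<phi>)})"
proof -
  have "i \<in> {1, 2, 3}" if "i \<in> {1..3}" for i :: nat using that by auto
  note 1 = E7_elementary_transitive[OF assms this] E8_elementary_transitive[OF this]
  let ?A = "elementary_2_group 4"
  let ?X = "neighbours ?A E8" and ?\<phi> = "neighbour_action ?A E8"
  have U: "E8_half 1 \<union> E8_half (-1) = ?X" unfolding E8_half_def E8_neighbours_4 using det_orth_cases by blast
  have "orbit (orth_group E8) ?\<phi> N = ?X" if N: "N \<in> ?X" for N
  proof -
    have "M \<in> {h ` N | h. orthogonal_transformation h \<and> h ` E8 = E8}" if M: "M \<in> ?X" for M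
    proof -
      obtain h k where h: "orthogonal_transformation h" "h ` E8 = E8" "h ` E8_flip 4 ` E8 = N"
        and k: "orthogonal_transformation k" "k ` E8 = E8" "k ` E8_flip 4 ` E8 = M"
        using M N unfolding E8_neighbours_4 by blast
      obtain i where i: "orthogonal_transformation i" "\<And>x. i (h x) = x" using orth_inverse[OF h(1)] by metis
      have iE: "i ` E8 = E8" using arg_cong[OF h(2), of "(`) i"] by (simp add: image_image i(2))
      have "M = (k \<circ> i) ` N" unfolding h(3)[symmetric] k(3)[symmetric] by (simp add: image_image i(2))
      then show ?thesis using orthogonal_transformation_compose[OF k(1) i(1)] comp_image[OF iE k(2)] by blast
    qed
    then show ?thesis unfolding orbit_orth[OF N] using neighbours_image[OF elementary_2_group _ _ N] by blast
  qed
  moreover have "?X \<noteq> {}" using E8_flip_neighbour[of 4] by auto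
  ultimately have O: "orbits (orth_group E8) ?X ?\<phi> = {?X}" unfolding orbits_def by auto
  have "card {E8_half 1, E8_half (-1)} = 2" using E8_half_distinct by simp
  then show ?thesis
    unfolding Let_def E8_orbits O
    using 1 E7_cyclic_transitive[OF assms] E8_cyclic_transitive U
      orth_group_action[OF elementary_2_group] special_orth_group_action[OF elementary_2_group] by auto
qed

end
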